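(* Let $(P_t)_{t\ge0}$ be a reversible Markov process with generator $\mathscr{L}$ and stationary distribution $\pi=\sum_{k=1}^mw_k\pi_k$, where the $\pi_k$ are probability measures, $w_k>0$, $\sum_kw_k=1$. Assume: 1. $\langle f,\mathscr{L}f\rangle_\pi\le\sum_{k=1}^mw_k\langle f,\mathscr{L}_kf\rangle_{\pi_k}$ for all $f$, where $\mathscr{L}_k$ is the generator of a Markov process with stationary distribution $\pi_k$; 2. for each $k$, $\operatorname{Ent}_{\pi_k}[f^2]\le2c_k\,\mathscr{E}_{\pi_k}(f,f)$ for all $f$, where $\mathscr{E}_{\pi_k}(f,f)=-\langle f,\mathscr{L}_kf\rangle_{\pi_k}$. Let $p>1$, $C^*=\max_kc_k$, $q(t)=1+(p-1)e^{2t/C^*}$ and $w^*=\min_kw_k$. Then for every $f>0$ the function $t\mapsto\|P_tf\|_{L^{q(t)}(\pi)}/(w^* )^{1/q(t)}$ is non-increasing; in particular, for all $t\ge0$, $$\frac{\|P_tf\|_{L^{q(t)}(\pi)}}{(w^* )^{1/q(t)}}\le\frac{\|f\|_{L^p(\pi)}}{(w^* )^{1/p}},$$ and $$\|P_tf\|_{L^{q(t)}(\pi)}\le\theta(q(t),p)\,\|f\|_{L^p(\pi)},\qquad\text{where }\theta(q,p)=\left(\frac1{w^*}\right)^{\frac1p-\frac1q}.$$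
   Context: $\langle f,g\rangle_\mu=\int fg\,d\mu$; $\operatorname{Ent}_\mu[h]=\mathbb{E}_\mu[h\log h]-\mathbb{E}_\mu[h]\log\mathbb{E}_\mu[h]$ for $h\ge0$. Inequalities involving generators are required for all $f$ for which both sides make sense; $f$ in the conclusion is a positive function in $L^p(\pi)$.
   Formalization: Hypothesis 1 is required for every f in the L²-domain of 𝓛; where f is outside the domain of 𝓛_k, ⟨f,𝓛_k f⟩ is read as the extended value liminf_{t→0}⟨f,(P^k_t f−f)/t⟩ in [−∞,0]. Asking it only on the common domain would make the claim false. C*>0 is assumed. *)

theory Defs
  imports "HOL-Probability.Probability"
begin

definition Lp_space :: "'a measure \<Rightarrow> real \<Rightarrow> ('a \<Rightarrow> real) set" where
  "Lp_space \<mu> p = {f \<in> borel_measurable \<mu>. integrable \<mu> (\<lambda>x. \<bar>f x\<bar> powr p)}"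

text \<open>Only meaningful for members of \<open>Lp_space \<mu> p\<close>: the Bochner integral of a non-integrable
  function is 0.\<close>

definition Lp_norm :: "'a measure \<Rightarrow> real \<Rightarrow> ('a \<Rightarrow> real) \<Rightarrow> real" where
  "Lp_norm \<mu> p f = (\<integral>x. \<bar>f x\<bar> powr p \<partial>\<mu>) powr (1 / p)"

definition inner_L2 :: "'a measure \<Rightarrow> ('a \<Rightarrow> real) \<Rightarrow> ('a \<Rightarrow> real) \<Rightarrow> real" where
  "inner_L2 \<mu> f g = (\<integral>x. f x * g x \<partial>\<mu>)"

definition Ent :: "'a measure \<Rightarrow> ('a \<Rightarrow> real) \<Rightarrow> real" where
  "Ent \<mu> h = (\<integral>x. h x * ln (h x) \<partial>\<mu>) - (\<integral>x. h x \<partial>\<mu>) * ln (\<integral>x. h x \<partial>\<mu>)"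

text \<open>A time-homogeneous Markov process is given by its transition function: \<open>K t x\<close> is the law
  at time \<open>t\<close> of the process started in \<open>x\<close>.\<close>

definition markov_op :: "(real \<Rightarrow> 'a \<Rightarrow> 'a measure) \<Rightarrow> real \<Rightarrow> ('a \<Rightarrow> real) \<Rightarrow> 'a \<Rightarrow> real" where
  "markov_op K t f x = (\<integral>y. f y \<partial>K t x)"

text \<open>Markov process with stationary distribution \<open>\<mu>\<close>. The last conjunct is strong continuity
  of the semigroup on \<open>L\<^sup>2(\<mu>)\<close>, which is what makes its generator densely defined.\<close>

definition markov_process :: "'a measure \<Rightarrow> (real \<Rightarrow> 'a \<Rightarrow> 'a measure) \<Rightarrow> bool" where
  "markov_process \<mu> K \<longleftrightarrow>
     prob_space \<mu> \<and>
     (\<forall>t\<ge>0. K t \<in> measurable \<mu> (prob_algebra \<mu>)) \<and>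
     (\<forall>x\<in>space \<mu>. K 0 x = return \<mu> x) \<and>
     (\<forall>s\<ge>0. \<forall>t\<ge>0. \<forall>x\<in>space \<mu>. K (s + t) x = bind (K s x) (K t)) \<and>
     (\<forall>t\<ge>0. bind \<mu> (K t) = \<mu>) \<and>
     (\<forall>f\<in>Lp_space \<mu> 2.
        ((\<lambda>t. Lp_norm \<mu> 2 (\<lambda>x. markov_op K t f x - f x)) \<longlongrightarrow> 0) (at_right 0))"

definition reversible :: "'a measure \<Rightarrow> (real \<Rightarrow> 'a \<Rightarrow> 'a measure) \<Rightarrow> bool" where
  "reversible \<mu> K \<longleftrightarrow>
     (\<forall>t\<ge>0. \<forall>f\<in>Lp_space \<mu> 2. \<forall>g\<in>Lp_space \<mu> 2.
        inner_L2 \<mu> f (markov_op K t g) = inner_L2 \<mu> (markov_op K t f) g)"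

definition gen_rel ::
    "'a measure \<Rightarrow> (real \<Rightarrow> 'a \<Rightarrow> 'a measure) \<Rightarrow> ('a \<Rightarrow> real) \<Rightarrow> ('a \<Rightarrow> real) \<Rightarrow> bool" where
  "gen_rel \<mu> K f g \<longleftrightarrow> f \<in> Lp_space \<mu> 2 \<and> g \<in> Lp_space \<mu> 2 \<and>
     ((\<lambda>t. Lp_norm \<mu> 2 (\<lambda>x. (markov_op K t f x - f x) / t - g x)) \<longlongrightarrow> 0) (at_right 0)"

definition gen_dom :: "'a measure \<Rightarrow> (real \<Rightarrow> 'a \<Rightarrow> 'a measure) \<Rightarrow> ('a \<Rightarrow> real) set" where
  "gen_dom \<mu> K = {f. \<exists>g. gen_rel \<mu> K f g}"

text \<open>The \<open>L\<^sup>2(\<mu>)\<close>-limit is determined up to a \<open>\<mu>\<close>-null set.\<close>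

definition gen :: "'a measure \<Rightarrow> (real \<Rightarrow> 'a \<Rightarrow> 'a measure) \<Rightarrow> ('a \<Rightarrow> real) \<Rightarrow> 'a \<Rightarrow> real" where
  "gen \<mu> K f = (SOME g. gen_rel \<mu> K f g)"

definition dirichlet_form ::
    "'a measure \<Rightarrow> (real \<Rightarrow> 'a \<Rightarrow> 'a measure) \<Rightarrow> ('a \<Rightarrow> real) \<Rightarrow> ('a \<Rightarrow> real) \<Rightarrow> real" where
  "dirichlet_form \<mu> K f g = - inner_L2 \<mu> f (gen \<mu> K g)"

text \<open>The quadratic form \<open>\<langle>f, L f\<rangle>\<close>, with values in \<open>[-\<infinity>, 0]\<close>, for every \<open>f\<close> in \<open>L\<^sup>2(\<mu>)\<close>.
  Outside the domain of the generator it is read in the usual sense of forms, as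
  \<open>lim \<langle>f, (P\<^sub>t f - f) / t\<rangle>\<close> for \<open>t\<close> decreasing to 0; for reversible processes this is a monotone
  limit, so \<open>Liminf\<close> is the limit, finite exactly on the domain of the Dirichlet form.\<close>

definition gen_form ::
    "'a measure \<Rightarrow> (real \<Rightarrow> 'a \<Rightarrow> 'a measure) \<Rightarrow> ('a \<Rightarrow> real) \<Rightarrow> ereal" where
  "gen_form \<mu> K f =
     (if f \<in> gen_dom \<mu> K then ereal (inner_L2 \<mu> f (gen \<mu> K f))
      else Liminf (at_right 0)
             (\<lambda>t. ereal (inner_L2 \<mu> f (\<lambda>x. (markov_op K t f x - f x) / t))))"

definition mixture :: "nat \<Rightarrow> (nat \<Rightarrow> real) \<Rightarrow> (nat \<Rightarrow> 'a measure) \<Rightarrow> 'a measure \<Rightarrow> bool" where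
  "mixture m w \<nu> \<mu> \<longleftrightarrow>
     (\<forall>k\<in>{1..m}. prob_space (\<nu> k) \<and> sets (\<nu> k) = sets \<mu> \<and> w k > 0) \<and>
     (\<Sum>k=1..m. w k) = 1 \<and>
     (\<forall>A\<in>sets \<mu>. measure \<mu> A = (\<Sum>k=1..m. w k * measure (\<nu> k) A))"

definition theta :: "real \<Rightarrow> real \<Rightarrow> real \<Rightarrow> real" where
  "theta ws q p = (1 / ws) powr (1 / p - 1 / q)"

end

theory Submission
  imports Defs
begin

text \<open>
  Averaging the component inequalities and bounding the entropy of the mixture weights gives the
  defective inequality \<open>Ent(g\<^sup>2) \<le> 2 C E(g, g) + ln (1 / w\<^sup>*) \<parallel>g\<parallel>\<^sup>2\<close> for \<open>\<pi>\<close>, and Gross's argument turns it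
  into monotonicity of \<open>(ln \<integral> (P\<^sub>t f)\<^bsup>q(t)\<^esup> + ln (1 / w\<^sup>*)) / q(t)\<close>, the Stroock--Varopoulos inequality
  comparing \<open>E(u\<^bsup>q-1\<^esup>, u)\<close> with \<open>E(u\<^bsup>q/2\<^esup>, u\<^bsup>q/2\<^esup>)\<close>.
  A function in the domain of one generator need not be in the domain of another, nor need its powers.
  The resolvent \<open>G = \<lambda> (\<lambda> - L)\<^sup>-\<^sup>1 h\<close> repairs this: it preserves bounds \<open>a \<le> h \<le> b\<close>, converges to \<open>h\<close> in
  \<open>L\<^sup>2\<close>, and its energy \<open>\<lambda> \<langle>G, h - G\<rangle> \<le> \<lambda> \<langle>h, h - G\<rangle>\<close> is asymptotically at most
  \<open>limsup \<langle>h, h - P\<^sub>t h\<rangle> / t\<close>, even for non-reversible processes. Only a lower right Dini derivative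
  of the monotone quantity is ever needed, so no regularity of \<open>t \<mapsto> E(P\<^sub>t f, P\<^sub>t f)\<close> enters.
\<close>

section \<open>Bounded measurable functions\<close>

text \<open>The exponent \<open>q(t)\<close> is forced by a cancellation. Formally N' <= q' I - q (4
  (q - 1) / q^2) E, where 4 (q - 1) / q^2 is the Stroock-Varopoulos constant, and the defective
  inequality gives E >= (q I - N ln N - D N) / (2 C). The terms in I cancel exactly when q' = 2 (q -
  1) / C. What remains is N' <= (q' / q) N (ln N + D), which says that (ln N + D) / q does not
  increase: the defect D is paid for by the power of w* in the quotient of the theorem. All of this
  is run on functions with values in a fixed \<open>{a..b}\<close>, \<open>a > 0\<close>, where
  every power and logarithm is bounded and continuous and \<open>P\<close> is defined pointwise.
  Resolvents enter in three places: for each component, for the main process at the power u^(q/2),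
  and for the initial datum, where membership in the domain makes t -> P_t G Lipschitz in L^2, so
  that second-order errors in one time step h are O(h^2). Truncation from above and below then
  reaches all positive f in L^p.\<close>

definition bdd_meas :: "'a measure \<Rightarrow> ('a \<Rightarrow> real) set" where
  "bdd_meas \<mu> = {u \<in> borel_measurable \<mu>. \<exists>B. \<forall>x\<in>space \<mu>. \<bar>u x\<bar> \<le> B}"

definition valued_in :: "'a measure \<Rightarrow> real \<Rightarrow> real \<Rightarrow> ('a \<Rightarrow> real) set" where
  "valued_in \<mu> a b = {u \<in> borel_measurable \<mu>. \<forall>x\<in>space \<mu>. u x \<in> {a..b}}"

lemma bdd_measD[measurable_dest]: "u \<in> bdd_meas \<mu> \<Longrightarrow> u \<in> borel_measurable \<mu>"
  by (simp add: bdd_meas_def)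

lemma bdd_measE:
  assumes "u \<in> bdd_meas \<mu>"
  obtains B where "B \<ge> 0" "\<And>x. x \<in> space \<mu> \<Longrightarrow> \<bar>u x\<bar> \<le> B"
proof -
  obtain B where "\<forall>x\<in>space \<mu>. \<bar>u x\<bar> \<le> B" using assms by (auto simp: bdd_meas_def)
  then show ?thesis by (intro that[of "max 0 B"]) (auto simp: le_max_iff_disj)
qed

lemma bdd_measI:
  assumes "u \<in> borel_measurable \<mu>" "\<And>x. x \<in> space \<mu> \<Longrightarrow> \<bar>u x\<bar> \<le> B"
  shows "u \<in> bdd_meas \<mu>"
  using assms by (auto simp: bdd_meas_def)

lemma valued_inD[measurable_dest]: "u \<in> valued_in \<mu> a b \<Longrightarrow> u \<in> borel_measurable \<mu>"
  by (simp add: valued_in_def)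

lemma valued_in_bounds: "u \<in> valued_in \<mu> a b \<Longrightarrow> x \<in> space \<mu> \<Longrightarrow> a \<le> u x \<and> u x \<le> b"
  by (simp add: valued_in_def)

lemma valued_in_bdd: "u \<in> valued_in \<mu> a b \<Longrightarrow> u \<in> bdd_meas \<mu>"
  by (rule bdd_measI[where B="max \<bar>a\<bar> \<bar>b\<bar>"]) (auto dest: valued_in_bounds valued_inD)

lemma bdd_meas_const[simp, intro]: "(\<lambda>_. c) \<in> bdd_meas \<mu>"
  by (rule bdd_measI[where B="\<bar>c\<bar>"]) auto

lemma bdd_meas_indicator[simp, intro]: "A \<in> sets \<mu> \<Longrightarrow> indicator A \<in> bdd_meas \<mu>"
  by (rule bdd_measI[where B=1]) (auto simp: indicator_def)

lemma bdd_meas_add[intro]: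
  assumes "u \<in> bdd_meas \<mu>" "v \<in> bdd_meas \<mu>" shows "(\<lambda>x. u x + v x) \<in> bdd_meas \<mu>"
proof -
  obtain B C where "\<And>x. x \<in> space \<mu> \<Longrightarrow> \<bar>u x\<bar> \<le> B" "\<And>x. x \<in> space \<mu> \<Longrightarrow> \<bar>v x\<bar> \<le> C"
    using assms by (metis bdd_measE)
  then have "\<bar>u x + v x\<bar> \<le> B + C" if "x \<in> space \<mu>" for x
    using that by (smt (verit))
  then show ?thesis using assms by (intro bdd_measI) (auto dest: bdd_measD)
qed

lemma bdd_meas_mult[intro]:
  assumes "u \<in> bdd_meas \<mu>" "v \<in> bdd_meas \<mu>" shows "(\<lambda>x. u x * v x) \<in> bdd_meas \<mu>"
proof -
  obtain B C where "\<And>x. x \<in> space \<mu> \<Longrightarrow> \<bar>u x\<bar> \<le> B" "\<And>x. x \<in> space \<mu> \<Longrightarrow> \<bar>v x\<bar> \<le> C" "B \<ge> 0" "C \<ge> 0"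
    using assms by (metis bdd_measE)
  then have "\<bar>u x * v x\<bar> \<le> B * C" if "x \<in> space \<mu>" for x
    using that by (auto simp: abs_mult intro!: mult_mono)
  then show ?thesis using assms by (intro bdd_measI) (auto dest: bdd_measD)
qed

lemma bdd_meas_minus[intro]: "u \<in> bdd_meas \<mu> \<Longrightarrow> (\<lambda>x. - u x) \<in> bdd_meas \<mu>"
  using bdd_meas_mult[of "\<lambda>_. -1" \<mu> u] by auto

lemma bdd_meas_diff[intro]:
  "u \<in> bdd_meas \<mu> \<Longrightarrow> v \<in> bdd_meas \<mu> \<Longrightarrow> (\<lambda>x. u x - v x) \<in> bdd_meas \<mu>"
  using bdd_meas_add[of u \<mu> "\<lambda>x. - v x"] by auto

lemma bdd_meas_divide[intro]: "u \<in> bdd_meas \<mu> \<Longrightarrow> (\<lambda>x. u x / c) \<in> bdd_meas \<mu>"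
  using bdd_meas_mult[of "\<lambda>_. 1 / c" \<mu> u] by auto

lemma bdd_meas_power2[intro]: "u \<in> bdd_meas \<mu> \<Longrightarrow> (\<lambda>x. (u x)\<^sup>2) \<in> bdd_meas \<mu>"
  unfolding power2_eq_square by (rule bdd_meas_mult)

lemma bdd_meas_integrable:
  assumes "finite_measure \<mu>" "u \<in> bdd_meas \<mu>" shows "integrable \<mu> u"
proof -
  interpret finite_measure \<mu> by fact
  from assms(2) obtain B where "\<And>x. x \<in> space \<mu> \<Longrightarrow> \<bar>u x\<bar> \<le> B" by (metis bdd_measE)
  then show ?thesis using assms(2)
    by (intro integrable_const_bound[where B=B]) (auto dest: bdd_measD)
qed

text \<open>A monotone class argument: indicators, multiples, sums and increasing limits exhaust the
  nonnegative functions, and positive and negative parts do the rest. Boundedness is a premise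
  inside the induction, because the induction runs over all nonnegative measurable functions while
  \<open>d\<close> is controlled on bounded ones only.\<close>

lemma bdd_meas_functional_zero:
  fixes d :: "('a \<Rightarrow> real) \<Rightarrow> real"
  assumes add: "\<And>u v. u \<in> bdd_meas \<mu> \<Longrightarrow> v \<in> bdd_meas \<mu> \<Longrightarrow> d (\<lambda>x. u x + v x) = d u + d v"
    and scale: "\<And>u c. u \<in> bdd_meas \<mu> \<Longrightarrow> d (\<lambda>x. c * u x) = c * d u"
    and ind: "\<And>A. A \<in> sets \<mu> \<Longrightarrow> d (indicator A) = 0"
    and lim: "\<And>U u. (\<And>i. U i \<in> bdd_meas \<mu>) \<Longrightarrow> u \<in> bdd_meas \<mu> \<Longrightarrow>
      (\<And>i x. x \<in> space \<mu> \<Longrightarrow> 0 \<le> U i x \<and> U i x \<le> u x) \<Longrightarrow>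
      (\<And>x. x \<in> space \<mu> \<Longrightarrow> (\<lambda>i. U i x) \<longlonglongrightarrow> u x) \<Longrightarrow> (\<lambda>i. d (U i)) \<longlonglongrightarrow> d u"
    and u: "u \<in> bdd_meas \<mu>"
  shows "d u = 0"
proof -
  have nonneg: "(\<exists>B. \<forall>x\<in>space \<mu>. u x \<le> B) \<longrightarrow> d u = 0"
    if "u \<in> borel_measurable \<mu>" "\<And>x. 0 \<le> u x" for u
    using that
  proof (induction rule: borel_measurable_induct_real)
    case (set A)
    then show ?case by (simp add: ind)
  next
    case (mult u c)
    show ?case
    proof (cases "c = 0")
      case True
      then show ?thesis using scale[of "\<lambda>_. 0" 0] by simp
    next
      case False
      with mult have c: "c > 0" by simp
      show ?thesis
      proof
        assume "\<exists>B. \<forall>x\<in>space \<mu>. c * u x \<le> B"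
        then obtain B where "\<forall>x\<in>space \<mu>. c * u x \<le> B" by blast
        then have B: "\<forall>x\<in>space \<mu>. u x \<le> B / c" using c by (simp add: field_simps)
        with mult have "u \<in> bdd_meas \<mu>" by (intro bdd_measI[where B="B / c"]) auto
        with B mult show "d (\<lambda>x. c * u x) = 0" by (auto simp: scale)
      qed
    qed
  next
    case (add u v)
    show ?case
    proof
      assume "\<exists>B. \<forall>x\<in>space \<mu>. v x + u x \<le> B"
      then obtain B where "\<forall>x\<in>space \<mu>. v x + u x \<le> B" by blast
      moreover have "0 \<le> u x" "0 \<le> v x" for x using add by auto
      ultimately have B: "\<forall>x\<in>space \<mu>. u x \<le> B" "\<forall>x\<in>space \<mu>. v x \<le> B"
        by (meson le_add_same_cancel1 le_add_same_cancel2 order_trans)+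
      with add have "u \<in> bdd_meas \<mu>" "v \<in> bdd_meas \<mu>" by (auto intro!: bdd_measI[where B=B])
      with B add show "d (\<lambda>x. v x + u x) = 0" by (subst assms(1)) auto
    qed
  next
    case (seq U)
    show ?case
    proof
      assume "\<exists>B. \<forall>x\<in>space \<mu>. u x \<le> B"
      then obtain B where B: "\<forall>x\<in>space \<mu>. u x \<le> B" by blast
      have le: "U i x \<le> u x" if "x \<in> space \<mu>" for i x
        using seq.hyps(3) seq.hyps(4)[OF that] by (intro incseq_le) (auto simp: incseq_def le_fun_def)
      have U: "U i \<in> bdd_meas \<mu>" for i
        using le B seq.hyps(1,2) by (intro bdd_measI[where B=B]) (auto intro: order_trans)
      have 0: "d (U i) = 0" for i using seq.IH[of i] le B by (meson order_trans)
      have "u \<in> bdd_meas \<mu>"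
        using B le[of _ 0] seq.hyps(2)[of 0] that by (intro bdd_measI[where B=B]) auto
      then have "(\<lambda>i. d (U i)) \<longlonglongrightarrow> d u" using U le seq.hyps(2,4) by (intro lim) auto
      then show "d u = 0" using 0 by (simp add: LIMSEQ_const_iff)
    qed
  qed
  obtain B where B: "\<And>x. x \<in> space \<mu> \<Longrightarrow> \<bar>u x\<bar> \<le> B" "B \<ge> 0" using u by (metis bdd_measE)
  let ?p = "\<lambda>x. max 0 (u x)" and ?n = "\<lambda>x. max 0 (- u x)"
  have "?p \<in> borel_measurable \<mu>" "?n \<in> borel_measurable \<mu>" using bdd_measD[OF u] by auto
  moreover have "\<forall>x\<in>space \<mu>. ?p x \<le> B \<and> ?n x \<le> B" using B by fastforce
  ultimately have "?p \<in> bdd_meas \<mu>" "?n \<in> bdd_meas \<mu>" "d ?p = 0" "d ?n = 0"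
    using nonneg[of ?p] nonneg[of ?n] by (auto intro!: bdd_measI[where B=B])
  moreover have "u = (\<lambda>x. ?p x + (-1) * ?n x)" by auto
  ultimately show ?thesis
    using assms(1)[of ?p "\<lambda>x. (-1) * ?n x"] scale[of ?n "-1"] bdd_meas_mult[of "\<lambda>_. -1" \<mu> ?n] by auto
qed

text \<open>Being squeezed between multiples of the integral makes the functional a measure on
  indicators that is absolutely continuous, so Radon-Nikodym applies. This is the device that
  produces actual functions, with bounds valid at every point, from weakly defined objects (adjoints
  and resolvents).\<close>

lemma bdd_meas_functional_density:
  fixes l :: "('a \<Rightarrow> real) \<Rightarrow> real"
  assumes fin: "finite_measure \<mu>"
    and add: "\<And>u v. u \<in> bdd_meas \<mu> \<Longrightarrow> v \<in> bdd_meas \<mu> \<Longrightarrow> l (\<lambda>x. u x + v x) = l u + l v"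
    and scale: "\<And>u c. u \<in> bdd_meas \<mu> \<Longrightarrow> l (\<lambda>x. c * u x) = c * l u"
    and bnd: "\<And>u. u \<in> bdd_meas \<mu> \<Longrightarrow> (\<And>x. x \<in> space \<mu> \<Longrightarrow> 0 \<le> u x) \<Longrightarrow>
      a * (\<integral>x. u x \<partial>\<mu>) \<le> l u \<and> l u \<le> b * (\<integral>x. u x \<partial>\<mu>)"
    and ab: "a \<le> b"
  obtains G where "G \<in> valued_in \<mu> a b" "\<And>u. u \<in> bdd_meas \<mu> \<Longrightarrow> l u = (\<integral>x. G x * u x \<partial>\<mu>)"
proof -
  interpret finite_measure \<mu> by fact
  note int = bdd_meas_integrable[OF fin]
  \<comment> \<open>Subtracting \<open>a\<close> times the integral makes the functional nonnegative
    and dominated by \<open>(b - a)\<close> times the integral.\<close>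
  define l' where "l' u = l u - a * (\<integral>x. u x \<partial>\<mu>)" for u
  have add': "l' (\<lambda>x. u x + v x) = l' u + l' v" if "u \<in> bdd_meas \<mu>" "v \<in> bdd_meas \<mu>" for u v
    using that int by (simp add: l'_def add algebra_simps)
  have scale': "l' (\<lambda>x. c * u x) = c * l' u" if "u \<in> bdd_meas \<mu>" for u c
    using that int by (simp add: l'_def scale algebra_simps)
  have bnd': "0 \<le> l' u \<and> l' u \<le> (b - a) * (\<integral>x. u x \<partial>\<mu>)"
    if "u \<in> bdd_meas \<mu>" "\<And>x. x \<in> space \<mu> \<Longrightarrow> 0 \<le> u x" for u
    using bnd[OF that] by (simp add: l'_def algebra_simps)
  have ind: "0 \<le> l' (indicator A) \<and> l' (indicator A) \<le> (b - a) * measure \<mu> A" if "A \<in> sets \<mu>" for A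
    using bnd'[of "indicator A"] that by simp
  define m where "m A = ennreal (l' (indicator A))" for A
  have pos: "positive (sets \<mu>) m"
    using ind[of "{}"] by (auto simp: positive_def m_def)
  have additive: "additive (sets \<mu>) m"
  unfolding additive_def
  proof (intro ballI impI)
    fix A B assume *: "A \<in> sets \<mu>" "B \<in> sets \<mu>" "A \<inter> B = {}"
    have "indicator (A \<union> B) = (\<lambda>x. indicator A x + indicator B x :: real)"
      using *(3) by (auto simp: fun_eq_iff indicator_def)
    then have "l' (indicator (A \<union> B)) = l' (indicator A) + l' (indicator B)"
      using * by (simp add: add')
    then show "m (A \<union> B) = m A + m B" using * ind by (simp add: m_def ennreal_plus)
  qed
  \<comment> \<open>Finite additivity upgrades to countable additivity by continuity at the empty
    set, which the domination by \<open>(b - a) * measure \<mu>\<close> supplies.\<close>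
  have ca: "countably_additive (sets \<mu>) m"
  proof (rule sets.empty_continuous_imp_countably_additive[OF pos additive])
    show "\<forall>A\<in>sets \<mu>. m A \<noteq> \<infinity>" by (simp add: m_def)
    fix A :: "nat \<Rightarrow> 'a set" assume A: "range A \<subseteq> sets \<mu>" "decseq A" "(\<Inter>i. A i) = {}"
    have As: "A i \<in> sets \<mu>" for i using A(1) by blast
    have "(\<lambda>i. measure \<mu> (A i)) \<longlonglongrightarrow> measure \<mu> (\<Inter>i. A i)"
      by (rule finite_Lim_measure_decseq[OF A(1,2)])
    then have "(\<lambda>i. (b - a) * measure \<mu> (A i)) \<longlonglongrightarrow> 0"
      unfolding A(3) by (intro tendsto_mult_right_zero) simp
    then have "(\<lambda>i. l' (indicator (A i))) \<longlonglongrightarrow> 0"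
      by (rule tendsto_sandwich[OF always_eventually always_eventually tendsto_const, rotated 2])
        (use ind[OF As] in blast)+
    then have "(\<lambda>i. ennreal (l' (indicator (A i)))) \<longlonglongrightarrow> ennreal 0" by (rule tendsto_ennrealI)
    then show "(\<lambda>i. m (A i)) \<longlonglongrightarrow> 0" unfolding m_def by simp
  qed
  define N where "N = measure_of (space \<mu>) (sets \<mu>) m"
  have setsN: "sets N = sets \<mu>" by (simp add: N_def)
  have emN: "emeasure N A = m A" if "A \<in> sets \<mu>" for A
    using that pos ca unfolding N_def by (intro emeasure_measure_of_sigma) (auto simp: sets.sigma_algebra_axioms)
  have finN: "finite_measure N"
    using setsN emN[of "space \<mu>"] sets_eq_imp_space_eq[OF setsN] by (intro finite_measureI) (simp add: m_def)
  have acN: "absolutely_continuous \<mu> N"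
    unfolding absolutely_continuous_def
  proof
    fix A assume "A \<in> null_sets \<mu>"
    then have A: "A \<in> sets \<mu>" "measure \<mu> A = 0" by (auto simp: measure_def)
    with ind[of A] have "l' (indicator A) = 0" by simp
    with A emN show "A \<in> null_sets N" by (auto simp: null_sets_def setsN m_def)
  qed
  obtain D where D[measurable]: "D \<in> borel_measurable \<mu>" "AE x in \<mu>. RN_deriv \<mu> N x = ennreal (D x)"
      "\<And>x. 0 \<le> D x"
    using real_RN_deriv[OF finN acN setsN] by metis
  have N: "N = density \<mu> (\<lambda>x. ennreal (D x))"
    using density_RN_deriv[OF acN setsN] D(2)
    by (subst density_RN_deriv[OF acN setsN, symmetric], intro density_cong) auto
  have "(\<integral>\<^sup>+x. ennreal (D x) \<partial>\<mu>) = emeasure N (space \<mu>)"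
    unfolding N by (subst emeasure_density) (auto intro!: nn_integral_cong)
  then have intD: "integrable \<mu> D"
    using emN[of "space \<mu>"] D by (intro integrableI_nonneg) (auto simp: m_def)
  have l'D: "l' (indicator A) = (\<integral>x. D x * indicator A x \<partial>\<mu>)" if A: "A \<in> sets \<mu>" for A
  proof -
    have "ennreal (l' (indicator A)) = (\<integral>\<^sup>+x. ennreal (D x) * indicator A x \<partial>\<mu>)"
      using emN[OF A] A unfolding m_def N by (subst (asm) emeasure_density) auto
    also have "\<dots> = (\<integral>\<^sup>+x. ennreal (D x * indicator A x) \<partial>\<mu>)"
      by (intro nn_integral_cong) (auto simp: indicator_def)
    also have "\<dots> = ennreal (\<integral>x. D x * indicator A x \<partial>\<mu>)"
      using A D intD by (intro nn_integral_eq_integral integrable_real_mult_indicator) auto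
    finally have "ennreal (l' (indicator A)) = ennreal (\<integral>x. D x * indicator A x \<partial>\<mu>)" .
    moreover have "0 \<le> (\<integral>x. D x * indicator A x \<partial>\<mu>)" using D(3) by (intro Bochner_Integration.integral_nonneg) auto
    ultimately show ?thesis using ind[OF A] by (simp add: ennreal_inj)
  qed
  \<comment> \<open>Test the density on the set where the bound fails: the integral of the excess
    over that set is both nonnegative and nonpositive.\<close>
  have AED: "AE x in \<mu>. D x \<le> b - a"
  proof -
    define A where "A = {x \<in> space \<mu>. b - a < D x}"
    have A[measurable]: "A \<in> sets \<mu>" unfolding A_def by measurable
    let ?g = "\<lambda>x. (D x - (b - a)) * indicator A x"
    have "integrable \<mu> (\<lambda>x. D x * indicator A x)" "integrable \<mu> (\<lambda>x. (b - a) * indicator A x :: real)"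
      using A intD int[OF bdd_meas_indicator[OF A]] by (auto intro!: integrable_real_mult_indicator)
    moreover have "?g = (\<lambda>x. D x * indicator A x - (b - a) * indicator A x)"
      by (auto simp: algebra_simps)
    ultimately have ig: "integrable \<mu> ?g" "(\<integral>x. ?g x \<partial>\<mu>) = l' (indicator A) - (b - a) * measure \<mu> A"
      using A l'D[OF A] by simp_all
    have nn: "\<And>x. 0 \<le> ?g x" by (auto simp: A_def indicator_def)
    then have "0 \<le> (\<integral>x. ?g x \<partial>\<mu>)" by (rule Bochner_Integration.integral_nonneg)
    then have "(\<integral>x. ?g x \<partial>\<mu>) = 0" using ig(2) ind[OF A] by linarith
    then have "AE x in \<mu>. ?g x = 0"
      using integral_nonneg_eq_0_iff_AE[OF ig(1)] nn by auto
    then show ?thesis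
      using AE_space by eventually_elim (auto simp: A_def indicator_def split: if_splits)
  qed
  have all: "l' u - (\<integral>x. D x * u x \<partial>\<mu>) = 0" if u: "u \<in> bdd_meas \<mu>" for u
  proof -
    have iD: "integrable \<mu> (\<lambda>x. D x * u x)" if u: "u \<in> bdd_meas \<mu>" for u
    proof -
      obtain B where "B \<ge> 0" "\<And>x. x \<in> space \<mu> \<Longrightarrow> \<bar>u x\<bar> \<le> B" using u by (metis bdd_measE)
      then show ?thesis using u D
        by (intro Bochner_Integration.integrable_bound[OF integrable_mult_left[OF intD, of B]])
          (auto simp: abs_mult dest: bdd_measD intro!: AE_I2 mult_left_mono)
    qed
    show ?thesis
    proof (rule bdd_meas_functional_zero[where d="\<lambda>u. l' u - (\<integral>x. D x * u x \<partial>\<mu>)", OF _ _ _ _ u])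
      fix U :: "nat \<Rightarrow> 'a \<Rightarrow> real" and u
      assume U: "\<And>i. U i \<in> bdd_meas \<mu>" "u \<in> bdd_meas \<mu>"
        "\<And>i x. x \<in> space \<mu> \<Longrightarrow> 0 \<le> U i x \<and> U i x \<le> u x" "\<And>x. x \<in> space \<mu> \<Longrightarrow> (\<lambda>i. U i x) \<longlonglongrightarrow> u x"
      have "(\<lambda>i. \<integral>x. U i x \<partial>\<mu>) \<longlonglongrightarrow> (\<integral>x. u x \<partial>\<mu>)"
        using U int by (intro integral_dominated_convergence[where w=u]) (auto dest: bdd_measD)
      then have lim: "(\<lambda>i. (b - a) * ((\<integral>x. u x \<partial>\<mu>) - (\<integral>x. U i x \<partial>\<mu>))) \<longlonglongrightarrow> (b - a) * ((\<integral>x. u x \<partial>\<mu>) - (\<integral>x. u x \<partial>\<mu>))"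
        by (intro tendsto_intros)
      have e: "0 \<le> l' u - l' (U i) \<and> l' u - l' (U i) \<le> (b - a) * ((\<integral>x. u x \<partial>\<mu>) - (\<integral>x. U i x \<partial>\<mu>))" for i
      proof -
        have "l' (\<lambda>x. u x - U i x) = l' u - l' (U i)"
          using add'[of u "\<lambda>x. (-1) * U i x"] scale'[of "U i" "-1"] U bdd_meas_mult[of "\<lambda>_. -1" \<mu> "U i"] by simp
        then show ?thesis using bnd'[of "\<lambda>x. u x - U i x"] U int by auto
      qed
      have "(\<lambda>i. l' u - l' (U i)) \<longlonglongrightarrow> 0"
        by (rule tendsto_sandwich[OF _ _ tendsto_const]) (use e lim in auto)
      then have "(\<lambda>i. l' u - (l' u - l' (U i))) \<longlonglongrightarrow> l' u - 0" by (intro tendsto_intros)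
      moreover have "(\<lambda>i. \<integral>x. D x * U i x \<partial>\<mu>) \<longlonglongrightarrow> (\<integral>x. D x * u x \<partial>\<mu>)"
        using U D iD by (intro integral_dominated_convergence[where w="\<lambda>x. D x * u x"])
          (auto dest: bdd_measD intro!: tendsto_intros mult_left_mono AE_I2)
      ultimately show "(\<lambda>i. l' (U i) - (\<integral>x. D x * U i x \<partial>\<mu>)) \<longlonglongrightarrow> l' u - (\<integral>x. D x * u x \<partial>\<mu>)"
        by (intro tendsto_intros) simp_all
    qed (use iD add' scale' l'D in \<open>simp_all add: bdd_meas_add bdd_meas_mult ring_distribs mult.left_commute\<close>)
  qed
  \<comment> \<open>Capping \<open>D\<close> changes it on a null set only, but turns the
    almost-everywhere bound into the everywhere bound that \<open>valued_in\<close> demands.\<close>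
  define G where "G x = a + min (b - a) (D x)" for x
  have GD: "AE x in \<mu>. G x = a + D x" using AED by eventually_elim (auto simp: G_def)
  have G: "G \<in> valued_in \<mu> a b" unfolding valued_in_def G_def using D ab by auto
  show ?thesis
  proof (rule that[OF G])
    fix u assume u: "u \<in> bdd_meas \<mu>"
    have iG: "integrable \<mu> (\<lambda>x. G x * u x)" using int[OF bdd_meas_mult[OF valued_in_bdd[OF G] u]] .
    have "(\<integral>x. D x * u x \<partial>\<mu>) = (\<integral>x. G x * u x - a * u x \<partial>\<mu>)"
      using GD G u by (intro integral_cong_AE) (auto dest: valued_inD bdd_measD simp: algebra_simps)
    also have "\<dots> = (\<integral>x. G x * u x \<partial>\<mu>) - a * (\<integral>x. u x \<partial>\<mu>)"
      using iG int[OF u] by simp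
    finally show "l u = (\<integral>x. G x * u x \<partial>\<mu>)" using all[OF u] by (simp add: l'_def)
  qed
qed

section \<open>The L^2 inner product and norm\<close>

lemma Lp_space_2: "f \<in> Lp_space \<mu> 2 \<longleftrightarrow> f \<in> borel_measurable \<mu> \<and> integrable \<mu> (\<lambda>x. (f x)\<^sup>2)"
  by (simp add: Lp_space_def)

lemma Lp_norm_2: "Lp_norm \<mu> 2 f = sqrt (\<integral>x. (f x)\<^sup>2 \<partial>\<mu>)"
proof -
  have "0 \<le> (\<integral>x. (f x)\<^sup>2 \<partial>\<mu>)" by (intro Bochner_Integration.integral_nonneg) simp
  then show ?thesis by (simp add: Lp_norm_def powr_half_sqrt)
qed

lemma Lp_norm_2_nonneg[simp]: "0 \<le> Lp_norm \<mu> 2 f"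
  by (simp add: Lp_norm_def)

lemma Lp_norm_2_power2: "(Lp_norm \<mu> 2 f)\<^sup>2 = (\<integral>x. (f x)\<^sup>2 \<partial>\<mu>)"
  by (simp add: Lp_norm_2 Bochner_Integration.integral_nonneg)

lemma L2_mult_integrable:
  assumes "f \<in> Lp_space \<mu> 2" "g \<in> Lp_space \<mu> 2"
  shows "integrable \<mu> (\<lambda>x. f x * g x)"
proof (rule Bochner_Integration.integrable_bound)
  show "integrable \<mu> (\<lambda>x. (f x)\<^sup>2 + (g x)\<^sup>2)" "(\<lambda>x. f x * g x) \<in> borel_measurable \<mu>"
    using assms by (auto simp: Lp_space_2)
  have "\<bar>f x * g x\<bar> \<le> (f x)\<^sup>2 + (g x)\<^sup>2" for x
  proof -
    have "2 * (\<bar>f x\<bar> * \<bar>g x\<bar>) \<le> (f x)\<^sup>2 + (g x)\<^sup>2"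
      using sum_squares_bound[of "\<bar>f x\<bar>" "\<bar>g x\<bar>"] by (simp add: mult.assoc)
    moreover have "0 \<le> \<bar>f x\<bar> * \<bar>g x\<bar>" by simp
    ultimately show ?thesis unfolding abs_mult by linarith
  qed
  then show "AE x in \<mu>. norm (f x * g x) \<le> norm ((f x)\<^sup>2 + (g x)\<^sup>2)"
    by (intro AE_I2) (simp add: abs_of_nonneg)
qed

lemma L2_add:
  assumes "f \<in> Lp_space \<mu> 2" "g \<in> Lp_space \<mu> 2"
  shows "(\<lambda>x. f x + g x) \<in> Lp_space \<mu> 2"
  using assms L2_mult_integrable[OF assms] by (auto simp: Lp_space_2 power2_sum mult.assoc)

lemma L2_scale: "f \<in> Lp_space \<mu> 2 \<Longrightarrow> (\<lambda>x. c * f x) \<in> Lp_space \<mu> 2"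
  by (auto simp: Lp_space_2 power_mult_distrib)

lemma L2_diff:
  assumes "f \<in> Lp_space \<mu> 2" "g \<in> Lp_space \<mu> 2"
  shows "(\<lambda>x. f x - g x) \<in> Lp_space \<mu> 2"
  using L2_add[OF assms(1) L2_scale[OF assms(2), of "-1"]] by simp

lemma bdd_meas_L2: "finite_measure \<mu> \<Longrightarrow> u \<in> bdd_meas \<mu> \<Longrightarrow> u \<in> Lp_space \<mu> 2"
  by (auto simp: Lp_space_2 dest: bdd_measD intro!: bdd_meas_integrable)

text \<open>The quadratic polynomial s -> integral of (f + s g)^2 is nonnegative, so its
  discriminant is not positive; the degenerate case \<open>C = 0\<close> is separate.\<close>

lemma Cauchy_Schwarz_L2:
  assumes f: "f \<in> Lp_space \<mu> 2" and g: "g \<in> Lp_space \<mu> 2"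
  shows "\<bar>\<integral>x. f x * g x \<partial>\<mu>\<bar> \<le> Lp_norm \<mu> 2 f * Lp_norm \<mu> 2 g"
proof -
  define A B C where "A = (\<integral>x. (f x)\<^sup>2 \<partial>\<mu>)" and "B = (\<integral>x. f x * g x \<partial>\<mu>)" and "C = (\<integral>x. (g x)\<^sup>2 \<partial>\<mu>)"
  have int: "integrable \<mu> (\<lambda>x. (f x)\<^sup>2)" "integrable \<mu> (\<lambda>x. f x * g x)" "integrable \<mu> (\<lambda>x. (g x)\<^sup>2)"
    using f g L2_mult_integrable by (auto simp: Lp_space_2)
  have q: "0 \<le> A + 2 * s * B + s\<^sup>2 * C" for s
  proof -
    have "0 \<le> (\<integral>x. (f x + s * g x)\<^sup>2 \<partial>\<mu>)" by (intro Bochner_Integration.integral_nonneg) simp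
    also have "\<dots> = (\<integral>x. (f x)\<^sup>2 + 2 * s * (f x * g x) + s\<^sup>2 * (g x)\<^sup>2 \<partial>\<mu>)"
      by (intro Bochner_Integration.integral_cong) (auto simp: power2_eq_square algebra_simps)
    also have "\<dots> = A + 2 * s * B + s\<^sup>2 * C" using int by (simp add: A_def B_def C_def)
    finally show ?thesis .
  qed
  have nn: "0 \<le> A" "0 \<le> C" by (auto simp: A_def C_def intro!: Bochner_Integration.integral_nonneg)
  have "B\<^sup>2 \<le> A * C"
  proof (cases "C = 0")
    case True
    have "B = 0"
    proof (rule ccontr)
      assume "B \<noteq> 0"
      \<comment> \<open>With \<open>C = 0\<close> the polynomial is affine, and this
        \<open>s\<close> gives it the value -1.\<close>
      then show False using q[of "- (A + 1) / (2 * B)"] True by (simp add: field_simps)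
    qed
    then show ?thesis using True by simp
  next
    case False
    with nn have "C > 0" by simp
    \<comment> \<open>The minimiser of the quadratic polynomial.\<close>
    then have "0 \<le> (A + 2 * (- B / C) * B + (- B / C)\<^sup>2 * C) * C" using q[of "- B / C"] by (intro mult_nonneg_nonneg) auto
    also have "\<dots> = A * C - B\<^sup>2" using \<open>C > 0\<close> by (simp add: power2_eq_square field_simps)
    finally show ?thesis by simp
  qed
  then have "sqrt (B\<^sup>2) \<le> sqrt (A * C)" by (rule real_sqrt_le_mono)
  then show ?thesis by (simp add: Lp_norm_2 real_sqrt_mult A_def B_def C_def)
qed

lemma Minkowski_L2:
  assumes f: "f \<in> Lp_space \<mu> 2" and g: "g \<in> Lp_space \<mu> 2"
  shows "Lp_norm \<mu> 2 (\<lambda>x. f x + g x) \<le> Lp_norm \<mu> 2 f + Lp_norm \<mu> 2 g"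
proof (rule power2_le_imp_le)
  have "(\<integral>x. (f x + g x)\<^sup>2 \<partial>\<mu>) = (\<integral>x. (f x)\<^sup>2 + (g x)\<^sup>2 + 2 * (f x * g x) \<partial>\<mu>)"
    by (intro Bochner_Integration.integral_cong) (auto simp: power2_eq_square algebra_simps)
  also have "\<dots> = (\<integral>x. (f x)\<^sup>2 \<partial>\<mu>) + (\<integral>x. (g x)\<^sup>2 \<partial>\<mu>) + 2 * (\<integral>x. f x * g x \<partial>\<mu>)"
    using f g L2_mult_integrable[OF f g] by (simp add: Lp_space_2)
  also have "\<dots> \<le> (Lp_norm \<mu> 2 f + Lp_norm \<mu> 2 g)\<^sup>2"
    using Cauchy_Schwarz_L2[OF f g] by (simp add: power2_sum Lp_norm_2_power2)
  finally show "(Lp_norm \<mu> 2 (\<lambda>x. f x + g x))\<^sup>2 \<le> (Lp_norm \<mu> 2 f + Lp_norm \<mu> 2 g)\<^sup>2"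
    by (simp add: Lp_norm_2_power2)
qed simp

lemma Lp_norm_2_scale: "Lp_norm \<mu> 2 (\<lambda>x. c * f x) = \<bar>c\<bar> * Lp_norm \<mu> 2 f"
  by (simp add: Lp_norm_2 power_mult_distrib real_sqrt_mult)

lemma Lp_norm_cong:
  assumes "\<And>x. x \<in> space \<mu> \<Longrightarrow> f x = g x" shows "Lp_norm \<mu> p f = Lp_norm \<mu> p g"
  using assms by (simp add: Lp_norm_def cong: Bochner_Integration.integral_cong)

lemma (in prob_space) Lp_norm_2_le_bound:
  assumes "u \<in> borel_measurable M" "\<And>x. x \<in> space M \<Longrightarrow> \<bar>u x\<bar> \<le> B"
  shows "Lp_norm M 2 u \<le> B"
proof -
  have "B \<ge> 0" using not_empty assms(2) by fastforce
  have "u \<in> bdd_meas M" using assms by (rule bdd_measI)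
  then have "integrable M (\<lambda>x. (u x)\<^sup>2)" by (intro bdd_meas_integrable finite_measure_axioms bdd_meas_power2)
  then have "(\<integral>x. (u x)\<^sup>2 \<partial>M) \<le> B\<^sup>2"
    using assms(2) \<open>B \<ge> 0\<close> by (intro integral_le_const AE_I2) (auto intro!: power2_le_iff_abs_le[THEN iffD2])
  then show ?thesis using \<open>B \<ge> 0\<close> by (metis Lp_norm_2 real_sqrt_le_mono real_sqrt_abs abs_of_nonneg)
qed

section \<open>Continuous nonlinearities under L^2 convergence of bounded functions\<close>

lemma valued_in_comp_bdd:
  assumes "continuous_on {a..b} \<phi>" "u \<in> valued_in \<mu> a b"
  shows "(\<lambda>x. \<phi> (u x)) \<in> bdd_meas \<mu>"
proof -
  have "u \<in> measurable \<mu> (restrict_space borel {a..b})"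
    using assms(2) by (intro measurable_restrict_space2) (auto simp: valued_in_def)
  then have m: "(\<lambda>x. \<phi> (u x)) \<in> borel_measurable \<mu>"
    using borel_measurable_continuous_on_restrict[OF assms(1)] by (rule measurable_compose)
  have "bounded (\<phi> ` {a..b})" using assms(1) by (intro compact_imp_bounded compact_continuous_image) auto
  then obtain B where "\<forall>y\<in>\<phi> ` {a..b}. norm y \<le> B" by (auto simp: bounded_iff)
  then show ?thesis using m assms(2) by (intro bdd_measI[where B=B]) (auto simp: valued_in_def)
qed

text \<open>Trades the modulus of continuity for a quadratic error, so that \<open>L\<^sup>2\<close>-convergence of uniformly
  bounded functions passes through every continuous nonlinearity without extracting subsequences.\<close>

lemma continuous_quadratic_bound:
  fixes F :: "real \<Rightarrow> real \<Rightarrow> real"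
  assumes F: "continuous_on ({a..b} \<times> {c..d}) (\<lambda>(x, q). F x q)" and e: "e > 0"
  obtains B where "B \<ge> 0"
    "\<And>x y q r. \<lbrakk>x \<in> {a..b}; y \<in> {a..b}; q \<in> {c..d}; r \<in> {c..d}\<rbrakk> \<Longrightarrow>
      \<bar>F x q - F y r\<bar> \<le> e + B * ((x - y)\<^sup>2 + (q - r)\<^sup>2)"
proof -
  have cpt: "compact ({a..b} \<times> {c..d})" by (intro compact_Times) auto
  then have "bounded ((\<lambda>(x, q). F x q) ` ({a..b} \<times> {c..d}))"
    using F by (intro compact_imp_bounded compact_continuous_image)
  then obtain A where A: "\<forall>y\<in>(\<lambda>(x, q). F x q) ` ({a..b} \<times> {c..d}). norm y \<le> A" by (auto simp: bounded_iff)
  have "uniformly_continuous_on ({a..b} \<times> {c..d}) (\<lambda>(x, q). F x q)"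
    using F cpt by (rule compact_uniformly_continuous)
  then obtain \<delta> where \<delta>: "\<delta> > 0" "\<forall>z\<in>{a..b} \<times> {c..d}. \<forall>z'\<in>{a..b} \<times> {c..d}.
      dist z' z < \<delta> \<longrightarrow> dist ((\<lambda>(x, q). F x q) z') ((\<lambda>(x, q). F x q) z) < e"
    using e unfolding uniformly_continuous_on_def by metis
  show ?thesis
  \<comment> \<open>Points closer than \<open>\<delta>\<close> are served by uniform continuity; for
    the others the crude bound 2 |A| is at most this constant times the squared distance.\<close>
  proof (rule that[of "2 * \<bar>A\<bar> / \<delta>\<^sup>2"])
    fix x y q r assume *: "x \<in> {a..b}" "y \<in> {a..b}" "q \<in> {c..d}" "r \<in> {c..d}"
    have d: "dist (x, q) (y, r) = sqrt ((x - y)\<^sup>2 + (q - r)\<^sup>2)" by (simp add: dist_Pair_Pair dist_real_def)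
    show "\<bar>F x q - F y r\<bar> \<le> e + 2 * \<bar>A\<bar> / \<delta>\<^sup>2 * ((x - y)\<^sup>2 + (q - r)\<^sup>2)"
    proof (cases "dist (x, q) (y, r) < \<delta>")
      case True
      have "\<bar>F x q - F y r\<bar> < e"
        using \<delta>(2)[rule_format, of "(y, r)" "(x, q)"] * True by (simp add: dist_real_def)
      moreover have "0 \<le> 2 * \<bar>A\<bar> / \<delta>\<^sup>2 * ((x - y)\<^sup>2 + (q - r)\<^sup>2)" by simp
      ultimately show ?thesis by linarith
    next
      case False
      then have "\<delta>\<^sup>2 \<le> (dist (x, q) (y, r))\<^sup>2" using \<delta>(1) by (intro power_mono) auto
      then have "\<delta>\<^sup>2 \<le> (x - y)\<^sup>2 + (q - r)\<^sup>2" unfolding d by simp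
      then have "2 * \<bar>A\<bar> * \<delta>\<^sup>2 \<le> 2 * \<bar>A\<bar> * ((x - y)\<^sup>2 + (q - r)\<^sup>2)" by (intro mult_left_mono) auto
      then have "2 * \<bar>A\<bar> \<le> 2 * \<bar>A\<bar> / \<delta>\<^sup>2 * ((x - y)\<^sup>2 + (q - r)\<^sup>2)" using \<delta>(1) by (simp add: field_simps)
      moreover have "\<bar>F x q\<bar> \<le> A" "\<bar>F y r\<bar> \<le> A" using A * by auto
      ultimately show ?thesis using e by linarith
    qed
  qed simp
qed

text \<open>Integrating the quadratic bound leaves e/2 + B (||u_i - v||^2 + (q_i - r)^2). The second
  argument of \<open>F\<close> moves along with the function because the exponent q(t) changes
  together with P_t f.\<close>

lemma (in prob_space) integral_tendsto_valued_in:
  fixes F :: "real \<Rightarrow> real \<Rightarrow> real" and q :: "'b \<Rightarrow> real"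
  assumes F: "continuous_on ({a..b} \<times> {c..d}) (\<lambda>(x, q). F x q)"
    and u: "eventually (\<lambda>i. u i \<in> valued_in M a b) Fi" and v: "v \<in> valued_in M a b"
    and lim: "((\<lambda>i. Lp_norm M 2 (\<lambda>x. u i x - v x)) \<longlongrightarrow> 0) Fi"
    and q: "(q \<longlongrightarrow> r) Fi" "eventually (\<lambda>i. q i \<in> {c..d}) Fi" "r \<in> {c..d}"
  shows "((\<lambda>i. \<integral>x. F (u i x) (q i) \<partial>M) \<longlongrightarrow> (\<integral>x. F (v x) r \<partial>M)) Fi"
proof (rule tendstoI)
  fix e :: real assume "e > 0"
  then have "e / 2 > 0" by simp
  then obtain B where B: "B \<ge> 0" "\<And>x y q r. \<lbrakk>x \<in> {a..b}; y \<in> {a..b}; q \<in> {c..d}; r \<in> {c..d}\<rbrakk> \<Longrightarrow>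
      \<bar>F x q - F y r\<bar> \<le> e / 2 + B * ((x - y)\<^sup>2 + (q - r)\<^sup>2)"
    using continuous_quadratic_bound[OF F] by metis
  have "((\<lambda>i. B * ((Lp_norm M 2 (\<lambda>x. u i x - v x))\<^sup>2 + (q i - r)\<^sup>2)) \<longlongrightarrow> B * (0\<^sup>2 + (r - r)\<^sup>2)) Fi"
    by (intro tendsto_mult tendsto_const tendsto_add tendsto_power lim tendsto_diff q)
  then have small: "eventually (\<lambda>i. B * ((Lp_norm M 2 (\<lambda>x. u i x - v x))\<^sup>2 + (q i - r)\<^sup>2) < e / 2) Fi"
    using \<open>e > 0\<close> by (intro order_tendstoD) auto
  have cont: "continuous_on {a..b} (\<lambda>x. F x q)" if "q \<in> {c..d}" for q
  proof -
    have "continuous_on {a..b} (\<lambda>x. (\<lambda>(x, q). F x q) (x, q))"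
      using that by (intro continuous_on_compose2[OF F]) (auto intro!: continuous_intros)
    then show ?thesis by simp
  qed
  show "eventually (\<lambda>i. dist (\<integral>x. F (u i x) (q i) \<partial>M) (\<integral>x. F (v x) r \<partial>M) < e) Fi"
    using small u q(2)
  proof eventually_elim
    case (elim i)
    note int = bdd_meas_integrable[OF finite_measure_axioms]
    have i1: "integrable M (\<lambda>x. F (u i x) (q i))" "integrable M (\<lambda>x. F (v x) r)"
      using int valued_in_comp_bdd cont elim q(3) v by blast+
    have i2: "integrable M (\<lambda>x. (u i x - v x)\<^sup>2)"
      by (intro int bdd_meas_power2 bdd_meas_diff valued_in_bdd[OF elim(2)] valued_in_bdd[OF v])
    have "\<bar>(\<integral>x. F (u i x) (q i) \<partial>M) - (\<integral>x. F (v x) r \<partial>M)\<bar> = \<bar>\<integral>x. F (u i x) (q i) - F (v x) r \<partial>M\<bar>"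
      using i1 by simp
    also have "\<dots> \<le> (\<integral>x. \<bar>F (u i x) (q i) - F (v x) r\<bar> \<partial>M)" by (rule integral_abs_bound)
    also have "\<dots> \<le> (\<integral>x. e / 2 + B * ((u i x - v x)\<^sup>2 + (q i - r)\<^sup>2) \<partial>M)"
    proof (rule integral_mono)
      show "integrable M (\<lambda>x. \<bar>F (u i x) (q i) - F (v x) r\<bar>)" using i1 by simp
      show "integrable M (\<lambda>x. e / 2 + B * ((u i x - v x)\<^sup>2 + (q i - r)\<^sup>2))" using i2 by simp
      show "\<bar>F (u i x) (q i) - F (v x) r\<bar> \<le> e / 2 + B * ((u i x - v x)\<^sup>2 + (q i - r)\<^sup>2)"
        if "x \<in> space M" for x
        using elim(2,3) v q(3) that by (intro B(2)) (simp_all add: valued_in_def)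
    qed
    also have "\<dots> = e / 2 + B * ((Lp_norm M 2 (\<lambda>x. u i x - v x))\<^sup>2 + (q i - r)\<^sup>2)"
      using i2 by (simp add: Lp_norm_2_power2 prob_space)
    finally show ?case using elim(1) by (simp add: dist_real_def)
  qed
qed

section \<open>The semigroup on bounded functions\<close>

locale markov = prob_space \<mu> for \<mu> :: "'a measure" +
  fixes K :: "real \<Rightarrow> 'a \<Rightarrow> 'a measure"
  assumes process: "markov_process \<mu> K"
begin

abbreviation P :: "real \<Rightarrow> ('a \<Rightarrow> real) \<Rightarrow> 'a \<Rightarrow> real" where
  "P \<equiv> markov_op K"

abbreviation nrm :: "('a \<Rightarrow> real) \<Rightarrow> real" where
  "nrm \<equiv> Lp_norm \<mu> 2"

lemma kernel: "t \<ge> 0 \<Longrightarrow> K t \<in> measurable \<mu> (prob_algebra \<mu>)"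
  using process by (simp add: markov_process_def)

lemma kernel_sub: "t \<ge> 0 \<Longrightarrow> K t \<in> measurable \<mu> (subprob_algebra \<mu>)"
  using kernel by (rule measurable_prob_algebraD)

lemma kernelD:
  assumes "t \<ge> 0" "x \<in> space \<mu>"
  shows "prob_space (K t x)" "sets (K t x) = sets \<mu>" "space (K t x) = space \<mu>"
    "borel_measurable (K t x) = borel_measurable \<mu>"
proof -
  show *: "prob_space (K t x)" "sets (K t x) = sets \<mu>"
    using measurable_space[OF kernel[OF assms(1)] assms(2)] by (auto simp: space_prob_algebra)
  then show "space (K t x) = space \<mu>" by (intro sets_eq_imp_space_eq)
  show "borel_measurable (K t x) = borel_measurable \<mu>" using *(2) by (rule measurable_cong_sets) simp
qed

lemma bdd_meas_kernel: "t \<ge> 0 \<Longrightarrow> x \<in> space \<mu> \<Longrightarrow> bdd_meas (K t x) = bdd_meas \<mu>"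
  by (simp add: bdd_meas_def kernelD)

lemma bdd_integrable: "u \<in> bdd_meas \<mu> \<Longrightarrow> integrable \<mu> u"
  by (rule bdd_meas_integrable[OF finite_measure_axioms])

lemma bdd_L2: "u \<in> bdd_meas \<mu> \<Longrightarrow> u \<in> Lp_space \<mu> 2"
  by (rule bdd_meas_L2[OF finite_measure_axioms])

lemma bdd_integrable_kernel:
  assumes "t \<ge> 0" "x \<in> space \<mu>" "u \<in> bdd_meas \<mu>" shows "integrable (K t x) u"
proof -
  interpret k: prob_space "K t x" using assms by (intro kernelD)
  show ?thesis using assms by (intro bdd_meas_integrable k.finite_measure_axioms) (simp add: bdd_meas_kernel)
qed

lemma P_measurable: "t \<ge> 0 \<Longrightarrow> u \<in> borel_measurable \<mu> \<Longrightarrow> P t u \<in> borel_measurable \<mu>"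
  unfolding markov_op_def by (rule measurable_compose[OF kernel_sub integral_measurable_subprob_algebra])

lemma P_valued_in:
  assumes "t \<ge> 0" "u \<in> valued_in \<mu> a b" shows "P t u \<in> valued_in \<mu> a b"
proof -
  have "P t u x \<in> {a..b}" if x: "x \<in> space \<mu>" for x
  proof -
    interpret k: prob_space "K t x" using assms x by (intro kernelD)
    have "integrable (K t x) u" using assms x by (intro bdd_integrable_kernel valued_in_bdd)
    then show ?thesis unfolding markov_op_def using assms x
      by (auto intro!: k.integral_le_const k.integral_ge_const AE_I2 simp: kernelD dest: valued_in_bounds)
  qed
  then show ?thesis using P_measurable assms by (auto simp: valued_in_def)
qed

lemma bdd_valued_in: "u \<in> bdd_meas \<mu> \<Longrightarrow> \<exists>B. u \<in> valued_in \<mu> (-B) B"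
  by (force simp: bdd_meas_def valued_in_def abs_le_iff)

lemma P_bdd: "t \<ge> 0 \<Longrightarrow> u \<in> bdd_meas \<mu> \<Longrightarrow> P t u \<in> bdd_meas \<mu>"
  using bdd_valued_in P_valued_in valued_in_bdd by metis

lemma P_add:
  "\<lbrakk>t \<ge> 0; x \<in> space \<mu>; u \<in> bdd_meas \<mu>; v \<in> bdd_meas \<mu>\<rbrakk> \<Longrightarrow> P t (\<lambda>x. u x + v x) x = P t u x + P t v x"
  unfolding markov_op_def by (intro Bochner_Integration.integral_add bdd_integrable_kernel)

lemma P_diff:
  "\<lbrakk>t \<ge> 0; x \<in> space \<mu>; u \<in> bdd_meas \<mu>; v \<in> bdd_meas \<mu>\<rbrakk> \<Longrightarrow> P t (\<lambda>x. u x - v x) x = P t u x - P t v x"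
  unfolding markov_op_def by (intro Bochner_Integration.integral_diff bdd_integrable_kernel)

lemma P_scale: "P t (\<lambda>x. c * u x) x = c * P t u x"
  unfolding markov_op_def by simp

lemma P_zero: "x \<in> space \<mu> \<Longrightarrow> u \<in> borel_measurable \<mu> \<Longrightarrow> P 0 u x = u x"
  using process by (simp add: markov_op_def markov_process_def integral_return)

lemma P_mono:
  "\<lbrakk>t \<ge> 0; x \<in> space \<mu>; u \<in> bdd_meas \<mu>; v \<in> bdd_meas \<mu>; \<And>y. y \<in> space \<mu> \<Longrightarrow> u y \<le> v y\<rbrakk> \<Longrightarrow> P t u x \<le> P t v x"
  unfolding markov_op_def by (intro integral_mono bdd_integrable_kernel) (auto simp: kernelD)

lemma kernel_mass: "t \<ge> 0 \<Longrightarrow> x \<in> space \<mu> \<Longrightarrow> emeasure (K t x) (space (K t x)) \<le> ennreal 1"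
  using prob_space.emeasure_space_1[OF kernelD(1)] by simp

lemma P_semigroup:
  assumes "s \<ge> 0" "t \<ge> 0" "x \<in> space \<mu>" "u \<in> bdd_meas \<mu>"
  shows "P (s + t) u x = P s (P t u) x"
proof -
  have "K (s + t) x = bind (K s x) (K t)" using process assms by (simp add: markov_process_def)
  obtain B where B: "\<And>y. y \<in> space \<mu> \<Longrightarrow> \<bar>u y\<bar> \<le> B" using assms by (metis bdd_measE)
  interpret k: prob_space "K s x" using assms by (intro kernelD)
  have "(\<integral>y. u y \<partial>bind (K s x) (K t)) = (\<integral>z. \<integral>y. u y \<partial>K t z \<partial>K s x)"
    using assms B kernel_sub[of t] kernel_mass[of t]
    by (intro integral_bind[where K=\<mu> and B=B and B'=1] k.finite_measure_axioms AE_I2)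
      (auto simp: kernelD dest: bdd_measD cong: measurable_cong_sets)
  then show ?thesis using \<open>K (s + t) x = _\<close> by (simp add: markov_op_def)
qed

lemma P_invariant:
  assumes "t \<ge> 0" "u \<in> bdd_meas \<mu>"
  shows "(\<integral>x. P t u x \<partial>\<mu>) = (\<integral>x. u x \<partial>\<mu>)"
proof -
  have bind: "bind \<mu> (K t) = \<mu>" using process assms by (simp add: markov_process_def)
  obtain B where B: "\<And>y. y \<in> space \<mu> \<Longrightarrow> \<bar>u y\<bar> \<le> B" using assms by (metis bdd_measE)
  have "(\<integral>y. u y \<partial>bind \<mu> (K t)) = (\<integral>z. \<integral>y. u y \<partial>K t z \<partial>\<mu>)"
    using assms B kernel_sub[of t] kernel_mass[of t]
    by (intro integral_bind[where K=\<mu> and B=B and B'=1] finite_measure_axioms AE_I2)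
      (auto dest: bdd_measD)
  then show ?thesis by (simp add: markov_op_def bind)
qed

text \<open>The variance of \<open>u\<close> under the law \<open>K t x\<close> is
  nonnegative.\<close>

lemma P_power2_le:
  assumes "t \<ge> 0" "x \<in> space \<mu>" "u \<in> bdd_meas \<mu>"
  shows "(P t u x)\<^sup>2 \<le> P t (\<lambda>y. (u y)\<^sup>2) x"
proof -
  interpret k: prob_space "K t x" using assms by (intro kernelD)
  have i: "integrable (K t x) u" "integrable (K t x) (\<lambda>y. (u y)\<^sup>2)"
    using assms by (auto intro!: bdd_integrable_kernel)
  have "0 \<le> (\<integral>y. (u y - P t u x)\<^sup>2 \<partial>K t x)" by (intro Bochner_Integration.integral_nonneg) simp
  also have "\<dots> = (\<integral>y. (u y)\<^sup>2 - 2 * P t u x * u y + (P t u x)\<^sup>2 \<partial>K t x)"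
    by (intro Bochner_Integration.integral_cong) (auto simp: power2_eq_square algebra_simps)
  also have "\<dots> = P t (\<lambda>y. (u y)\<^sup>2) x - 2 * P t u x * P t u x + (P t u x)\<^sup>2"
    using i by (simp add: k.prob_space markov_op_def)
  finally show ?thesis by (simp add: power2_eq_square)
qed

lemma P_contraction:
  assumes "t \<ge> 0" "u \<in> bdd_meas \<mu>" shows "nrm (P t u) \<le> nrm u"
proof -
  have "(\<integral>x. (P t u x)\<^sup>2 \<partial>\<mu>) \<le> (\<integral>x. P t (\<lambda>y. (u y)\<^sup>2) x \<partial>\<mu>)"
    using assms by (intro integral_mono bdd_integrable bdd_meas_power2 P_bdd P_power2_le)
  also have "\<dots> = (\<integral>x. (u x)\<^sup>2 \<partial>\<mu>)" using assms by (intro P_invariant bdd_meas_power2)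
  finally show ?thesis by (simp add: Lp_norm_2)
qed

lemma nrm_triangle:
  assumes "u \<in> bdd_meas \<mu>" "v \<in> bdd_meas \<mu>"
  shows "nrm (\<lambda>x. u x + v x) \<le> nrm u + nrm v"
  using assms by (intro Minkowski_L2 bdd_L2)

lemma nrm_minus_commute: "nrm (\<lambda>x. u x - v x) = nrm (\<lambda>x. v x - u x)"
  by (simp add: Lp_norm_2 power2_commute)

lemma P_contraction_diff:
  assumes "t \<ge> 0" "u \<in> bdd_meas \<mu>" "v \<in> bdd_meas \<mu>"
  shows "nrm (\<lambda>x. P t u x - P t v x) \<le> nrm (\<lambda>x. u x - v x)"
proof -
  have "nrm (\<lambda>x. P t u x - P t v x) = nrm (P t (\<lambda>x. u x - v x))"
    using assms by (intro Lp_norm_cong) (simp add: P_diff)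
  also have "\<dots> \<le> nrm (\<lambda>x. u x - v x)" using assms by (intro P_contraction bdd_meas_diff)
  finally show ?thesis .
qed

lemma P_strongly_continuous:
  assumes "u \<in> bdd_meas \<mu>"
  shows "((\<lambda>t. nrm (\<lambda>x. P t u x - u x)) \<longlongrightarrow> 0) (at_right 0)"
  using process bdd_L2[OF assms] by (simp add: markov_process_def)

text \<open>The semigroup law factors out the operator at the smaller time, which is a contraction;
  continuity at any time thus reduces to continuity at 0.\<close>

lemma P_diff_le:
  assumes "s \<ge> 0" "t \<ge> 0" "u \<in> bdd_meas \<mu>"
  shows "nrm (\<lambda>x. P t u x - P s u x) \<le> nrm (\<lambda>x. P \<bar>t - s\<bar> u x - u x)"
  using assms
proof (induction s t rule: linorder_wlog)
  case (le s t)
  have "nrm (\<lambda>x. P t u x - P s u x) = nrm (\<lambda>x. P s (P (t - s) u) x - P s u x)"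
    using le P_semigroup[of s "t - s"] by (intro Lp_norm_cong) simp
  also have "\<dots> \<le> nrm (\<lambda>x. P (t - s) u x - u x)"
    using le by (intro P_contraction_diff P_bdd) auto
  finally show ?case using le by simp
next
  case (sym s t)
  then show ?case by (metis nrm_minus_commute abs_minus_commute)
qed

text \<open>Continuity at 0 in a form valid for all times: from \<open>d\<close> on, the trivial
  bound 2 C is at most (2 C / d) t. Unlike a bound for small \<open>t\<close>, an affine one can be
  integrated against the exponential law, whose mean is known.\<close>

lemma P_affine_modulus:
  assumes u: "u \<in> bdd_meas \<mu>" and e: "e > 0"
  obtains B where "B \<ge> 0" "\<And>t. t \<ge> 0 \<Longrightarrow> nrm (\<lambda>x. P t u x - u x) \<le> e + B * t"
proof -
  obtain C where C: "C \<ge> 0" "\<And>x. x \<in> space \<mu> \<Longrightarrow> \<bar>u x\<bar> \<le> C" using u by (metis bdd_measE)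
  have "u \<in> valued_in \<mu> (- C) C" using C(2) bdd_measD[OF u] by (fastforce simp: valued_in_def abs_le_iff)
  then have PC: "\<bar>P t u x - u x\<bar> \<le> 2 * C" if "t \<ge> 0" "x \<in> space \<mu>" for t x
    using valued_in_bounds[OF P_valued_in[OF that(1)] that(2)] C(2)[OF that(2)] by fastforce
  have "eventually (\<lambda>t. nrm (\<lambda>x. P t u x - u x) < e) (at_right 0)"
    using P_strongly_continuous[OF u] e by (rule order_tendstoD)
  then obtain d where d: "d > 0" "\<And>t. 0 < t \<Longrightarrow> t < d \<Longrightarrow> nrm (\<lambda>x. P t u x - u x) < e"
    unfolding eventually_at_right_field by auto
  have "nrm (\<lambda>x. P t u x - u x) \<le> e + 2 * C / d * t" if t: "t \<ge> 0" for t
  proof -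
    have nn: "0 \<le> 2 * C / d * t" using C d that by simp
    consider "t = 0" | "0 < t \<and> t < d" | "t \<ge> d" using t by linarith
    then show ?thesis
    proof cases
      case 1
      then have "nrm (\<lambda>x. P t u x - u x) = nrm (\<lambda>x. 0)" using u P_zero by (intro Lp_norm_cong) (auto dest: bdd_measD)
      then show ?thesis using e nn by (simp add: Lp_norm_2)
    next
      case 2
      then show ?thesis using nn d(2)[of t] by linarith
    next
      case 3
      have "nrm (\<lambda>x. P t u x - u x) \<le> 2 * C"
        using that u PC by (intro Lp_norm_2_le_bound) (auto dest: bdd_measD intro!: borel_measurable_diff P_measurable)
      also have "2 * C \<le> 2 * C / d * t" using 3 d(1) C(1) by (simp add: field_simps mult_left_mono)
      finally show ?thesis using e by simp
    qed
  qed
  moreover have "0 \<le> 2 * C / d" using C d by simp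
  ultimately show ?thesis using that by blast
qed

text \<open>Supplies the measurability in \<open>t\<close> of the weak resolvent integrand. The
  \<open>max 0 t\<close> extends it to the whole line, since the kernels are constrained at
  nonnegative times only.\<close>

lemma inner_P_continuous:
  assumes h: "h \<in> bdd_meas \<mu>" and u: "u \<in> bdd_meas \<mu>"
  shows "continuous_on UNIV (\<lambda>t. \<integral>x. P (max 0 t) h x * u x \<partial>\<mu>)"
proof -
  let ?F = "\<lambda>t. \<integral>x. P (max 0 t) h x * u x \<partial>\<mu>"
  have le: "\<bar>?F t - ?F s\<bar> \<le> nrm (\<lambda>x. P \<bar>max 0 t - max 0 s\<bar> h x - h x) * nrm u" for s t
  proof -
    have "?F t - ?F s = (\<integral>x. (P (max 0 t) h x - P (max 0 s) h x) * u x \<partial>\<mu>)"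
      using h u by (simp add: left_diff_distrib bdd_integrable bdd_meas_mult P_bdd)
    also have "\<bar>\<dots>\<bar> \<le> nrm (\<lambda>x. P (max 0 t) h x - P (max 0 s) h x) * nrm u"
      using h u by (intro Cauchy_Schwarz_L2 bdd_L2) (auto intro!: P_bdd)
    also have "\<dots> \<le> nrm (\<lambda>x. P \<bar>max 0 t - max 0 s\<bar> h x - h x) * nrm u"
      using h by (intro mult_right_mono P_diff_le) auto
    finally show ?thesis .
  qed
  show ?thesis
    unfolding continuous_on_iff
  proof (intro ballI allI impI)
    fix s e :: real assume "e > 0"
    \<comment> \<open>The modulus contributes at most two \<open>e'\<close>, each multiplied by the
      norm of \<open>u\<close>; the added 1 covers the case of norm 0.\<close>
    define e' where "e' = e / (2 * (nrm u + 1))"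
    have "nrm u + 1 > 0" by (simp add: add_nonneg_pos)
    then have "e' > 0" using \<open>e > 0\<close> by (simp add: e'_def)
    then obtain B where B: "B \<ge> 0" "\<And>t. t \<ge> 0 \<Longrightarrow> nrm (\<lambda>x. P t h x - h x) \<le> e' + B * t"
      using P_affine_modulus[OF h] by metis
    have "dist (?F t) (?F s) < e" if "dist t s < e' / (B + 1)" for t
    proof -
      have "\<bar>max 0 t - max 0 s\<bar> \<le> \<bar>t - s\<bar>" by auto
      then have "B * \<bar>max 0 t - max 0 s\<bar> \<le> B * (e' / (B + 1))"
        using that B(1) by (intro mult_left_mono) (auto simp: dist_real_def)
      also have "\<dots> < e'" using B(1) \<open>e' > 0\<close> by (simp add: field_simps)
      finally have "nrm (\<lambda>x. P \<bar>max 0 t - max 0 s\<bar> h x - h x) \<le> 2 * e'"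
        using B(2)[of "\<bar>max 0 t - max 0 s\<bar>"] by simp
      then have "nrm (\<lambda>x. P \<bar>max 0 t - max 0 s\<bar> h x - h x) * nrm u \<le> 2 * e' * nrm u"
        by (intro mult_right_mono) auto
      also have "\<dots> < 2 * e' * (nrm u + 1)" using \<open>e' > 0\<close> by simp
      also have "\<dots> = e" using \<open>nrm u + 1 > 0\<close> unfolding e'_def by (simp add: field_simps)
      finally show ?thesis using le[of t s] by (simp add: dist_real_def)
    qed
    moreover have "e' / (B + 1) > 0" using \<open>e' > 0\<close> B(1) by simp
    ultimately show "\<exists>d>0. \<forall>t\<in>UNIV. dist t s < d \<longrightarrow> dist (?F t) (?F s) < e" by blast
  qed
qed

text \<open>By positivity and invariance, |u| <= C puts the integral of (P_s v) u between -C and C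
  times that of v when v >= 0, so it has a bounded density. An adjoint is constructed because the
  component processes need not be reversible.\<close>

lemma P_adjoint:
  assumes s: "s \<ge> 0" and u: "u \<in> bdd_meas \<mu>"
  obtains u' where "u' \<in> bdd_meas \<mu>"
    "\<And>v. v \<in> bdd_meas \<mu> \<Longrightarrow> (\<integral>x. P s v x * u x \<partial>\<mu>) = (\<integral>x. v x * u' x \<partial>\<mu>)"
proof -
  obtain C where C: "C \<ge> 0" "\<And>x. x \<in> space \<mu> \<Longrightarrow> \<bar>u x\<bar> \<le> C" using u by (metis bdd_measE)
  note bi = bdd_integrable bdd_meas_mult P_bdd
  define l where "l v = (\<integral>x. P s v x * u x \<partial>\<mu>)" for v
  obtain G where G: "G \<in> valued_in \<mu> (- C) C" "\<And>v. v \<in> bdd_meas \<mu> \<Longrightarrow> l v = (\<integral>x. G x * v x \<partial>\<mu>)"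
  proof (rule bdd_meas_functional_density[of \<mu> l "-C" C])
    fix v w assume vw: "v \<in> bdd_meas \<mu>" "w \<in> bdd_meas \<mu>"
    have "l (\<lambda>x. v x + w x) = (\<integral>x. P s v x * u x + P s w x * u x \<partial>\<mu>)"
      unfolding l_def using s vw by (intro Bochner_Integration.integral_cong) (auto simp: P_add algebra_simps)
    then show "l (\<lambda>x. v x + w x) = l v + l w" using vw s u by (simp add: bi l_def)
  next
    fix v c assume "v \<in> bdd_meas \<mu>"
    then show "l (\<lambda>x. c * v x) = c * l v" using s by (simp add: l_def P_scale mult.assoc)
  next
    fix v assume v: "v \<in> bdd_meas \<mu>" "\<And>x. x \<in> space \<mu> \<Longrightarrow> 0 \<le> v x"
    have nn: "0 \<le> P s v x" if "x \<in> space \<mu>" for x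
      using P_mono[OF s that bdd_meas_const[of 0] v(1)] v(2) P_scale[of s 0 "\<lambda>_. 0" x] by simp
    have lo: "P s v x * (- C) \<le> P s v x * u x" and hi: "P s v x * u x \<le> P s v x * C" if "x \<in> space \<mu>" for x
      using nn[OF that] C(2)[OF that] by (intro mult_left_mono; simp add: abs_le_iff)+
    have "(\<integral>x. P s v x * (- C) \<partial>\<mu>) \<le> l v"
      unfolding l_def using s u v(1) lo by (intro integral_mono bi) auto
    moreover have "l v \<le> (\<integral>x. P s v x * C \<partial>\<mu>)"
      unfolding l_def using s u v(1) hi by (intro integral_mono bi) auto
    ultimately show "- C * (\<integral>x. v x \<partial>\<mu>) \<le> l v \<and> l v \<le> C * (\<integral>x. v x \<partial>\<mu>)"
      using P_invariant[OF s v(1)] by (simp add: mult.commute)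
  qed (use C finite_measure_axioms in auto)
  show ?thesis using that[OF valued_in_bdd[OF G(1)]] G(2) by (simp add: l_def mult.commute)
qed

end

section \<open>Resolvents\<close>

text \<open>The moments of order 0, 1 and 2 turn bounds e + B t and A t + B t^2 along the semigroup
  into e + B / l and A / l + 2 B / l^2 for the resolvent.\<close>

lemma exponential_moment:
  fixes l :: real
  assumes "l > 0"
  shows "has_bochner_integral lborel (\<lambda>t. exponential_density l t * t ^ i) (fact i / l ^ i)"
proof (rule has_bochner_integral_nn_integral)
  show "AE t in lborel. 0 \<le> exponential_density l t * t ^ i"
    using assms by (intro AE_I2) (simp add: exponential_density_def)
  show "(\<integral>\<^sup>+t. ennreal (exponential_density l t * t ^ i) \<partial>lborel) = ennreal (fact i / l ^ i)"
    using nn_integral_erlang_ith_moment[OF assms, of 0 i] by simp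
qed (use assms in simp_all)

context markov
begin

text \<open>The kernels are not assumed jointly measurable in time and space, so \<open>\<integral> \<lambda> e\<^bsup>-\<lambda>t\<^esup> P\<^sub>t h dt\<close> makes no
  pointwise sense; it is defined weakly and represented by a Radon--Nikodym density.\<close>

definition is_resolvent :: "real \<Rightarrow> ('a \<Rightarrow> real) \<Rightarrow> ('a \<Rightarrow> real) \<Rightarrow> bool" where
  "is_resolvent l h G \<longleftrightarrow> (\<forall>u\<in>bdd_meas \<mu>.
     (\<integral>x. G x * u x \<partial>\<mu>) = (\<integral>t. exponential_density l t * (\<integral>x. P (max 0 t) h x * u x \<partial>\<mu>) \<partial>lborel))"

lemma inner_P_bound:
  assumes "h \<in> bdd_meas \<mu>" "u \<in> bdd_meas \<mu>"
  shows "\<bar>\<integral>x. P (max 0 t) h x * u x \<partial>\<mu>\<bar> \<le> nrm h * nrm u"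
proof -
  have "\<bar>\<integral>x. P (max 0 t) h x * u x \<partial>\<mu>\<bar> \<le> nrm (P (max 0 t) h) * nrm u"
    using assms by (intro Cauchy_Schwarz_L2 bdd_L2 P_bdd) auto
  also have "\<dots> \<le> nrm h * nrm u"
    using assms by (intro mult_right_mono P_contraction) auto
  finally show ?thesis .
qed

text \<open>The shift \<open>s\<close> is there for the increment of the resolvent, where applying
  P_s translates the exponential density by \<open>s\<close>.\<close>

lemma exponential_inner_integrable:
  assumes h: "h \<in> bdd_meas \<mu>" and u: "u \<in> bdd_meas \<mu>" and l: "l > 0"
  shows "integrable lborel (\<lambda>t. exponential_density l (t - s) * (\<integral>x. P (max 0 t) h x * u x \<partial>\<mu>))"
proof (rule Bochner_Integration.integrable_bound)
  have "integrable lborel (exponential_density l)"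
    using exponential_moment[OF l, of 0] by (simp add: has_bochner_integral_iff)
  then have "integrable lborel (\<lambda>t. exponential_density l (- s + 1 * t))"
    by (rule lborel_integrable_real_affine) simp
  then show "integrable lborel (\<lambda>t. exponential_density l (t - s) * (nrm h * nrm u))"
    by (intro integrable_mult_left) simp
  have "(\<lambda>t. \<integral>x. P (max 0 t) h x * u x \<partial>\<mu>) \<in> borel_measurable borel"
    by (rule borel_measurable_continuous_onI[OF inner_P_continuous[OF h u]])
  then show "(\<lambda>t. exponential_density l (t - s) * (\<integral>x. P (max 0 t) h x * u x \<partial>\<mu>)) \<in> borel_measurable lborel"
    by measurable
  show "AE t in lborel. norm (exponential_density l (t - s) * (\<integral>x. P (max 0 t) h x * u x \<partial>\<mu>))
      \<le> norm (exponential_density l (t - s) * (nrm h * nrm u))"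
    using inner_P_bound[OF h u] by (intro AE_I2) (auto simp: abs_mult intro!: mult_left_mono)
qed

text \<open>Each P_t h has values in \<open>{a..b}\<close>, so for u >= 0 the average over the
  exponential probability law lies between \<open>a\<close> and \<open>b\<close> times the integral
  of \<open>u\<close>; the density lemma then returns a function with the same bounds.\<close>

lemma resolvent_exists:
  assumes h: "h \<in> valued_in \<mu> a b" and ab: "a \<le> b" and l: "l > 0"
  obtains G where "G \<in> valued_in \<mu> a b" "is_resolvent l h G"
proof -
  let ?e = "exponential_density l"
  define F where "F u t = (\<integral>x. P (max 0 t) h x * u x \<partial>\<mu>)" for u t
  define L where "L u = (\<integral>t. ?e t * F u t \<partial>lborel)" for u
  have hb: "h \<in> bdd_meas \<mu>" using h by (rule valued_in_bdd)
  have e: "integrable lborel ?e" "(\<integral>t. ?e t \<partial>lborel) = 1"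
    using exponential_moment[OF l, of 0] by (simp_all add: has_bochner_integral_iff)
  have e0: "0 \<le> ?e t" for t using l by (simp add: exponential_density_def)
  have int: "integrable lborel (\<lambda>t. ?e t * F u t)" if "u \<in> bdd_meas \<mu>" for u
    using exponential_inner_integrable[OF hb that l, of 0] by (simp add: F_def)
  have bi: "integrable \<mu> (\<lambda>x. P (max 0 t) h x * u x)" if "u \<in> bdd_meas \<mu>" for u t
    using that hb by (intro bdd_integrable bdd_meas_mult P_bdd) auto
  obtain G where "G \<in> valued_in \<mu> a b" "\<And>u. u \<in> bdd_meas \<mu> \<Longrightarrow> L u = (\<integral>x. G x * u x \<partial>\<mu>)"
  proof (rule bdd_meas_functional_density[of \<mu> L a b])
    fix u v assume uv: "u \<in> bdd_meas \<mu>" "v \<in> bdd_meas \<mu>"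
    have "F (\<lambda>x. u x + v x) t = F u t + F v t" for t
      using bi uv by (simp add: F_def ring_distribs)
    then show "L (\<lambda>x. u x + v x) = L u + L v" using int uv by (simp add: L_def ring_distribs)
  next
    fix u c assume u: "u \<in> bdd_meas \<mu>"
    have "F (\<lambda>x. c * u x) t = c * F u t" for t by (simp add: F_def mult.left_commute)
    then show "L (\<lambda>x. c * u x) = c * L u" by (simp add: L_def mult.left_commute)
  next
    fix u assume u: "u \<in> bdd_meas \<mu>" "\<And>x. x \<in> space \<mu> \<Longrightarrow> 0 \<le> u x"
    have "a * (\<integral>x. u x \<partial>\<mu>) \<le> F u t \<and> F u t \<le> b * (\<integral>x. u x \<partial>\<mu>)" for t
    proof -
      have *: "a * u x \<le> P (max 0 t) h x * u x" "P (max 0 t) h x * u x \<le> b * u x" if "x \<in> space \<mu>" for x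
        using valued_in_bounds[OF P_valued_in[OF _ h] that, of "max 0 t"] u(2)[OF that] by (auto intro: mult_right_mono)
      have "(\<integral>x. a * u x \<partial>\<mu>) \<le> F u t"
        unfolding F_def using * bi u(1) by (intro integral_mono) (auto intro: bdd_integrable)
      moreover have "F u t \<le> (\<integral>x. b * u x \<partial>\<mu>)"
        unfolding F_def using * bi u(1) by (intro integral_mono) (auto intro: bdd_integrable)
      ultimately show ?thesis by simp
    qed
    then have *: "?e t * (a * (\<integral>x. u x \<partial>\<mu>)) \<le> ?e t * F u t" "?e t * F u t \<le> ?e t * (b * (\<integral>x. u x \<partial>\<mu>))" for t
      using e0[of t] by (auto intro: mult_left_mono)
    have "(\<integral>t. ?e t * (a * (\<integral>x. u x \<partial>\<mu>)) \<partial>lborel) \<le> L u"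
      unfolding L_def using * e int[OF u(1)] by (intro integral_mono integrable_mult_left)
    moreover have "L u \<le> (\<integral>t. ?e t * (b * (\<integral>x. u x \<partial>\<mu>)) \<partial>lborel)"
      unfolding L_def using * e int[OF u(1)] by (intro integral_mono integrable_mult_left)
    ultimately show "a * (\<integral>x. u x \<partial>\<mu>) \<le> L u \<and> L u \<le> b * (\<integral>x. u x \<partial>\<mu>)" using e by simp
  qed (use ab finite_measure_axioms in auto)
  then show ?thesis using that[of G] by (simp add: is_resolvent_def L_def F_def)
qed

lemma inner_P_diff_zero:
  assumes h: "h \<in> bdd_meas \<mu>" and u: "u \<in> bdd_meas \<mu>" and t: "t \<ge> 0"
  shows "\<bar>(\<integral>x. P (max 0 t) h x * u x \<partial>\<mu>) - (\<integral>x. h x * u x \<partial>\<mu>)\<bar> \<le> nrm (\<lambda>x. P t h x - h x) * nrm u"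
proof -
  have "(\<integral>x. P (max 0 t) h x * u x \<partial>\<mu>) - (\<integral>x. h x * u x \<partial>\<mu>) = (\<integral>x. (P t h x - h x) * u x \<partial>\<mu>)"
    using h u t by (simp add: left_diff_distrib bdd_integrable bdd_meas_mult P_bdd)
  then show ?thesis using h u t Cauchy_Schwarz_L2[of "\<lambda>x. P t h x - h x" \<mu> u]
    by (simp add: bdd_L2 bdd_meas_diff P_bdd)
qed

text \<open>Recovers norm bounds from weak identities: the function to be estimated is itself taken
  as the test function.\<close>

lemma nrm_le_of_inner:
  assumes "u \<in> bdd_meas \<mu>" "(\<integral>x. u x * u x \<partial>\<mu>) \<le> nrm u * c" "c \<ge> 0"
  shows "nrm u \<le> c"
proof (cases "nrm u = 0")
  case False
  then have "nrm u > 0" using Lp_norm_2_nonneg[of \<mu> u] by linarith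
  moreover have "nrm u * nrm u \<le> nrm u * c"
    using assms(2) Lp_norm_2_power2[of \<mu> u] by (simp add: power2_eq_square)
  ultimately show ?thesis by simp
qed (use assms in simp)

text \<open>G - h, tested against itself, is the exponential average of P_t h - h; the law has mean
  1 / l.\<close>

lemma resolvent_near:
  assumes h: "h \<in> bdd_meas \<mu>" and G: "G \<in> bdd_meas \<mu>" "is_resolvent l h G" and l: "l > 0"
    and B: "B \<ge> 0" "e \<ge> 0" "\<And>t. t \<ge> 0 \<Longrightarrow> nrm (\<lambda>x. P t h x - h x) \<le> e + B * t"
  shows "nrm (\<lambda>x. G x - h x) \<le> e + B / l"
proof (rule nrm_le_of_inner)
  let ?e = "exponential_density l"
  let ?u = "\<lambda>x. G x - h x"
  show u: "?u \<in> bdd_meas \<mu>" using h G by auto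
  let ?F = "\<lambda>t. \<integral>x. P (max 0 t) h x * ?u x \<partial>\<mu>"
  have m0: "integrable lborel ?e" "(\<integral>t. ?e t \<partial>lborel) = 1"
    using exponential_moment[OF l, of 0] by (simp_all add: has_bochner_integral_iff)
  have m1: "integrable lborel (\<lambda>t. ?e t * t)" "(\<integral>t. ?e t * t \<partial>lborel) = 1 / l"
    using exponential_moment[OF l, of 1] by (simp_all add: has_bochner_integral_iff)
  have int: "integrable lborel (\<lambda>t. ?e t * ?F t)"
    using exponential_inner_integrable[OF h u l, of 0] by simp
  have "(\<integral>x. ?u x * ?u x \<partial>\<mu>) = (\<integral>x. G x * ?u x \<partial>\<mu>) - (\<integral>x. h x * ?u x \<partial>\<mu>)"
    using u h G(1) by (subst Bochner_Integration.integral_diff[symmetric])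
      (auto intro!: bdd_integrable bdd_meas_mult Bochner_Integration.integral_cong simp: algebra_simps)
  also have "\<dots> = (\<integral>t. ?e t * ?F t - ?e t * (\<integral>x. h x * ?u x \<partial>\<mu>) \<partial>lborel)"
    using G(2) u int m0 by (simp add: is_resolvent_def)
  also have "\<dots> \<le> (\<integral>t. nrm ?u * (e * ?e t + B * (?e t * t)) \<partial>lborel)"
  proof (rule integral_mono)
    show "integrable lborel (\<lambda>t. ?e t * ?F t - ?e t * (\<integral>x. h x * ?u x \<partial>\<mu>))" using int m0 by simp
    show "integrable lborel (\<lambda>t. nrm ?u * (e * ?e t + B * (?e t * t)))" using m0 m1 by simp
    fix t :: real
    show "?e t * ?F t - ?e t * (\<integral>x. h x * ?u x \<partial>\<mu>) \<le> nrm ?u * (e * ?e t + B * (?e t * t))"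
    proof (cases "t < 0")
      case True
      then show ?thesis by (simp add: exponential_density_def)
    next
      case False
      then have "?F t - (\<integral>x. h x * ?u x \<partial>\<mu>) \<le> nrm (\<lambda>x. P t h x - h x) * nrm ?u"
        using inner_P_diff_zero[OF h u, of t] by linarith
      also have "\<dots> \<le> (e + B * t) * nrm ?u" using False B(3)[of t] by (intro mult_right_mono) auto
      finally have "?e t * (?F t - (\<integral>x. h x * ?u x \<partial>\<mu>)) \<le> ?e t * ((e + B * t) * nrm ?u)"
        using l by (intro mult_left_mono) (simp_all add: exponential_density_def)
      then show ?thesis by (simp add: algebra_simps)
    qed
  qed
  also have "\<dots> = nrm ?u * (e + B / l)" using m0 m1 by simp
  finally show "(\<integral>x. ?u x * ?u x \<partial>\<mu>) \<le> nrm ?u * (e + B / l)" .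
  show "0 \<le> e + B / l" using B l by simp
qed

lemma resolvent_energy:
  assumes h: "h \<in> bdd_meas \<mu>" and G: "G \<in> bdd_meas \<mu>" "is_resolvent l h G" and l: "l > 0"
    and A: "\<And>t. t \<ge> 0 \<Longrightarrow> (\<integral>x. h x * (h x - P t h x) \<partial>\<mu>) \<le> A * t + B * t\<^sup>2"
  shows "l * (\<integral>x. G x * (h x - G x) \<partial>\<mu>) \<le> A + 2 * B / l"
proof -
  let ?e = "exponential_density l"
  let ?F = "\<lambda>t. \<integral>x. P (max 0 t) h x * h x \<partial>\<mu>"
  have m0: "integrable lborel ?e" "(\<integral>t. ?e t \<partial>lborel) = 1"
    using exponential_moment[OF l, of 0] by (simp_all add: has_bochner_integral_iff)
  have m1: "integrable lborel (\<lambda>t. ?e t * t)" "(\<integral>t. ?e t * t \<partial>lborel) = 1 / l"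
    using exponential_moment[OF l, of 1] by (simp_all add: has_bochner_integral_iff)
  have m2: "integrable lborel (\<lambda>t. ?e t * t\<^sup>2)" "(\<integral>t. ?e t * t\<^sup>2 \<partial>lborel) = 2 / l\<^sup>2"
    using exponential_moment[OF l, of 2] by (simp_all add: has_bochner_integral_iff)
  have int: "integrable lborel (\<lambda>t. ?e t * ?F t)"
    using exponential_inner_integrable[OF h h l, of 0] by simp
  have "(\<integral>x. G x * (h x - G x) \<partial>\<mu>) = (\<integral>x. h x * (h x - G x) - (h x - G x)\<^sup>2 \<partial>\<mu>)"
    by (intro Bochner_Integration.integral_cong) (auto simp: power2_eq_square algebra_simps)
  also have "\<dots> = (\<integral>x. h x * (h x - G x) \<partial>\<mu>) - (\<integral>x. (h x - G x)\<^sup>2 \<partial>\<mu>)"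
    using h G(1) by (intro Bochner_Integration.integral_diff bdd_integrable) auto
  also have "\<dots> \<le> (\<integral>x. h x * (h x - G x) \<partial>\<mu>)"
    by (simp add: Bochner_Integration.integral_nonneg)
  also have "\<dots> = (\<integral>x. h x * h x \<partial>\<mu>) - (\<integral>x. G x * h x \<partial>\<mu>)"
    using h G(1) by (subst Bochner_Integration.integral_diff[symmetric])
      (auto intro!: bdd_integrable bdd_meas_mult Bochner_Integration.integral_cong simp: algebra_simps)
  also have "\<dots> = (\<integral>t. ?e t * (\<integral>x. h x * h x \<partial>\<mu>) - ?e t * ?F t \<partial>lborel)"
    using G(2) h int m0 by (simp add: is_resolvent_def)
  also have "\<dots> \<le> (\<integral>t. A * (?e t * t) + B * (?e t * t\<^sup>2) \<partial>lborel)"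
  proof (rule integral_mono)
    show "integrable lborel (\<lambda>t. ?e t * (\<integral>x. h x * h x \<partial>\<mu>) - ?e t * ?F t)" using int m0 by simp
    show "integrable lborel (\<lambda>t. A * (?e t * t) + B * (?e t * t\<^sup>2))" using m1 m2 by simp
    fix t :: real
    show "?e t * (\<integral>x. h x * h x \<partial>\<mu>) - ?e t * ?F t \<le> A * (?e t * t) + B * (?e t * t\<^sup>2)"
    proof (cases "t < 0")
      case True
      then show ?thesis by (simp add: exponential_density_def)
    next
      case False
      have "(\<integral>x. h x * h x \<partial>\<mu>) - ?F t = (\<integral>x. h x * (h x - P t h x) \<partial>\<mu>)"
        using h False by (subst Bochner_Integration.integral_diff[symmetric])
          (auto intro!: bdd_integrable bdd_meas_mult P_bdd Bochner_Integration.integral_cong simp: algebra_simps)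
      then have "?e t * ((\<integral>x. h x * h x \<partial>\<mu>) - ?F t) \<le> ?e t * (A * t + B * t\<^sup>2)"
        using l A[of t] False by (intro mult_left_mono) (simp_all add: exponential_density_def)
      then show ?thesis by (simp add: algebra_simps)
    qed
  qed
  also have "\<dots> = A / l + 2 * B / l\<^sup>2" using m1 m2 by simp
  finally have "l * (\<integral>x. G x * (h x - G x) \<partial>\<mu>) \<le> l * (A / l + 2 * B / l\<^sup>2)"
    using l by (intro mult_left_mono) auto
  also have "\<dots> = A + 2 * B / l" using l by (simp add: field_simps power2_eq_square)
  finally show ?thesis .
qed

text \<open>Between 0 and \<open>s\<close> the shifted density vanishes and the other term is at
  most 2 l; beyond \<open>s\<close> the two densities have the exact ratio exp (s l), so the
  difference is a second-order Taylor remainder.\<close>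

lemma exponential_kernel_bound:
  fixes l s r :: real
  assumes l: "l > 0" and s: "0 < s" "s \<le> 1 / l"
  shows "\<bar>exponential_density l (r - s) - (1 + s * l) * exponential_density l r\<bar>
    \<le> (l * s)\<^sup>2 * exponential_density l r + 2 * l * indicator {0..s} r"
proof -
  have sl: "0 \<le> s * l" "s * l \<le> 1" using l s by (auto simp: field_simps)
  consider "r < 0" | "0 \<le> r" "r < s" | "s \<le> r" by linarith
  then show ?thesis
  proof cases
    case 1
    then show ?thesis using s by (simp add: exponential_density_def)
  next
    case 2
    have "(1 + s * l) * (l * exp (- r * l)) \<le> 2 * (l * 1)"
      using sl l 2 by (intro mult_mono) auto
    moreover have "0 \<le> (1 + s * l) * (l * exp (- r * l))" using sl l by simp
    moreover have "0 \<le> (l * s)\<^sup>2 * (l * exp (- r * l))" using l by simp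
    ultimately have "\<bar>(1 + s * l) * (l * exp (- r * l))\<bar> \<le> (l * s)\<^sup>2 * (l * exp (- r * l)) + 2 * l" by linarith
    then show ?thesis using 2 s by (simp add: exponential_density_def)
  next
    case 3
    have "exp (- (r - s) * l) = exp (- r * l) * exp (s * l)" by (simp add: exp_add[symmetric] algebra_simps)
    then have eq: "exponential_density l (r - s) - (1 + s * l) * exponential_density l r
        = l * exp (- r * l) * (exp (s * l) - 1 - s * l)"
      using 3 s by (simp add: exponential_density_def algebra_simps)
    have "1 + s * l \<le> exp (s * l)" by (rule exp_ge_add_one_self)
    moreover have "exp (s * l) \<le> 1 + s * l + (s * l)\<^sup>2" using sl by (rule exp_bound)
    ultimately have "0 \<le> exp (s * l) - 1 - s * l" "exp (s * l) - 1 - s * l \<le> (s * l)\<^sup>2" by linarith+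
    then have "\<bar>l * exp (- r * l) * (exp (s * l) - 1 - s * l)\<bar> \<le> l * exp (- r * l) * (s * l)\<^sup>2"
      using l by (subst abs_of_nonneg) (auto intro!: mult_left_mono)
    also have "\<dots> = (l * s)\<^sup>2 * exponential_density l r"
      using 3 s by (simp add: exponential_density_def power_mult_distrib)
    finally show ?thesis unfolding eq using l by (simp add: indicator_def)
  qed
qed

text \<open>Testing the difference quotient of \<open>G\<close> against \<open>u\<close> and moving \<open>P\<^sub>s\<close> to the adjoint turns the
  increment into an integral of \<open>\<langle>P\<^sub>r h - h, u\<rangle>\<close> against a kernel of total mass \<open>O(s)\<close>
  that concentrates at \<open>r = 0\<close> up to \<open>O(s\<^sup>2)\<close>.\<close>

lemma resolvent_increment:
  assumes h: "h \<in> bdd_meas \<mu>" and G: "G \<in> bdd_meas \<mu>" "is_resolvent l h G" and l: "l > 0"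
    and s: "0 < s" "s \<le> 1 / l"
    and B: "B \<ge> 0" "e \<ge> 0" "\<And>t. t \<ge> 0 \<Longrightarrow> nrm (\<lambda>x. P t h x - h x) \<le> e + B * t"
  shows "nrm (\<lambda>x. P s G x - G x - s * l * (G x - h x)) \<le> (l * s)\<^sup>2 * (e + B / l) + 2 * l * s * (e + B * s)"
proof (rule nrm_le_of_inner)
  let ?e = "exponential_density l"
  let ?u = "\<lambda>x. P s G x - G x - s * l * (G x - h x)"
  have bds: "P s G \<in> bdd_meas \<mu>" using G s by (intro P_bdd) auto
  show u: "?u \<in> bdd_meas \<mu>"
    by (intro bdd_meas_diff bdd_meas_mult bdd_meas_const bds h G)
  obtain u' where u': "u' \<in> bdd_meas \<mu>"
    "\<And>v. v \<in> bdd_meas \<mu> \<Longrightarrow> (\<integral>x. P s v x * ?u x \<partial>\<mu>) = (\<integral>x. v x * u' x \<partial>\<mu>)"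
    by (rule P_adjoint[OF less_imp_le[OF s(1)] u]) (rule that; simp)
  define F where "F t = (\<integral>x. P (max 0 t) h x * ?u x \<partial>\<mu>)" for t
  define F0 where "F0 = (\<integral>x. h x * ?u x \<partial>\<mu>)"
  define k where "k r = ?e (r - s) - (1 + s * l) * ?e r" for r
  have m0: "integrable lborel ?e" "(\<integral>t. ?e t \<partial>lborel) = 1"
    using exponential_moment[OF l, of 0] by (simp_all add: has_bochner_integral_iff)
  have m1: "integrable lborel (\<lambda>t. ?e t * t)" "(\<integral>t. ?e t * t \<partial>lborel) = 1 / l"
    using exponential_moment[OF l, of 1] by (simp_all add: has_bochner_integral_iff)
  have mI: "integrable lborel (indicator {0..s} :: real \<Rightarrow> real)" "(\<integral>r. indicator {0..s} r \<partial>lborel) = s"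
    using s by auto
  have m0s: "integrable lborel (\<lambda>r. ?e (r - s))" "(\<integral>r. ?e (r - s) \<partial>lborel) = 1"
    using lborel_integrable_real_affine[OF m0(1), of 1 "-s"] lborel_integral_real_affine[of 1 ?e "-s"] m0(2) by simp_all
  have int0: "integrable lborel (\<lambda>r. ?e r * F r)"
    unfolding F_def using exponential_inner_integrable[OF h u l, of 0] unfolding diff_0_right .
  have ints: "integrable lborel (\<lambda>r. ?e (r - s) * F r)"
    unfolding F_def by (rule exponential_inner_integrable[OF h u l])
  have GF: "(\<integral>x. G x * ?u x \<partial>\<mu>) = (\<integral>r. ?e r * F r \<partial>lborel)"
    using G(2) u by (simp add: is_resolvent_def F_def)
  have "(\<integral>x. P s G x * ?u x \<partial>\<mu>) = (\<integral>x. G x * u' x \<partial>\<mu>)" by (rule u'(2)[OF G(1)])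
  also have "\<dots> = (\<integral>t. ?e t * (\<integral>x. P (max 0 t) h x * u' x \<partial>\<mu>) \<partial>lborel)"
    using G(2) u'(1) by (simp add: is_resolvent_def)
  also have "\<dots> = (\<integral>t. ?e t * F (s + t) \<partial>lborel)"
  proof (intro Bochner_Integration.integral_cong refl)
    fix t :: real
    show "?e t * (\<integral>x. P (max 0 t) h x * u' x \<partial>\<mu>) = ?e t * F (s + t)"
    proof (cases "t < 0")
      case True
      then show ?thesis by (simp add: exponential_density_def)
    next
      case False
      have "(\<integral>x. P (max 0 t) h x * u' x \<partial>\<mu>) = (\<integral>x. P s (P (max 0 t) h) x * ?u x \<partial>\<mu>)"
        using h by (intro u'(2)[symmetric] P_bdd) auto
      also have "\<dots> = F (s + t)"
        unfolding F_def using False s h P_semigroup[of s t _ h] by (intro Bochner_Integration.integral_cong) auto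
      finally show ?thesis by simp
    qed
  qed
  also have "\<dots> = (\<integral>r. ?e (r - s) * F r \<partial>lborel)"
    using lborel_integral_real_affine[of 1 "\<lambda>r. ?e (r - s) * F r" s] by simp
  finally have PG: "(\<integral>x. P s G x * ?u x \<partial>\<mu>) = (\<integral>r. ?e (r - s) * F r \<partial>lborel)" .
  have "(\<integral>x. ?u x * ?u x \<partial>\<mu>) = (\<integral>x. P s G x * ?u x - (1 + s * l) * (G x * ?u x) + s * l * (h x * ?u x) \<partial>\<mu>)"
    by (intro Bochner_Integration.integral_cong) (auto simp: algebra_simps)
  also have "\<dots> = (\<integral>x. P s G x * ?u x \<partial>\<mu>) - (1 + s * l) * (\<integral>x. G x * ?u x \<partial>\<mu>) + s * l * F0"
    using bdd_integrable[OF bdd_meas_mult[OF bds u]] bdd_integrable[OF bdd_meas_mult[OF G(1) u]]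
      bdd_integrable[OF bdd_meas_mult[OF h u]] by (simp add: F0_def)
  also have "\<dots> = (\<integral>r. k r * F r \<partial>lborel) + s * l * F0"
    unfolding PG GF k_def using int0 ints by (simp add: left_diff_distrib mult.assoc)
  \<comment> \<open>Both densities have mass 1, so \<open>k\<close> has total mass - s l, and the
    term \<open>s * l * F0\<close> is exactly what recentres \<open>F\<close> at its value at time
    0.\<close>
  also have "\<dots> = (\<integral>r. k r * F r - k r * F0 \<partial>lborel)"
    using int0 ints m0 m0s by (simp add: k_def left_diff_distrib mult.assoc) (simp add: algebra_simps)
  also have "\<dots> \<le> (\<integral>r. nrm ?u * ((l * s)\<^sup>2 * (e * ?e r + B * (?e r * r)) + 2 * l * (e + B * s) * indicator {0..s} r) \<partial>lborel)"
  proof (rule integral_mono)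
    show "integrable lborel (\<lambda>r. k r * F r - k r * F0)"
      using int0 ints m0 m0s by (simp add: k_def left_diff_distrib mult.assoc)
    show "integrable lborel (\<lambda>r. nrm ?u * ((l * s)\<^sup>2 * (e * ?e r + B * (?e r * r)) + 2 * l * (e + B * s) * indicator {0..s} r))"
      by (intro integrable_mult_right Bochner_Integration.integrable_add m0 m1 mI)
    fix r :: real
    show "k r * F r - k r * F0 \<le> nrm ?u * ((l * s)\<^sup>2 * (e * ?e r + B * (?e r * r)) + 2 * l * (e + B * s) * indicator {0..s} r)"
    proof (cases "r < 0")
      case True
      then show ?thesis using s by (simp add: k_def exponential_density_def)
    next
      case False
      have "\<bar>F r - F0\<bar> \<le> nrm (\<lambda>x. P r h x - h x) * nrm ?u"
        unfolding F_def F0_def using False by (intro inner_P_diff_zero[OF h u]) auto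
      also have "\<dots> \<le> (e + B * r) * nrm ?u" using False B(3)[of r] by (intro mult_right_mono) auto
      finally have *: "\<bar>F r - F0\<bar> \<le> (e + B * r) * nrm ?u" .
      have "k r * F r - k r * F0 \<le> \<bar>k r\<bar> * \<bar>F r - F0\<bar>"
        by (metis abs_ge_self abs_mult right_diff_distrib)
      also have "\<dots> \<le> ((l * s)\<^sup>2 * ?e r + 2 * l * indicator {0..s} r) * ((e + B * r) * nrm ?u)"
        using exponential_kernel_bound[OF l s, of r] * l
        by (intro mult_mono) (auto simp: k_def exponential_density_def)
      also have "\<dots> = nrm ?u * ((l * s)\<^sup>2 * (e * ?e r + B * (?e r * r)) + 2 * l * ((e + B * r) * indicator {0..s} r))"
        by (simp add: algebra_simps)
      also have "\<dots> \<le> nrm ?u * ((l * s)\<^sup>2 * (e * ?e r + B * (?e r * r)) + 2 * l * ((e + B * s) * indicator {0..s} r))"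
        using l B by (intro mult_left_mono add_left_mono) (auto simp: indicator_def intro: mult_left_mono)
      finally show ?thesis by (simp add: mult.assoc)
    qed
  qed
  also have "\<dots> = nrm ?u * ((l * s)\<^sup>2 * (e + B / l) + 2 * l * s * (e + B * s))"
    by (simp only: integral_mult_right_zero Bochner_Integration.integral_add integrable_mult_right
      Bochner_Integration.integrable_add m0 m1 mI) (simp add: algebra_simps)
  finally show "(\<integral>x. ?u x * ?u x \<partial>\<mu>) \<le> nrm ?u * ((l * s)\<^sup>2 * (e + B / l) + 2 * l * s * (e + B * s))" .
  show "0 \<le> (l * s)\<^sup>2 * (e + B / l) + 2 * l * s * (e + B * s)" using B l s by simp
qed

text \<open>The resolvent equation l G - L G = l h, read as membership in the domain together with
  the value of the generator.\<close>

lemma resolvent_gen_rel: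
  assumes h: "h \<in> bdd_meas \<mu>" and G: "G \<in> bdd_meas \<mu>" "is_resolvent l h G" and l: "l > 0"
  shows "gen_rel \<mu> K G (\<lambda>x. l * (G x - h x))"
  unfolding gen_rel_def
proof (intro conjI)
  show "G \<in> Lp_space \<mu> 2" using G by (intro bdd_L2)
  show "(\<lambda>x. l * (G x - h x)) \<in> Lp_space \<mu> 2" using G h by (intro bdd_L2) auto
  show "((\<lambda>s. nrm (\<lambda>x. (P s G x - G x) / s - l * (G x - h x))) \<longlongrightarrow> 0) (at_right 0)"
  proof (rule order_tendstoI)
    fix y :: real assume "y < 0"
    then show "eventually (\<lambda>s. y < nrm (\<lambda>x. (P s G x - G x) / s - l * (G x - h x))) (at_right 0)"
      using Lp_norm_2_nonneg by (intro always_eventually allI) (rule less_le_trans)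
  next
    fix y :: real assume "0 < y"
    \<comment> \<open>After division by \<open>s\<close> the increment bound tends to 2 l e, which
      this choice makes y / 2.\<close>
    define e where "e = y / (4 * l)"
    have e: "e > 0" using \<open>0 < y\<close> l by (simp add: e_def)
    obtain B where B: "B \<ge> 0" "\<And>t. t \<ge> 0 \<Longrightarrow> nrm (\<lambda>x. P t h x - h x) \<le> e + B * t"
      using P_affine_modulus[OF h e] by metis
    have "((\<lambda>s. l\<^sup>2 * s * (e + B / l) + 2 * l * (e + B * s)) \<longlongrightarrow> l\<^sup>2 * 0 * (e + B / l) + 2 * l * (e + B * 0)) (at_right 0)"
      by (intro tendsto_intros)
    then have "eventually (\<lambda>s. l\<^sup>2 * s * (e + B / l) + 2 * l * (e + B * s) < y) (at_right 0)"
      by (rule order_tendstoD(2)) (use \<open>0 < y\<close> l in \<open>simp add: e_def\<close>)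
    moreover have "eventually (\<lambda>s. s \<in> {0<..<1 / l}) (at_right (0::real))"
      using l by (intro eventually_at_right_real) simp
    ultimately show "eventually (\<lambda>s. nrm (\<lambda>x. (P s G x - G x) / s - l * (G x - h x)) < y) (at_right 0)"
    proof eventually_elim
      case (elim s)
      then have s: "0 < s" "s \<le> 1 / l" by auto
      have "nrm (\<lambda>x. (P s G x - G x) / s - l * (G x - h x)) = nrm (\<lambda>x. (1 / s) * (P s G x - G x - s * l * (G x - h x)))"
        using s by (intro Lp_norm_cong) (simp add: field_simps)
      also have "\<dots> = (1 / s) * nrm (\<lambda>x. P s G x - G x - s * l * (G x - h x))"
        using s by (subst Lp_norm_2_scale) simp
      also have "\<dots> \<le> (1 / s) * ((l * s)\<^sup>2 * (e + B / l) + 2 * l * s * (e + B * s))"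
        using s e by (intro mult_left_mono resolvent_increment[OF h G l s B(1) _ B(2)]) auto
      also have "\<dots> = l\<^sup>2 * s * (e + B / l) + 2 * l * (e + B * s)"
        using s l by (simp add: field_simps power2_eq_square)
      finally show ?case using elim by linarith
    qed
  qed
qed

section \<open>The generator on bounded functions and approximation from its domain\<close>

lemma gen_rel_unique:
  assumes g: "gen_rel \<mu> K f g" and g': "gen_rel \<mu> K f g'" and f: "f \<in> bdd_meas \<mu>"
  shows "nrm (\<lambda>x. g x - g' x) = 0"
proof -
  let ?D = "\<lambda>t x. (P t f x - f x) / t"
  have "nrm (\<lambda>x. g x - g' x) \<le> nrm (\<lambda>x. ?D t x - g x) + nrm (\<lambda>x. ?D t x - g' x)" if "t > 0" for t
  proof -
    have L: "?D t \<in> Lp_space \<mu> 2" "g \<in> Lp_space \<mu> 2" "g' \<in> Lp_space \<mu> 2"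
      using g g' f that by (simp_all add: gen_rel_def bdd_L2 bdd_meas_divide bdd_meas_diff P_bdd)
    have "nrm (\<lambda>x. g x - g' x) = nrm (\<lambda>x. (g x - ?D t x) + (?D t x - g' x))" by simp
    also have "\<dots> \<le> nrm (\<lambda>x. g x - ?D t x) + nrm (\<lambda>x. ?D t x - g' x)"
      by (intro Minkowski_L2 L2_diff L)
    finally show ?thesis by (simp add: nrm_minus_commute[of g])
  qed
  then have "eventually (\<lambda>t. nrm (\<lambda>x. g x - g' x) \<le> nrm (\<lambda>x. ?D t x - g x) + nrm (\<lambda>x. ?D t x - g' x)) (at_right 0)"
    by (auto simp: eventually_at_right_field intro!: exI[of _ 1])
  moreover have "((\<lambda>t. nrm (\<lambda>x. ?D t x - g x) + nrm (\<lambda>x. ?D t x - g' x)) \<longlongrightarrow> 0 + 0) (at_right 0)"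
    using g g' by (intro tendsto_add) (auto simp: gen_rel_def)
  ultimately have "nrm (\<lambda>x. g x - g' x) \<le> 0"
    using tendsto_lowerbound trivial_limit_at_right_real by fastforce
  then show ?thesis using Lp_norm_2_nonneg[of \<mu>] by (intro antisym)
qed

text \<open>\<open>gen\<close> is a choice among functions equal almost everywhere, so inner
  products with it may be computed from any explicit representative, here the one from the resolvent
  equation.\<close>

lemma inner_gen:
  assumes g: "gen_rel \<mu> K f g" and f: "f \<in> bdd_meas \<mu>"
  shows "inner_L2 \<mu> f (gen \<mu> K f) = (\<integral>x. f x * g x \<partial>\<mu>)" "f \<in> gen_dom \<mu> K"
proof -
  have gg: "gen_rel \<mu> K f (gen \<mu> K f)" unfolding gen_def by (rule someI[where P="gen_rel \<mu> K f", OF g])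
  show "f \<in> gen_dom \<mu> K" using g by (auto simp: gen_dom_def)
  have L: "gen \<mu> K f \<in> Lp_space \<mu> 2" "g \<in> Lp_space \<mu> 2" using g gg by (auto simp: gen_rel_def)
  have "\<bar>\<integral>x. f x * (gen \<mu> K f x - g x) \<partial>\<mu>\<bar> \<le> nrm f * nrm (\<lambda>x. gen \<mu> K f x - g x)"
    using Cauchy_Schwarz_L2[OF bdd_L2[OF f] L2_diff[OF L]] .
  then have "(\<integral>x. f x * (gen \<mu> K f x - g x) \<partial>\<mu>) = 0" using gen_rel_unique[OF gg g f] by simp
  then show "inner_L2 \<mu> f (gen \<mu> K f) = (\<integral>x. f x * g x \<partial>\<mu>)"
    using L2_mult_integrable[OF bdd_L2[OF f]] L by (simp add: inner_L2_def right_diff_distrib)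
qed

text \<open>The approximants are the resolvents with parameter n + 1, positive already at n = 0.
  They are fixed before \<open>A\<close>, so the convergence clauses are also available when no
  energy bound is at hand.\<close>

lemma domain_approximation:
  assumes h: "h \<in> valued_in \<mu> a b" and ab: "a \<le> b"
  obtains G where "\<And>n::nat. G n \<in> valued_in \<mu> a b" "\<And>n. G n \<in> gen_dom \<mu> K"
    "(\<lambda>n. nrm (\<lambda>x. G n x - h x)) \<longlonglongrightarrow> 0"
    "\<forall>A. eventually (\<lambda>t. (\<integral>x. h x * (h x - P t h x) \<partial>\<mu>) \<le> A * t) (at_right 0) \<longrightarrow>
      (\<forall>e>0. eventually (\<lambda>n. dirichlet_form \<mu> K (G n) (G n) \<le> A + e) sequentially)"
proof -
  have hb: "h \<in> bdd_meas \<mu>" using h by (rule valued_in_bdd)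
  have "\<exists>G. G \<in> valued_in \<mu> a b \<and> is_resolvent (real n + 1) h G" for n
    using resolvent_exists[OF h ab, of "real n + 1"] by (metis add_nonneg_pos of_nat_0_le_iff zero_less_one)
  then obtain G where G: "\<And>n. G n \<in> valued_in \<mu> a b" "\<And>n. is_resolvent (real n + 1) h (G n)"
    by metis
  have Gb: "G n \<in> bdd_meas \<mu>" for n using G(1) by (rule valued_in_bdd)
  have pos: "real n + 1 > 0" for n by simp
  note gr = resolvent_gen_rel[OF hb Gb G(2) pos]
  have dir: "dirichlet_form \<mu> K (G n) (G n) = (real n + 1) * (\<integral>x. G n x * (h x - G n x) \<partial>\<mu>)" for n
  proof -
    have "dirichlet_form \<mu> K (G n) (G n) = - (\<integral>x. G n x * ((real n + 1) * (G n x - h x)) \<partial>\<mu>)"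
      using inner_gen(1)[OF gr Gb] by (simp add: dirichlet_form_def)
    also have "\<dots> = (\<integral>x. (real n + 1) * (G n x * (h x - G n x)) \<partial>\<mu>)"
      by (subst integral_minus[symmetric], intro Bochner_Integration.integral_cong) (auto simp: algebra_simps)
    finally show ?thesis by simp
  qed
  have inv: "(\<lambda>n. c / (real n + 1)) \<longlonglongrightarrow> 0" for c :: real
    using tendsto_mult[OF tendsto_const[of c] LIMSEQ_inverse_real_of_nat] by (simp add: inverse_eq_divide add.commute)
  show ?thesis
  proof (rule that[OF G(1)])
    show "G n \<in> gen_dom \<mu> K" for n using inner_gen(2)[OF gr Gb] .
    show "(\<lambda>n. nrm (\<lambda>x. G n x - h x)) \<longlonglongrightarrow> 0"
    proof (rule order_tendstoI)
      fix y :: real assume "y < 0"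
      then show "eventually (\<lambda>n. y < nrm (\<lambda>x. G n x - h x)) sequentially"
        using Lp_norm_2_nonneg by (intro always_eventually allI) (rule less_le_trans)
    next
      fix y :: real assume "0 < y"
      then have y2: "y / 2 > 0" by simp
      obtain B where B: "B \<ge> 0" "\<And>t. t \<ge> 0 \<Longrightarrow> nrm (\<lambda>x. P t h x - h x) \<le> y / 2 + B * t"
        using P_affine_modulus[OF hb y2] by metis
      have "eventually (\<lambda>n. B / (real n + 1) < y / 2) sequentially"
        using inv y2 by (rule order_tendstoD)
      then show "eventually (\<lambda>n. nrm (\<lambda>x. G n x - h x) < y) sequentially"
      proof eventually_elim
        case (elim n)
        have "nrm (\<lambda>x. G n x - h x) \<le> y / 2 + B / (real n + 1)"
          using y2 by (intro resolvent_near[OF hb Gb G(2) pos B(1) _ B(2)]) auto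
        then show ?case using elim by linarith
      qed
    qed
    have "eventually (\<lambda>n. dirichlet_form \<mu> K (G n) (G n) \<le> A + e) sequentially"
      if ev: "eventually (\<lambda>t. (\<integral>x. h x * (h x - P t h x) \<partial>\<mu>) \<le> A * t) (at_right 0)" and "e > 0" for A e :: real
    proof -
      obtain d where d: "d > 0" "\<And>t. 0 < t \<Longrightarrow> t < d \<Longrightarrow> (\<integral>x. h x * (h x - P t h x) \<partial>\<mu>) \<le> A * t"
        using ev unfolding eventually_at_right_field by auto
      \<comment> \<open>Extends the bound from small \<open>t\<close> to all \<open>t\<close>: past
        \<open>d\<close> the energy is at most 2 ||h||^2 <= 2 ||h||^2 t^2 / d^2, and the second
        summand compensates A t, which may be negative.\<close>
      define B where "B = 2 * (nrm h)\<^sup>2 / d\<^sup>2 + \<bar>A\<bar> / d"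
      have "(\<integral>x. h x * (h x - P t h x) \<partial>\<mu>) \<le> A * t + B * t\<^sup>2" if t: "t \<ge> 0" for t
      proof -
        have B0: "B \<ge> 0" using d by (simp add: B_def)
        consider "t = 0" | "0 < t \<and> t < d" | "t \<ge> d" using t by linarith
        then show ?thesis
        proof cases
          case 1
          then have "(\<integral>x. h x * (h x - P t h x) \<partial>\<mu>) = (\<integral>x. 0 \<partial>\<mu>)"
            using P_zero bdd_measD[OF hb] by (intro Bochner_Integration.integral_cong) auto
          then show ?thesis using 1 by simp
        next
          case 2
          have "0 \<le> B * t\<^sup>2" using B0 by simp
          then show ?thesis using 2 d(2)[of t] by linarith
        next
          case 3
          have "(\<integral>x. h x * (h x - P t h x) \<partial>\<mu>) \<le> nrm h * nrm (\<lambda>x. h x - P t h x)"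
            using Cauchy_Schwarz_L2[of h \<mu> "\<lambda>x. h x - P t h x"] hb t
            by (simp add: bdd_L2 bdd_meas_diff P_bdd)
          also have "nrm (\<lambda>x. h x - P t h x) \<le> nrm h + nrm (\<lambda>x. (-1) * P t h x)"
            using nrm_triangle[of h "\<lambda>x. (-1) * P t h x"] hb t by (simp add: P_bdd bdd_meas_minus)
          also have "\<dots> \<le> nrm h + nrm h"
            using P_contraction[OF t hb] Lp_norm_2_scale[of \<mu> "-1" "P t h"] by simp
          finally have "(\<integral>x. h x * (h x - P t h x) \<partial>\<mu>) \<le> 2 * (nrm h)\<^sup>2"
            by (simp add: power2_eq_square mult_left_mono)
          also have "\<dots> = 2 * (nrm h)\<^sup>2 / d\<^sup>2 * d\<^sup>2" using d by simp
          also have "\<dots> \<le> 2 * (nrm h)\<^sup>2 / d\<^sup>2 * t\<^sup>2"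
            using 3 d by (intro mult_left_mono power_mono) auto
          finally have 1: "(\<integral>x. h x * (h x - P t h x) \<partial>\<mu>) \<le> 2 * (nrm h)\<^sup>2 / d\<^sup>2 * t\<^sup>2" .
          have "\<bar>A\<bar> * t * d \<le> \<bar>A\<bar> * t * t" using 3 t by (intro mult_left_mono) auto
          then have "\<bar>A\<bar> * t \<le> \<bar>A\<bar> / d * t\<^sup>2" using d by (simp add: field_simps power2_eq_square)
          moreover have "- A * t \<le> \<bar>A\<bar> * t" using t by (intro mult_right_mono) auto
          ultimately show ?thesis using 1 by (simp add: B_def algebra_simps)
        qed
      qed
      note en = resolvent_energy[OF hb Gb G(2) pos this]
      have "eventually (\<lambda>n. 2 * B / (real n + 1) < e) sequentially"
        using inv \<open>e > 0\<close> by (rule order_tendstoD)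
      then show ?thesis
      proof eventually_elim
        case (elim n)
        then show ?case using en[of n] unfolding dir by linarith
      qed
    qed
    then show "\<forall>A. eventually (\<lambda>t. (\<integral>x. h x * (h x - P t h x) \<partial>\<mu>) \<le> A * t) (at_right 0) \<longrightarrow>
      (\<forall>e>0. eventually (\<lambda>n. dirichlet_form \<mu> K (G n) (G n) \<le> A + e) sequentially)" by blast
  qed
qed

end

section \<open>From the generator domain to the form domain\<close>

lemma bdd_meas_cong_sets:
  assumes "sets \<nu> = sets \<mu>" shows "bdd_meas \<nu> = bdd_meas \<mu>"
proof -
  have "borel_measurable \<nu> = (borel_measurable \<mu> :: ('a \<Rightarrow> real) set)"
    using assms by (rule measurable_cong_sets) simp
  then show ?thesis using sets_eq_imp_space_eq[OF assms] by (simp add: bdd_meas_def)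
qed

lemma valued_in_cong_sets:
  assumes "sets \<nu> = sets \<mu>" shows "valued_in \<nu> a b = valued_in \<mu> a b"
proof -
  have "borel_measurable \<nu> = (borel_measurable \<mu> :: ('a \<Rightarrow> real) set)"
    using assms by (rule measurable_cong_sets) simp
  then show ?thesis using sets_eq_imp_space_eq[OF assms] by (simp add: valued_in_def)
qed

lemma (in prob_space) Ent_power2_tendsto:
  assumes a: "0 < a" and u: "\<And>n::nat. u n \<in> valued_in M a b" and v: "v \<in> valued_in M a b"
    and lim: "(\<lambda>n. Lp_norm M 2 (\<lambda>x. u n x - v x)) \<longlonglongrightarrow> 0"
  shows "(\<lambda>n. \<integral>x. (u n x)\<^sup>2 \<partial>M) \<longlonglongrightarrow> (\<integral>x. (v x)\<^sup>2 \<partial>M)"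
    "(\<lambda>n. Ent M (\<lambda>x. (u n x)\<^sup>2)) \<longlonglongrightarrow> Ent M (\<lambda>x. (v x)\<^sup>2)"
proof -
  \<comment> \<open>The second variable is a dummy confined to the point 0, so that the two-variable
    limit lemma applies.\<close>
  have c1: "continuous_on ({a..b} \<times> {0..0}) (\<lambda>(x, q::real). x\<^sup>2)"
    unfolding split_beta by (intro continuous_intros)
  have c2: "continuous_on ({a..b} \<times> {0..0}) (\<lambda>(x, q::real). x\<^sup>2 * ln (x\<^sup>2))"
    unfolding split_beta using a by (intro continuous_intros) auto
  show 1: "(\<lambda>n. \<integral>x. (u n x)\<^sup>2 \<partial>M) \<longlonglongrightarrow> (\<integral>x. (v x)\<^sup>2 \<partial>M)"
    using integral_tendsto_valued_in[OF c1 _ v lim, of "\<lambda>_. 0" 0] u by simp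
  have 2: "(\<lambda>n. \<integral>x. (u n x)\<^sup>2 * ln ((u n x)\<^sup>2) \<partial>M) \<longlonglongrightarrow> (\<integral>x. (v x)\<^sup>2 * ln ((v x)\<^sup>2) \<partial>M)"
    using integral_tendsto_valued_in[OF c2 _ v lim, of "\<lambda>_. 0" 0] u by simp
  have "integrable M (\<lambda>x. (v x)\<^sup>2)"
    using v by (intro bdd_meas_integrable finite_measure_axioms bdd_meas_power2 valued_in_bdd)
  moreover have "a\<^sup>2 \<le> (v x)\<^sup>2" if "x \<in> space M" for x
    using valued_in_bounds[OF v that] a by (intro power_mono) auto
  \<comment> \<open>Keeps the mean away from 0, where the logarithm in the entropy is not
    continuous.\<close>
  ultimately have "a\<^sup>2 \<le> (\<integral>x. (v x)\<^sup>2 \<partial>M)" by (intro integral_ge_const AE_I2)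
  then have "0 < (\<integral>x. (v x)\<^sup>2 \<partial>M)" using a by (meson less_le_trans zero_less_power)
  then show "(\<lambda>n. Ent M (\<lambda>x. (u n x)\<^sup>2)) \<longlonglongrightarrow> Ent M (\<lambda>x. (v x)\<^sup>2)"
    unfolding Ent_def using 1 2 by (intro tendsto_diff tendsto_mult tendsto_ln) auto
qed

text \<open>A sum of nonpositive terms with a finite lower bound has no term equal to minus
  infinity; this is how the decomposition hypothesis makes each component form finite.\<close>

lemma ereal_nonpos_sum_le:
  fixes f :: "'i \<Rightarrow> ereal"
  assumes "finite I" "i \<in> I" "\<And>j. j \<in> I \<Longrightarrow> f j \<le> 0"
  shows "sum f I \<le> f i"
proof -
  have "sum f I = f i + sum f (I - {i})" using assms by (simp add: sum.remove)
  also have "\<dots> \<le> f i + 0" using assms by (intro add_left_mono sum_nonpos) auto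
  finally show ?thesis by simp
qed

context markov
begin

lemma inner_P_le:
  assumes "f \<in> bdd_meas \<mu>" "t \<ge> 0"
  shows "(\<integral>x. f x * P t f x \<partial>\<mu>) \<le> (\<integral>x. (f x)\<^sup>2 \<partial>\<mu>)"
proof -
  have "(\<integral>x. f x * P t f x \<partial>\<mu>) \<le> nrm f * nrm (P t f)"
    using Cauchy_Schwarz_L2[of f \<mu> "P t f"] assms by (simp add: bdd_L2 P_bdd)
  also have "\<dots> \<le> nrm f * nrm f" using assms by (intro mult_left_mono P_contraction) auto
  also have "nrm f * nrm f = (\<integral>x. (f x)\<^sup>2 \<partial>\<mu>)"
    using Lp_norm_2_power2[of \<mu> f] by (simp only: power2_eq_square)
  finally show ?thesis .
qed

lemma inner_quotient:
  assumes "f \<in> bdd_meas \<mu>" "t > 0"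
  shows "inner_L2 \<mu> f (\<lambda>x. (P t f x - f x) / t) = - (\<integral>x. f x * (f x - P t f x) \<partial>\<mu>) / t"
  unfolding inner_L2_def by (subst integral_minus[symmetric], subst integral_divide_zero[symmetric])
    (intro Bochner_Integration.integral_cong, auto simp: algebra_simps diff_divide_distrib)

lemma inner_quotient_nonpos:
  assumes f: "f \<in> bdd_meas \<mu>" and t: "t > 0"
  shows "inner_L2 \<mu> f (\<lambda>x. (P t f x - f x) / t) \<le> 0"
proof -
  have "(\<integral>x. f x * (f x - P t f x) \<partial>\<mu>) = (\<integral>x. (f x)\<^sup>2 \<partial>\<mu>) - (\<integral>x. f x * P t f x \<partial>\<mu>)"
    using f t by (subst Bochner_Integration.integral_diff[symmetric])
      (auto intro!: bdd_integrable bdd_meas_mult P_bdd Bochner_Integration.integral_cong simp: algebra_simps power2_eq_square)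
  then have "0 \<le> (\<integral>x. f x * (f x - P t f x) \<partial>\<mu>)" using inner_P_le[OF f, of t] t by simp
  then show ?thesis using t by (simp add: inner_quotient[OF f t])
qed

lemma eventually_inner_quotient_nonpos:
  assumes "f \<in> bdd_meas \<mu>"
  shows "eventually (\<lambda>t. inner_L2 \<mu> f (\<lambda>x. (P t f x - f x) / t) \<le> 0) (at_right 0)"
  using inner_quotient_nonpos[OF assms] by (auto simp: eventually_at_right_field intro!: exI[of _ 1])

lemma inner_quotient_tendsto:
  assumes g: "gen_rel \<mu> K f g" and f: "f \<in> bdd_meas \<mu>"
  shows "((\<lambda>t. inner_L2 \<mu> f (\<lambda>x. (P t f x - f x) / t)) \<longlongrightarrow> inner_L2 \<mu> f g) (at_right 0)"
proof (rule Lim_null[THEN iffD2], rule Lim_null_comparison)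
  have L: "g \<in> Lp_space \<mu> 2" using g by (simp add: gen_rel_def)
  have "norm (inner_L2 \<mu> f (\<lambda>x. (P t f x - f x) / t) - inner_L2 \<mu> f g) \<le> nrm f * nrm (\<lambda>x. (P t f x - f x) / t - g x)"
    if t: "t > 0" for t
  proof -
    have D: "(\<lambda>x. (P t f x - f x) / t) \<in> Lp_space \<mu> 2"
      using f t by (simp add: bdd_L2 bdd_meas_divide bdd_meas_diff P_bdd)
    have "inner_L2 \<mu> f (\<lambda>x. (P t f x - f x) / t) - inner_L2 \<mu> f g = (\<integral>x. f x * ((P t f x - f x) / t - g x) \<partial>\<mu>)"
      unfolding inner_L2_def using L2_mult_integrable[OF bdd_L2[OF f] D] L2_mult_integrable[OF bdd_L2[OF f] L]
      by (subst Bochner_Integration.integral_diff[symmetric]) (simp_all add: right_diff_distrib)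
    then show ?thesis using Cauchy_Schwarz_L2[OF bdd_L2[OF f] L2_diff[OF D L]] by simp
  qed
  then show "eventually (\<lambda>t. norm (inner_L2 \<mu> f (\<lambda>x. (P t f x - f x) / t) - inner_L2 \<mu> f g)
      \<le> nrm f * nrm (\<lambda>x. (P t f x - f x) / t - g x)) (at_right 0)"
    by (auto simp: eventually_at_right_field intro!: exI[of _ 1])
  show "((\<lambda>t. nrm f * nrm (\<lambda>x. (P t f x - f x) / t - g x)) \<longlongrightarrow> 0) (at_right 0)"
    using g by (intro tendsto_mult_right_zero) (simp add: gen_rel_def)
qed

lemma gen_dom_gen_rel: "f \<in> gen_dom \<mu> K \<Longrightarrow> gen_rel \<mu> K f (gen \<mu> K f)"
  unfolding gen_def gen_dom_def using someI[where P="gen_rel \<mu> K f"] by blast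

lemma inner_gen_nonpos:
  assumes "f \<in> gen_dom \<mu> K" "f \<in> bdd_meas \<mu>" shows "inner_L2 \<mu> f (gen \<mu> K f) \<le> 0"
  using inner_quotient_tendsto[OF gen_dom_gen_rel[OF assms(1)] assms(2)]
    eventually_inner_quotient_nonpos[OF assms(2)]
  by (rule tendsto_upperbound) simp

lemma gen_form_nonpos:
  assumes f: "f \<in> bdd_meas \<mu>" shows "gen_form \<mu> K f \<le> 0"
proof (cases "f \<in> gen_dom \<mu> K")
  case True
  then show ?thesis using inner_gen_nonpos f by (simp add: gen_form_def)
next
  case False
  let ?g = "\<lambda>t. ereal (inner_L2 \<mu> f (\<lambda>x. (P t f x - f x) / t))"
  have "Liminf (at_right 0) ?g \<le> Limsup (at_right 0) ?g" by (rule Liminf_le_Limsup) simp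
  also have "\<dots> \<le> 0"
    using eventually_inner_quotient_nonpos[OF f] by (intro Limsup_bounded) simp
  finally show ?thesis using False by (simp add: gen_form_def)
qed

text \<open>A value of the form, be it an inner product with the generator or a
  \<open>Liminf\<close>, bounds the difference quotients from below for all small \<open>t\<close>,
  which is the premise of the energy clause of \<open>domain_approximation\<close>.\<close>

lemma gen_form_eventually:
  assumes f: "f \<in> bdd_meas \<mu>" and r: "gen_form \<mu> K f = ereal r" and e: "e > 0"
  shows "eventually (\<lambda>t. (\<integral>x. f x * (f x - P t f x) \<partial>\<mu>) \<le> (- r + e) * t) (at_right 0)"
proof -
  have "eventually (\<lambda>t. r - e < inner_L2 \<mu> f (\<lambda>x. (P t f x - f x) / t)) (at_right 0)"
  proof (cases "f \<in> gen_dom \<mu> K")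
    case True
    then have "inner_L2 \<mu> f (gen \<mu> K f) = r" using r by (simp add: gen_form_def)
    then show ?thesis using inner_quotient_tendsto[OF gen_dom_gen_rel[OF True] f] e
      by (intro order_tendstoD) auto
  next
    case False
    then have "ereal (r - e) < Liminf (at_right 0) (\<lambda>t. ereal (inner_L2 \<mu> f (\<lambda>x. (P t f x - f x) / t)))"
      using r e by (simp add: gen_form_def)
    then show ?thesis by (auto dest: less_LiminfD)
  qed
  moreover have "eventually (\<lambda>t. t > 0) (at_right (0::real))" by (simp add: eventually_at_right_less)
  ultimately show ?thesis
    by eventually_elim (simp add: inner_quotient[OF f] field_simps)
qed

text \<open>Carries the logarithmic Sobolev inequality from the generator domain to functions of
  finite form: it holds for the resolvents of \<open>h\<close>, their entropies converge, and their
  energies are asymptotically at most - r.\<close>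

lemma form_log_sobolev:
  assumes lsi: "\<And>g. g \<in> gen_dom \<mu> K \<Longrightarrow> integrable \<mu> (\<lambda>x. (g x)\<^sup>2 * ln ((g x)\<^sup>2)) \<Longrightarrow>
      Ent \<mu> (\<lambda>x. (g x)\<^sup>2) \<le> 2 * c * dirichlet_form \<mu> K g g"
    and c: "c \<le> C" "0 < C" and h: "h \<in> valued_in \<mu> a b" "0 < a" "a \<le> b"
    and r: "gen_form \<mu> K h = ereal r"
  shows "Ent \<mu> (\<lambda>x. (h x)\<^sup>2) \<le> 2 * C * (- r)"
proof (rule field_le_epsilon)
  fix e :: real assume "e > 0"
  \<comment> \<open>Spent twice, on the form value and on the resolvent energy: 2 C times twice this
    is \<open>e\<close>.\<close>
  then have e: "e / (4 * C) > 0" using c by simp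
  obtain G where G: "\<And>n::nat. G n \<in> valued_in \<mu> a b" "\<And>n. G n \<in> gen_dom \<mu> K"
    "(\<lambda>n. nrm (\<lambda>x. G n x - h x)) \<longlonglongrightarrow> 0"
    "\<forall>A. eventually (\<lambda>t. (\<integral>x. h x * (h x - P t h x) \<partial>\<mu>) \<le> A * t) (at_right 0) \<longrightarrow>
      (\<forall>e>0. eventually (\<lambda>n. dirichlet_form \<mu> K (G n) (G n) \<le> A + e) sequentially)"
  proof (rule domain_approximation[OF h(1,3)], goal_cases)
    case (1 G)
    show ?case by (rule 1(1)[OF 1(2,3,4,5)])
  qed
  have "continuous_on {a..b} (\<lambda>x::real. x\<^sup>2 * ln (x\<^sup>2))" using h(2) by (intro continuous_intros) auto
  then have int: "integrable \<mu> (\<lambda>x. (G n x)\<^sup>2 * ln ((G n x)\<^sup>2))" for n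
    using valued_in_comp_bdd[OF _ G(1)] by (intro bdd_integrable) blast
  have "eventually (\<lambda>n. dirichlet_form \<mu> K (G n) (G n) \<le> (- r + e / (4 * C)) + e / (4 * C)) sequentially"
    by (intro G(4)[rule_format] gen_form_eventually[OF valued_in_bdd[OF h(1)] r] e)
  then have "eventually (\<lambda>n. Ent \<mu> (\<lambda>x. (G n x)\<^sup>2) \<le> 2 * C * (- r) + e) sequentially"
  proof eventually_elim
    case (elim n)
    \<comment> \<open>The sign of the energy is what allows \<open>c\<close> to be enlarged to
      \<open>C\<close>.\<close>
    have "0 \<le> dirichlet_form \<mu> K (G n) (G n)"
      using inner_gen_nonpos[OF G(2) valued_in_bdd[OF G(1)]] by (simp add: dirichlet_form_def)
    then have "2 * c * dirichlet_form \<mu> K (G n) (G n) \<le> 2 * C * dirichlet_form \<mu> K (G n) (G n)"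
      using c by (intro mult_right_mono) auto
    also have "\<dots> \<le> 2 * C * ((- r + e / (4 * C)) + e / (4 * C))"
      using elim c by (intro mult_left_mono) auto
    also have "\<dots> = 2 * C * (- r) + e" using c by (simp add: field_simps)
    finally show ?case using lsi[OF G(2) int, of n] by linarith
  qed
  then show "Ent \<mu> (\<lambda>x. (h x)\<^sup>2) \<le> 2 * C * (- r) + e"
    by (intro tendsto_upperbound[OF Ent_power2_tendsto(2)[OF h(2) G(1) h(1) G(3)]]) auto
qed

end

section \<open>Mixtures\<close>

lemma mixture_integral:
  assumes mix: "mixture m w \<nu> \<mu>" and fin: "finite_measure \<mu>" and u: "u \<in> bdd_meas \<mu>"
  shows "(\<integral>x. u x \<partial>\<mu>) = (\<Sum>k=1..m. w k * (\<integral>x. u x \<partial>\<nu> k))"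
proof -
  have sets: "sets (\<nu> k) = sets \<mu>" "finite_measure (\<nu> k)" if "k \<in> {1..m}" for k
    using mix that by (auto simp: mixture_def prob_space.finite_measure)
  have meas: "bdd_meas (\<nu> k) = bdd_meas \<mu>" if "k \<in> {1..m}" for k
    using sets(1)[OF that] by (rule bdd_meas_cong_sets)
  have int: "integrable (\<nu> k) u" if "k \<in> {1..m}" "u \<in> bdd_meas \<mu>" for k u
    using bdd_meas_integrable[OF sets(2)[OF that(1)]] meas that by simp
  have intm: "integrable \<mu> u" if "u \<in> bdd_meas \<mu>" for u
    using bdd_meas_integrable[OF fin that] .
  have "(\<integral>x. u x \<partial>\<mu>) - (\<Sum>k=1..m. w k * (\<integral>x. u x \<partial>\<nu> k)) = 0"
  proof (rule bdd_meas_functional_zero[where d="\<lambda>u. (\<integral>x. u x \<partial>\<mu>) - (\<Sum>k=1..m. w k * (\<integral>x. u x \<partial>\<nu> k))", OF _ _ _ _ u])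
    fix u v assume "u \<in> bdd_meas \<mu>" "v \<in> bdd_meas \<mu>"
    then show "(\<integral>x. u x + v x \<partial>\<mu>) - (\<Sum>k=1..m. w k * (\<integral>x. u x + v x \<partial>\<nu> k)) =
      ((\<integral>x. u x \<partial>\<mu>) - (\<Sum>k=1..m. w k * (\<integral>x. u x \<partial>\<nu> k))) + ((\<integral>x. v x \<partial>\<mu>) - (\<Sum>k=1..m. w k * (\<integral>x. v x \<partial>\<nu> k)))"
      using int intm by (simp add: ring_distribs sum.distrib)
  next
    fix u c assume "u \<in> bdd_meas \<mu>"
    then show "(\<integral>x. c * u x \<partial>\<mu>) - (\<Sum>k=1..m. w k * (\<integral>x. c * u x \<partial>\<nu> k)) =
      c * ((\<integral>x. u x \<partial>\<mu>) - (\<Sum>k=1..m. w k * (\<integral>x. u x \<partial>\<nu> k)))"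
      by (simp add: right_diff_distrib sum_distrib_left mult.left_commute)
  next
    fix A assume A: "A \<in> sets \<mu>"
    have "(\<integral>x. indicator A x \<partial>\<nu> k) = measure (\<nu> k) A" if "k \<in> {1..m}" for k
      using A sets[OF that] by simp
    then show "(\<integral>x. indicator A x \<partial>\<mu>) - (\<Sum>k=1..m. w k * (\<integral>x. indicator A x \<partial>\<nu> k)) = 0"
      using A mix by (simp add: mixture_def)
  next
    fix U :: "nat \<Rightarrow> 'a \<Rightarrow> real" and u
    assume U: "\<And>i. U i \<in> bdd_meas \<mu>" "u \<in> bdd_meas \<mu>"
      "\<And>i x. x \<in> space \<mu> \<Longrightarrow> 0 \<le> U i x \<and> U i x \<le> u x" "\<And>x. x \<in> space \<mu> \<Longrightarrow> (\<lambda>i. U i x) \<longlonglongrightarrow> u x"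
    have "(\<lambda>i. \<integral>x. U i x \<partial>\<nu> k) \<longlonglongrightarrow> (\<integral>x. u x \<partial>\<nu> k)" if k: "k \<in> {1..m}" for k
      using U int[OF k] sets_eq_imp_space_eq[OF sets(1)[OF k]]
      by (intro integral_dominated_convergence[where w=u]) (auto dest: borel_measurable_integrable)
    moreover have "(\<lambda>i. \<integral>x. U i x \<partial>\<mu>) \<longlonglongrightarrow> (\<integral>x. u x \<partial>\<mu>)"
      using U intm by (intro integral_dominated_convergence[where w=u]) (auto dest: bdd_measD)
    ultimately show "(\<lambda>i. (\<integral>x. U i x \<partial>\<mu>) - (\<Sum>k=1..m. w k * (\<integral>x. U i x \<partial>\<nu> k)))
        \<longlonglongrightarrow> (\<integral>x. u x \<partial>\<mu>) - (\<Sum>k=1..m. w k * (\<integral>x. u x \<partial>\<nu> k))"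
      by (intro tendsto_diff tendsto_sum tendsto_mult tendsto_const) auto
  qed
  then show ?thesis by simp
qed

lemma mixture_Ent:
  assumes mix: "mixture m w \<nu> \<mu>" and fin: "finite_measure \<mu>"
    and h: "h \<in> valued_in \<mu> a b" "0 < a" and ws: "0 < ws" "\<And>k. k \<in> {1..m} \<Longrightarrow> ws \<le> w k"
  shows "Ent \<mu> (\<lambda>x. (h x)\<^sup>2) \<le> (\<Sum>k=1..m. w k * Ent (\<nu> k) (\<lambda>x. (h x)\<^sup>2)) + ln (1 / ws) * (\<integral>x. (h x)\<^sup>2 \<partial>\<mu>)"
proof -
  define A where "A k = (\<integral>x. (h x)\<^sup>2 \<partial>\<nu> k)" for k
  define S where "S = (\<integral>x. (h x)\<^sup>2 \<partial>\<mu>)"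
  define E where "E k = (\<integral>x. (h x)\<^sup>2 * ln ((h x)\<^sup>2) \<partial>\<nu> k)" for k
  have bd: "(\<lambda>x. (h x)\<^sup>2) \<in> bdd_meas \<mu>" using h by (intro bdd_meas_power2 valued_in_bdd)
  have "continuous_on {a..b} (\<lambda>x::real. x\<^sup>2 * ln (x\<^sup>2))" using h(2) by (intro continuous_intros) auto
  then have bd2: "(\<lambda>x. (h x)\<^sup>2 * ln ((h x)\<^sup>2)) \<in> bdd_meas \<mu>" using h(1) by (rule valued_in_comp_bdd)
  have w: "0 < w k" if "k \<in> {1..m}" for k using mix that by (simp add: mixture_def)
  have Apos: "0 < A k" if k: "k \<in> {1..m}" for k
  proof -
    interpret n: prob_space "\<nu> k" using mix k by (simp add: mixture_def)
    have s: "sets (\<nu> k) = sets \<mu>" using mix k by (simp add: mixture_def)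
    have sp: "space (\<nu> k) = space \<mu>" using s by (rule sets_eq_imp_space_eq)
    have "(\<lambda>x. (h x)\<^sup>2) \<in> bdd_meas (\<nu> k)"
      using bd bdd_meas_cong_sets[OF s] by simp
    then have "integrable (\<nu> k) (\<lambda>x. (h x)\<^sup>2)" by (intro bdd_meas_integrable n.finite_measure_axioms)
    moreover have "a\<^sup>2 \<le> (h x)\<^sup>2" if "x \<in> space (\<nu> k)" for x
      using valued_in_bounds[OF h(1), of x] h(2) that by (intro power_mono) (auto simp: sp)
    ultimately have "a\<^sup>2 \<le> A k" unfolding A_def by (intro n.integral_ge_const AE_I2)
    then show ?thesis using h(2) by (meson less_le_trans zero_less_power)
  qed
  have S: "S = (\<Sum>k=1..m. w k * A k)" unfolding S_def A_def by (rule mixture_integral[OF mix fin bd])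
  have le: "w k * A k \<le> S" if "k \<in> {1..m}" for k
    unfolding S using that Apos w by (intro member_le_sum) (auto intro: less_imp_le)
  have lnle: "w k * A k * ln (A k) \<le> w k * A k * (ln S + ln (1 / ws))" if k: "k \<in> {1..m}" for k
  proof (rule mult_left_mono)
    have Sp: "S > 0" using le[OF k] mult_pos_pos[OF w[OF k] Apos[OF k]] by linarith
    have "ws * A k \<le> w k * A k" using ws(2)[OF k] Apos[OF k] by (intro mult_right_mono) auto
    then have "A k \<le> S * (1 / ws)" using le[OF k] ws(1) by (simp add: field_simps)
    then have "ln (A k) \<le> ln (S * (1 / ws))" using Apos[OF k] by (intro ln_mono) auto
    also have "\<dots> = ln S + ln (1 / ws)" using Sp ws(1) by (intro ln_mult_pos) auto
    finally show "ln (A k) \<le> ln S + ln (1 / ws)" .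
    show "0 \<le> w k * A k" using w[OF k] Apos[OF k] by simp
  qed
  have "(\<integral>x. (h x)\<^sup>2 * ln ((h x)\<^sup>2) \<partial>\<mu>) = (\<Sum>k=1..m. w k * E k)"
    unfolding E_def by (rule mixture_integral[OF mix fin bd2])
  also have "\<dots> = (\<Sum>k=1..m. w k * (E k - A k * ln (A k))) + (\<Sum>k=1..m. w k * A k * ln (A k))"
    by (simp add: sum.distrib[symmetric] algebra_simps)
  also have "\<dots> \<le> (\<Sum>k=1..m. w k * (E k - A k * ln (A k))) + (\<Sum>k=1..m. w k * A k * (ln S + ln (1 / ws)))"
    by (intro add_left_mono sum_mono lnle)
  also have "(\<Sum>k=1..m. w k * A k * (ln S + ln (1 / ws))) = S * (ln S + ln (1 / ws))"
    unfolding S by (simp add: sum_distrib_right)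
  finally show ?thesis by (simp add: Ent_def E_def[symmetric] A_def[symmetric] S_def[symmetric] algebra_simps)
qed

section \<open>The hypotheses of the theorem and the defective logarithmic Sobolev
  inequality\<close>

locale lsi_mixture = markov \<mu> K for \<mu> :: "'a measure" and K +
  fixes m :: nat and w c :: "nat \<Rightarrow> real" and \<nu> :: "nat \<Rightarrow> 'a measure"
    and \<kappa> :: "nat \<Rightarrow> real \<Rightarrow> 'a \<Rightarrow> 'a measure" and C ws :: real
  assumes rev: "reversible \<mu> K"
    and mix: "mixture m w \<nu> \<mu>"
    and processes: "\<And>k. k \<in> {1..m} \<Longrightarrow> markov_process (\<nu> k) (\<kappa> k)"
    and decomposition: "\<And>g. g \<in> gen_dom \<mu> K \<Longrightarrow>
      ereal (inner_L2 \<mu> g (gen \<mu> K g)) \<le> (\<Sum>k=1..m. ereal (w k) * gen_form (\<nu> k) (\<kappa> k) g)"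
    and log_sobolev: "\<And>k g. k \<in> {1..m} \<Longrightarrow> g \<in> gen_dom (\<nu> k) (\<kappa> k) \<Longrightarrow>
      integrable (\<nu> k) (\<lambda>x. (g x)\<^sup>2 * ln ((g x)\<^sup>2)) \<Longrightarrow>
      Ent (\<nu> k) (\<lambda>x. (g x)\<^sup>2) \<le> 2 * c k * dirichlet_form (\<nu> k) (\<kappa> k) g g"
    and C: "C = Max (c ` {1..m})" "C > 0"
    and ws: "ws = Min (w ` {1..m})"
begin

lemma weights: "0 < ws" "\<And>k. k \<in> {1..m} \<Longrightarrow> ws \<le> w k" "\<And>k. k \<in> {1..m} \<Longrightarrow> 0 < w k" "ws \<le> 1"
proof -
  have m: "{1..m} \<noteq> {}"
  proof
    assume "{1..m} = {}"
    then show False using mix unfolding mixture_def by simp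
  qed
  show w: "0 < w k" if "k \<in> {1..m}" for k using mix that by (simp add: mixture_def)
  show "0 < ws" unfolding ws using m w by (subst Min_gr_iff) auto
  show le: "ws \<le> w k" if "k \<in> {1..m}" for k unfolding ws using that by (intro Min_le) auto
  obtain k where k: "k \<in> {1..m}" using m by blast
  have "w k \<le> (\<Sum>k=1..m. w k)" using k w by (intro member_le_sum) (auto intro: less_imp_le)
  also have "\<dots> = 1" using mix by (simp add: mixture_def)
  finally show "ws \<le> 1" using le[OF k] by linarith
qed

lemma constants_le: "k \<in> {1..m} \<Longrightarrow> c k \<le> C"
  unfolding C(1) by (intro Max_ge) auto

lemma component_valued_in: "k \<in> {1..m} \<Longrightarrow> valued_in (\<nu> k) a b = valued_in \<mu> a b"
proof -
  assume "k \<in> {1..m}"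
  then have "sets (\<nu> k) = sets \<mu>" using mix by (simp add: mixture_def)
  then show ?thesis by (rule valued_in_cong_sets)
qed

lemma component_markov: "k \<in> {1..m} \<Longrightarrow> markov (\<nu> k) (\<kappa> k)"
  using processes by (intro markov.intro markov_axioms.intro) (auto simp: markov_process_def)

lemma defective_log_sobolev_domain:
  assumes g: "g \<in> gen_dom \<mu> K" "g \<in> valued_in \<mu> a b" "0 < a" "a \<le> b"
  shows "Ent \<mu> (\<lambda>x. (g x)\<^sup>2) \<le> 2 * C * dirichlet_form \<mu> K g g + ln (1 / ws) * (\<integral>x. (g x)\<^sup>2 \<partial>\<mu>)"
proof -
  define L where "L k = gen_form (\<nu> k) (\<kappa> k) g" for k
  have L0: "L k \<le> 0" if k: "k \<in> {1..m}" for k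
  proof -
    interpret k: markov "\<nu> k" "\<kappa> k" using k by (rule component_markov)
    have "g \<in> valued_in (\<nu> k) a b" using g k component_valued_in by simp
    then show ?thesis unfolding L_def by (intro k.gen_form_nonpos valued_in_bdd)
  qed
  have dec: "ereal (inner_L2 \<mu> g (gen \<mu> K g)) \<le> (\<Sum>k=1..m. ereal (w k) * L k)"
    unfolding L_def by (rule decomposition[OF g(1)])
  \<comment> \<open>The sum is bounded below by a real number and its terms are nonpositive, so none
    of them is minus infinity.\<close>
  have "\<exists>r. L k = ereal r" if k: "k \<in> {1..m}" for k
  proof -
    have "ereal (inner_L2 \<mu> g (gen \<mu> K g)) \<le> ereal (w k) * L k"
      using dec by (rule order_trans)
        (intro ereal_nonpos_sum_le[where f="\<lambda>k. ereal (w k) * L k"], use k L0 weights(3) in \<open>auto simp: ereal_mult_le_0_iff less_imp_le\<close>)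
    then have "L k \<noteq> -\<infinity>" using weights(3)[OF k] by auto
    then show ?thesis using L0[OF k] by (cases "L k") auto
  qed
  then obtain r where r: "\<And>k. k \<in> {1..m} \<Longrightarrow> L k = ereal (r k)" by metis
  have "(\<Sum>k=1..m. ereal (w k) * L k) = ereal (\<Sum>k=1..m. w k * r k)"
    using r by simp
  then have "inner_L2 \<mu> g (gen \<mu> K g) \<le> (\<Sum>k=1..m. w k * r k)" using dec by simp
  then have D: "(\<Sum>k=1..m. w k * (- r k)) \<le> dirichlet_form \<mu> K g g"
    by (simp add: dirichlet_form_def sum_negf)
  have "Ent (\<nu> k) (\<lambda>x. (g x)\<^sup>2) \<le> 2 * C * (- r k)" if k: "k \<in> {1..m}" for k
  proof -
    interpret k: markov "\<nu> k" "\<kappa> k" using k by (rule component_markov)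
    have "g \<in> valued_in (\<nu> k) a b" using g k component_valued_in by simp
    then show ?thesis
      using log_sobolev[OF k] constants_le[OF k] C(2) g(3,4) r[OF k] unfolding L_def
      by (intro k.form_log_sobolev)
  qed
  then have "(\<Sum>k=1..m. w k * Ent (\<nu> k) (\<lambda>x. (g x)\<^sup>2)) \<le> (\<Sum>k=1..m. w k * (2 * C * (- r k)))"
    using weights(3) by (intro sum_mono mult_left_mono) (auto intro: less_imp_le)
  also have "\<dots> = 2 * C * (\<Sum>k=1..m. w k * (- r k))" by (simp add: sum_distrib_left mult_ac)
  also have "\<dots> \<le> 2 * C * dirichlet_form \<mu> K g g" using D C(2) by (intro mult_left_mono) auto
  finally show ?thesis
    using mixture_Ent[OF mix finite_measure_axioms g(2,3) weights(1,2)] by linarith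
qed

text \<open>The second passage through resolvents, now of the main process: it will be applied to
  powers of P_r G, about which nothing but a bound \<open>A\<close> on small-time quotients can be
  assumed.\<close>

lemma defective_log_sobolev:
  assumes h: "h \<in> valued_in \<mu> a b" "0 < a" "a \<le> b"
    and A: "eventually (\<lambda>t. (\<integral>x. h x * (h x - P t h x) \<partial>\<mu>) \<le> A * t) (at_right 0)"
  shows "Ent \<mu> (\<lambda>x. (h x)\<^sup>2) \<le> 2 * C * A + ln (1 / ws) * (\<integral>x. (h x)\<^sup>2 \<partial>\<mu>)"
proof (rule field_le_epsilon)
  fix e :: real assume "e > 0"
  then have e: "e / (2 * C) > 0" using C by simp
  obtain G where G: "\<And>n::nat. G n \<in> valued_in \<mu> a b" "\<And>n. G n \<in> gen_dom \<mu> K"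
    "(\<lambda>n. nrm (\<lambda>x. G n x - h x)) \<longlonglongrightarrow> 0"
    "\<forall>A. eventually (\<lambda>t. (\<integral>x. h x * (h x - P t h x) \<partial>\<mu>) \<le> A * t) (at_right 0) \<longrightarrow>
      (\<forall>e>0. eventually (\<lambda>n. dirichlet_form \<mu> K (G n) (G n) \<le> A + e) sequentially)"
  proof (rule domain_approximation[OF h(1,3)], goal_cases)
    case (1 G)
    show ?case by (rule 1(1)[OF 1(2,3,4,5)])
  qed
  have "eventually (\<lambda>n. dirichlet_form \<mu> K (G n) (G n) \<le> A + e / (2 * C)) sequentially"
    by (intro G(4)[rule_format] A e)
  then have ev: "eventually (\<lambda>n. Ent \<mu> (\<lambda>x. (G n x)\<^sup>2) \<le> (2 * C * A + e) + ln (1 / ws) * (\<integral>x. (G n x)\<^sup>2 \<partial>\<mu>)) sequentially"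
  proof eventually_elim
    case (elim n)
    have "2 * C * dirichlet_form \<mu> K (G n) (G n) \<le> 2 * C * (A + e / (2 * C))"
      using elim C by (intro mult_left_mono) auto
    also have "\<dots> = 2 * C * A + e" using C by (simp add: field_simps)
    finally show ?case using defective_log_sobolev_domain[OF G(2) G(1) h(2,3), of n] by linarith
  qed
  have "Ent \<mu> (\<lambda>x. (h x)\<^sup>2) \<le> (2 * C * A + e) + ln (1 / ws) * (\<integral>x. (h x)\<^sup>2 \<partial>\<mu>)"
    using Ent_power2_tendsto[OF h(2) G(1) h(1) G(3)] ev
    by (intro tendsto_le[where F=sequentially and f="\<lambda>n. (2 * C * A + e) + ln (1 / ws) * (\<integral>x. (G n x)\<^sup>2 \<partial>\<mu>)"])
      (auto intro!: tendsto_intros)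
  then show "Ent \<mu> (\<lambda>x. (h x)\<^sup>2) \<le> 2 * C * A + ln (1 / ws) * (\<integral>x. (h x)\<^sup>2 \<partial>\<mu>) + e" by linarith
qed

end

section \<open>The Stroock--Varopoulos inequality\<close>

text \<open>The difference vanishes at 0 and has derivative r (cosh x - cosh (r x)), which is
  nonnegative for 0 <= r <= 1.\<close>

lemma sinh_mult_le:
  fixes r z :: real
  assumes "0 \<le> r" "r \<le> 1" "0 \<le> z"
  shows "sinh (r * z) \<le> r * sinh z"
proof -
  have "r * sinh 0 - sinh (r * 0) \<le> r * sinh z - sinh (r * z)"
  proof (rule DERIV_nonneg_imp_nondecreasing[OF assms(3)])
    fix x :: real assume x: "0 \<le> x" "x \<le> z"
    have "((\<lambda>z. r * sinh z - sinh (r * z)) has_real_derivative r * (cosh x - cosh (r * x))) (at x)"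
      by (auto intro!: derivative_eq_intros simp: algebra_simps)
    moreover have "r * x \<le> x" using assms x mult_right_mono[of r 1 x] by simp
    then have "cosh (r * x) \<le> cosh x" using assms x by (subst cosh_real_nonneg_le_iff) auto
    ultimately show "\<exists>y. ((\<lambda>z. r * sinh z - sinh (r * z)) has_real_derivative y) (at x) \<and> 0 \<le> y"
      using assms(1) by (intro exI[of _ "r * (cosh x - cosh (r * x))"]) auto
  qed
  then show ?thesis by simp
qed

lemma sinh_mult_power2_le:
  fixes r z :: real
  assumes "\<bar>r\<bar> \<le> 1"
  shows "(sinh (r * z))\<^sup>2 \<le> r\<^sup>2 * (sinh z)\<^sup>2"
proof -
  have "(sinh (\<bar>r\<bar> * \<bar>z\<bar>))\<^sup>2 \<le> (\<bar>r\<bar> * sinh \<bar>z\<bar>)\<^sup>2"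
    using sinh_mult_le[of "\<bar>r\<bar>" "\<bar>z\<bar>"] assms by (intro power_mono) auto
  then show ?thesis by (simp add: abs_mult[symmetric] sinh_real_abs power_mult_distrib)
qed

text \<open>Put a = exp (u + v), b = exp (u - v), z = q v / 2 and r = (q - 2) / q. The common factor
  4 exp (q u) drops out, and sinh ((q - 1) v) sinh v = sinh^2 z - sinh^2 (r z) with 4 (q - 1) / q^2
  = 1 - r^2 reduces the claim to sinh^2 (r z) <= r^2 sinh^2 z.\<close>

lemma powr_Stroock_Varopoulos:
  fixes a b q :: real
  assumes ab: "a > 0" "b > 0" and q: "q > 1"
  shows "4 * (q - 1) / q\<^sup>2 * (a powr (q / 2) - b powr (q / 2))\<^sup>2 \<le> (a powr (q - 1) - b powr (q - 1)) * (a - b)"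
proof -
  define u v where "u = (ln a + ln b) / 2" and "v = (ln a - ln b) / 2"
  have l: "ln a = u + v" "ln b = u - v" by (simp_all add: u_def v_def field_simps)
  have d: "a powr s - b powr s = 2 * exp (s * u) * sinh (s * v)" for s
  proof -
    have "a powr s = exp (s * u) * exp (s * v)" "b powr s = exp (s * u) * exp (- (s * v))"
      using ab by (simp_all add: powr_def l exp_add[symmetric] algebra_simps)
    then show ?thesis by (simp add: sinh_field_def algebra_simps)
  qed
  have d1: "a - b = 2 * exp u * sinh v" using d[of 1] ab by simp
  define z where "z = q * v / 2"
  define r where "r = (q - 2) / q"
  have r: "\<bar>r\<bar> \<le> 1" using q by (simp add: r_def field_simps abs_le_iff)
  have rz: "r * z = (q - 2) * v / 2" using q by (simp add: r_def z_def field_simps)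
  have "cosh (2 * z) = cosh ((q - 1) * v) * cosh v + sinh ((q - 1) * v) * sinh v"
    by (subst cosh_add[symmetric]) (simp add: z_def algebra_simps)
  moreover have "cosh (2 * (r * z)) = cosh ((q - 1) * v) * cosh v - sinh ((q - 1) * v) * sinh v"
  proof -
    have "2 * (r * z) = (q - 1) * v - v" unfolding rz by (simp add: field_simps)
    then show ?thesis by (simp only: cosh_diff)
  qed
  moreover have "cosh (2 * x) = 1 + 2 * (sinh x)\<^sup>2" for x :: real
    by (simp add: cosh_double cosh_square_eq)
  ultimately have prod: "sinh ((q - 1) * v) * sinh v = (sinh z)\<^sup>2 - (sinh (r * z))\<^sup>2" by simp
  have q2: "4 * (q - 1) / q\<^sup>2 = 1 - r\<^sup>2" using q by (simp add: r_def field_simps power2_eq_square)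
  have "4 * (q - 1) / q\<^sup>2 * (sinh z)\<^sup>2 \<le> sinh ((q - 1) * v) * sinh v"
    using sinh_mult_power2_le[OF r, of z] unfolding q2 prod by (simp add: algebra_simps)
  then have "4 * exp (q * u) * (4 * (q - 1) / q\<^sup>2 * (sinh z)\<^sup>2) \<le> 4 * exp (q * u) * (sinh ((q - 1) * v) * sinh v)"
    by (intro mult_left_mono) auto
  moreover have "4 * (q - 1) / q\<^sup>2 * (2 * exp (q / 2 * u) * sinh (q / 2 * v))\<^sup>2
      = 4 * exp (q * u) * (4 * (q - 1) / q\<^sup>2 * (sinh z)\<^sup>2)"
  proof -
    have "(exp (q / 2 * u))\<^sup>2 = exp (q * u)" by (simp add: exp_double[symmetric])
    then show ?thesis by (simp add: power_mult_distrib z_def)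
  qed
  moreover have "(2 * exp ((q - 1) * u) * sinh ((q - 1) * v)) * (2 * exp u * sinh v)
      = 4 * exp (q * u) * (sinh ((q - 1) * v) * sinh v)"
  proof -
    have "exp (q * u) = exp ((q - 1) * u) * exp u" by (simp add: exp_add[symmetric] algebra_simps)
    then show ?thesis by simp
  qed
  ultimately show ?thesis unfolding d d1 by linarith
qed

text \<open>Integrate the two-point inequality over y against \<open>K t x\<close> and then over x
  against \<open>\<mu>\<close>: by invariance and reversibility the double integral of (f x - f y)
  (g x - g y) is 2 <f, g - P_t g>. Working at a fixed time needs no domain condition.\<close>

lemma (in markov) reversible_form_comparison:
  assumes rev: "reversible \<mu> K" and t: "t \<ge> 0"
    and f: "f \<in> bdd_meas \<mu>" and g: "g \<in> bdd_meas \<mu>" and w: "w \<in> bdd_meas \<mu>"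
    and le: "\<And>x y. \<lbrakk>x \<in> space \<mu>; y \<in> space \<mu>\<rbrakk> \<Longrightarrow> c * (w x - w y)\<^sup>2 \<le> (f x - f y) * (g x - g y)"
  shows "c * (\<integral>x. w x * (w x - P t w x) \<partial>\<mu>) \<le> (\<integral>x. f x * (g x - P t g x) \<partial>\<mu>)"
proof -
  let ?fg = "\<lambda>x. f x * g x" and ?w2 = "\<lambda>x. (w x)\<^sup>2"
  have b: "?fg \<in> bdd_meas \<mu>" "?w2 \<in> bdd_meas \<mu>" using f g w by auto
  note bi = bdd_integrable[OF bdd_meas_mult]
  have pt: "c * (?w2 x - 2 * (w x * P t w x) + P t ?w2 x) \<le> ?fg x - f x * P t g x - g x * P t f x + P t ?fg x"
    if x: "x \<in> space \<mu>" for x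
  proof -
    interpret k: prob_space "K t x" using t x by (rule kernelD)
    note ik = bdd_integrable_kernel[OF t x]
    have "(\<integral>y. c * (?w2 x - 2 * w x * w y + ?w2 y) \<partial>K t x) \<le> (\<integral>y. ?fg x - f x * g y - g x * f y + ?fg y \<partial>K t x)"
    proof (rule integral_mono)
      show "integrable (K t x) (\<lambda>y. c * (?w2 x - 2 * w x * w y + ?w2 y))"
        using ik[OF w] ik[OF b(2)] by simp
      show "integrable (K t x) (\<lambda>y. ?fg x - f x * g y - g x * f y + ?fg y)"
        using ik[OF f] ik[OF g] ik[OF b(1)] by simp
      show "c * (?w2 x - 2 * w x * w y + ?w2 y) \<le> ?fg x - f x * g y - g x * f y + ?fg y"
        if "y \<in> space (K t x)" for y
        using le[OF x, of y] that t x by (simp add: kernelD power2_diff algebra_simps)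
    qed
    then show ?thesis using ik[OF f] ik[OF g] ik[OF w] ik[OF b(1)] ik[OF b(2)]
      by (simp add: markov_op_def k.prob_space mult.assoc)
  qed
  have "c * (2 * (\<integral>x. ?w2 x \<partial>\<mu>) - 2 * (\<integral>x. w x * P t w x \<partial>\<mu>))
      = (\<integral>x. c * (?w2 x - 2 * (w x * P t w x) + P t ?w2 x) \<partial>\<mu>)"
    using bdd_integrable[OF b(2)] bdd_integrable[OF P_bdd[OF t b(2)]] bi[OF w P_bdd[OF t w]]
    by (simp add: P_invariant[OF t b(2)])
  also have "\<dots> \<le> (\<integral>x. ?fg x - f x * P t g x - g x * P t f x + P t ?fg x \<partial>\<mu>)"
    using pt bdd_integrable[OF b(2)] bdd_integrable[OF P_bdd[OF t b(2)]] bi[OF w P_bdd[OF t w]]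
      bdd_integrable[OF b(1)] bdd_integrable[OF P_bdd[OF t b(1)]] bi[OF f P_bdd[OF t g]] bi[OF g P_bdd[OF t f]]
    by (intro integral_mono) simp_all
  also have "\<dots> = 2 * (\<integral>x. ?fg x \<partial>\<mu>) - (\<integral>x. f x * P t g x \<partial>\<mu>) - (\<integral>x. g x * P t f x \<partial>\<mu>)"
    using bdd_integrable[OF b(1)] bdd_integrable[OF P_bdd[OF t b(1)]] bi[OF f P_bdd[OF t g]] bi[OF g P_bdd[OF t f]]
    by (simp add: P_invariant[OF t b(1)])
  \<comment> \<open>Reversibility merges the two cross terms.\<close>
  also have "(\<integral>x. g x * P t f x \<partial>\<mu>) = (\<integral>x. f x * P t g x \<partial>\<mu>)"
    using rev t bdd_L2[OF f] bdd_L2[OF g] unfolding reversible_def inner_L2_def by (metis (no_types, lifting) mult.commute Bochner_Integration.integral_cong)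
  finally have "2 * (c * ((\<integral>x. ?w2 x \<partial>\<mu>) - (\<integral>x. w x * P t w x \<partial>\<mu>))) \<le> 2 * ((\<integral>x. ?fg x \<partial>\<mu>) - (\<integral>x. f x * P t g x \<partial>\<mu>))"
    by (simp add: algebra_simps)
  moreover have "(\<integral>x. w x * (w x - P t w x) \<partial>\<mu>) = (\<integral>x. ?w2 x \<partial>\<mu>) - (\<integral>x. w x * P t w x \<partial>\<mu>)"
    using bdd_integrable[OF b(2)] bi[OF w P_bdd[OF t w]] by (simp add: right_diff_distrib power2_eq_square)
  moreover have "(\<integral>x. f x * (g x - P t g x) \<partial>\<mu>) = (\<integral>x. ?fg x \<partial>\<mu>) - (\<integral>x. f x * P t g x \<partial>\<mu>)"
    using bdd_integrable[OF b(1)] bi[OF f P_bdd[OF t g]] by (simp add: right_diff_distrib)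
  ultimately show ?thesis by simp
qed

section \<open>Monotonicity along the semigroup\<close>

text \<open>The set where psi stays below the line of slope \<open>e\<close> from \<open>s\<close>
  is closed, hence has a largest point; a single admissible small \<open>h\<close> there would
  extend it. One such \<open>h\<close> is enough, so \<open>frequently\<close>, a condition on the
  lower right Dini derivative, suffices.\<close>

lemma dini_nonincreasing:
  fixes \<psi> :: "real \<Rightarrow> real"
  assumes st: "s \<le> t" and cont: "continuous_on {s..t} \<psi>"
    and dini: "\<And>r e. \<lbrakk>s \<le> r; r < t; e > 0\<rbrakk> \<Longrightarrow> frequently (\<lambda>h. \<psi> (r + h) \<le> \<psi> r + e * h) (at_right 0)"
  shows "\<psi> t \<le> \<psi> s"
proof (rule field_le_epsilon)
  fix e0 :: real assume "e0 > 0"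
  \<comment> \<open>The total rise along the line is then at most \<open>e0\<close>; the added 1
    covers s = t.\<close>
  define e where "e = e0 / (t - s + 1)"
  have e: "e > 0" using st \<open>e0 > 0\<close> by (simp add: e_def)
  define S where "S = {x \<in> {s..t}. \<psi> x \<le> \<psi> s + e * (x - s)}"
  have "closed S" unfolding S_def
    by (rule continuous_on_closed_Collect_le[OF cont]) (auto intro!: continuous_intros)
  moreover have "bounded S" by (rule bounded_subset[OF bounded_closed_interval[of s t]]) (auto simp: S_def)
  ultimately have "compact S" by (simp add: compact_eq_bounded_closed)
  moreover have "s \<in> S" using st by (simp add: S_def)
  ultimately obtain z where z: "z \<in> S" "\<And>x. x \<in> S \<Longrightarrow> x \<le> z" using compact_attains_sup[of S] by blast
  have "z = t"
  proof (rule ccontr)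
    assume "z \<noteq> t"
    then have zt: "s \<le> z" "z < t" using z(1) by (auto simp: S_def)
    have "eventually (\<lambda>h. h \<in> {0<..<t - z}) (at_right 0)" using zt by (intro eventually_at_right_real) simp
    then have "frequently (\<lambda>h. \<psi> (z + h) \<le> \<psi> z + e * h \<and> h \<in> {0<..<t - z}) (at_right 0)"
      by (intro frequently_rev_mp[OF dini[OF zt e]]) (auto elim: eventually_mono)
    then obtain h where h: "\<psi> (z + h) \<le> \<psi> z + e * h" "0 < h" "h < t - z" by (auto dest!: frequently_ex)
    have "\<psi> z \<le> \<psi> s + e * (z - s)" using z(1) by (simp add: S_def)
    then have "z + h \<in> S" using h zt by (simp add: S_def algebra_simps)
    then show False using z(2) h by fastforce
  qed
  then have "\<psi> t \<le> \<psi> s + e * (t - s)" using z(1) by (simp add: S_def)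
  also have "e * (t - s) \<le> e * (t - s + 1)" using e by simp
  also have "\<dots> = e0" using st by (simp add: e_def)
  finally show "\<psi> t \<le> \<psi> s + e0" by simp
qed

text \<open>Convexity of x -> x^q, with the tangent taken at the later value
  \<open>y\<close>.\<close>

lemma powr_tangent_le:
  fixes x y q :: real
  assumes "x > 0" "y > 0" "q \<ge> 1"
  shows "y powr q - x powr q \<le> q * y powr (q - 1) * (y - x)"
proof -
  have mvt: "\<exists>z. z > u \<and> z < v \<and> v powr q - u powr q = (v - u) * (q * z powr (q - 1))" if "0 < u" "u < v" for u v :: real
    using that by (intro MVT2) (auto intro!: derivative_eq_intros)
  consider "x = y" | "x < y" | "y < x" by linarith
  then show ?thesis
  proof cases
    case 2
    then obtain z where z: "z > x" "z < y" "y powr q - x powr q = (y - x) * (q * z powr (q - 1))"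
      using mvt assms by blast
    have "z powr (q - 1) \<le> y powr (q - 1)" using z assms by (intro powr_mono2) auto
    then have "(y - x) * (q * z powr (q - 1)) \<le> (y - x) * (q * y powr (q - 1))"
      using 2 assms by (intro mult_left_mono) auto
    then show ?thesis using z(3) by (simp add: mult_ac)
  next
    case 3
    then obtain z where z: "z > y" "z < x" "x powr q - y powr q = (x - y) * (q * z powr (q - 1))"
      using mvt assms by blast
    have "y powr (q - 1) \<le> z powr (q - 1)" using z assms by (intro powr_mono2) auto
    then have "(x - y) * (q * y powr (q - 1)) \<le> (x - y) * (q * z powr (q - 1))"
      using 3 assms by (intro mult_left_mono) auto
    then show ?thesis using z(3) by (simp add: algebra_simps)
  qed auto
qed

text \<open>From 1 + x <= exp x. The slope is taken at the new exponent, so only continuity in time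
  of the logarithmic integral is needed later.\<close>

lemma powr_exponent_le:
  fixes v q r :: real
  assumes "v > 0"
  shows "v powr r - v powr q \<le> (r - q) * (v powr r * ln v)"
proof -
  have "v powr r * (1 + (q - r) * ln v) \<le> v powr r * exp ((q - r) * ln v)"
    by (intro mult_left_mono exp_ge_add_one_self) auto
  also have "\<dots> = v powr q" using assms by (simp add: powr_def exp_add[symmetric] algebra_simps)
  finally show ?thesis by (simp add: algebra_simps)
qed

lemma powr_lipschitz:
  fixes a b s :: real
  assumes a: "0 < a"
  obtains \<Lambda> where "\<Lambda> \<ge> 0" "\<And>x y. x \<in> {a..b} \<Longrightarrow> y \<in> {a..b} \<Longrightarrow> \<bar>x powr s - y powr s\<bar> \<le> \<Lambda> * \<bar>x - y\<bar>"
proof -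
  have "continuous_on {a..b} (\<lambda>z. s * z powr (s - 1))" using a by (intro continuous_intros) auto
  then have "bounded ((\<lambda>z. s * z powr (s - 1)) ` {a..b})" by (intro compact_imp_bounded compact_continuous_image) auto
  then obtain B where "\<forall>y\<in>(\<lambda>z. s * z powr (s - 1)) ` {a..b}. norm y \<le> B" unfolding bounded_iff by blast
  then have B: "\<bar>s * z powr (s - 1)\<bar> \<le> B" if "z \<in> {a..b}" for z using that by simp
  have lt: "\<bar>y powr s - x powr s\<bar> \<le> \<bar>B\<bar> * \<bar>y - x\<bar>" if xy: "x \<in> {a..b}" "y \<in> {a..b}" "x < y" for x y
  proof -
    have "\<exists>z. z > x \<and> z < y \<and> y powr s - x powr s = (y - x) * (s * z powr (s - 1))"
      using xy a by (intro MVT2) (auto intro!: derivative_eq_intros)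
    then obtain z where z: "z > x" "z < y" "y powr s - x powr s = (y - x) * (s * z powr (s - 1))" by blast
    then have "\<bar>y powr s - x powr s\<bar> = \<bar>s * z powr (s - 1)\<bar> * \<bar>y - x\<bar>" by (simp add: abs_mult)
    also have "\<dots> \<le> \<bar>B\<bar> * \<bar>y - x\<bar>" using B[of z] z xy by (intro mult_right_mono) auto
    finally show ?thesis .
  qed
  have "\<bar>x powr s - y powr s\<bar> \<le> \<bar>B\<bar> * \<bar>x - y\<bar>" if "x \<in> {a..b}" "y \<in> {a..b}" for x y
    using lt[of x y] lt[of y x] that by (cases x y rule: linorder_cases) (auto simp: abs_minus_commute)
  then show ?thesis using that[of "\<bar>B\<bar>"] by simp
qed

lemma powr_continuous_on_strip:
  fixes a b d :: real
  assumes "0 < a"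
  shows "continuous_on ({a..b} \<times> {1..d}) (\<lambda>(x, q). x powr q)"
    "continuous_on ({a..b} \<times> {1..d}) (\<lambda>(x, q). x powr q * ln x)"
  unfolding split_beta using assms by (intro continuous_intros; force)+

lemma (in prob_space) integral_powr_pos:
  assumes u: "u \<in> valued_in M a b" and a: "0 < a"
  shows "0 < (\<integral>x. u x powr q \<partial>M)"
proof -
  have "continuous_on {a..b} (\<lambda>x. x powr q)" using a by (intro continuous_intros) auto
  then have "integrable M (\<lambda>x. u x powr q)"
    using u by (intro bdd_meas_integrable finite_measure_axioms valued_in_comp_bdd[of a b "\<lambda>x. x powr q"])
  moreover have "min (a powr q) (b powr q) \<le> u x powr q" if "x \<in> space M" for x
  proof (cases "q \<ge> 0")
    case True
    then have "a powr q \<le> u x powr q" using valued_in_bounds[OF u that] a by (intro powr_mono2) auto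
    then show ?thesis by simp
  next
    case False
    then have "b powr q \<le> u x powr q" using valued_in_bounds[OF u that] a by (intro powr_mono2') auto
    then show ?thesis by simp
  qed
  ultimately have "min (a powr q) (b powr q) \<le> (\<integral>x. u x powr q \<partial>M)" by (intro integral_ge_const AE_I2)
  moreover have "0 < b"
  proof -
    obtain x where "x \<in> space M" using not_empty by blast
    then show ?thesis using valued_in_bounds[OF u] a by fastforce
  qed
  then have "0 < min (a powr q) (b powr q)" using a by simp
  ultimately show ?thesis by linarith
qed

section \<open>Gross's argument for data that are Lipschitz in time\<close>

context lsi_mixture
begin

definition expo :: "real \<Rightarrow> real \<Rightarrow> real" where
  "expo p t = 1 + (p - 1) * exp (2 * t / C)"

text \<open>For data in \<open>{a..b}\<close> with \<open>a > 0\<close> this is the logarithm of the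
  quotient in the theorem.\<close>

definition potential :: "real \<Rightarrow> ('a \<Rightarrow> real) \<Rightarrow> real \<Rightarrow> real" where
  "potential p G t = (ln (\<integral>x. P t G x powr expo p t \<partial>\<mu>) + ln (1 / ws)) / expo p t"

lemma expo_gt_1: "p > 1 \<Longrightarrow> expo p t > 1"
  by (simp add: expo_def)

lemma expo_mono: "p > 1 \<Longrightarrow> s \<le> t \<Longrightarrow> expo p s \<le> expo p t"
  using C(2) by (simp add: expo_def divide_right_mono)

text \<open>The differential equation that the exponent is built to satisfy: q' = q * (4 (q - 1) /
  q^2) * q / (2 C).\<close>

lemma expo_deriv: "(expo p has_real_derivative 2 * (expo p t - 1) / C) (at t)"
  unfolding expo_def[abs_def] using C by (auto intro!: derivative_eq_intros)

lemma expo_continuous: "continuous_on S (expo p)"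
  using expo_deriv by (meson DERIV_continuous_on has_field_derivative_at_within)

text \<open>\<open>F\<close> is left general to serve both x^q and x^q ln x. The exponents near time
  \<open>r\<close> stay below \<open>expo p (r + 1)\<close>, hence the continuity assumption for
  every \<open>d\<close>.\<close>

lemma semigroup_integral_continuous:
  fixes F :: "real \<Rightarrow> real \<Rightarrow> real"
  assumes p: "p > 1" and G: "G \<in> valued_in \<mu> a b" and L: "\<And>t. t \<ge> 0 \<Longrightarrow> nrm (\<lambda>x. P t G x - G x) \<le> L * t"
    and F: "\<And>d. continuous_on ({a..b} \<times> {1..d}) (\<lambda>(x, q). F x q)"
  shows "continuous_on {0..} (\<lambda>t. \<integral>x. F (P t G x) (expo p t) \<partial>\<mu>)"
  unfolding continuous_on_def
proof
  fix r :: real assume "r \<in> {0..}"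
  then have r: "r \<ge> 0" by simp
  have ev0: "eventually (\<lambda>t. t \<in> {0..}) (at r within {0..})" by (simp add: eventually_at_filter)
  have "eventually (\<lambda>t. t < r + 1) (at r within {0..})"
    by (rule order_tendstoD(2)[OF tendsto_ident_at]) simp
  then have ev1: "eventually (\<lambda>t. expo p t \<in> {1..expo p (r + 1)}) (at r within {0..})"
    by eventually_elim (use expo_gt_1[OF p] expo_mono[OF p] in \<open>auto intro: less_imp_le\<close>)
  show "((\<lambda>t. \<integral>x. F (P t G x) (expo p t) \<partial>\<mu>) \<longlongrightarrow> (\<integral>x. F (P r G x) (expo p r) \<partial>\<mu>)) (at r within {0..})"
  proof (rule integral_tendsto_valued_in[OF F _ P_valued_in[OF r G] _ _ ev1])
    show "eventually (\<lambda>t. P t G \<in> valued_in \<mu> a b) (at r within {0..})"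
      using ev0 by eventually_elim (simp add: P_valued_in G)
    show "(expo p \<longlongrightarrow> expo p r) (at r within {0..})"
      using expo_continuous[of UNIV p] by (simp add: continuous_on_eq_continuous_at isCont_def tendsto_within_subset[of _ _ _ UNIV])
    show "expo p r \<in> {1..expo p (r + 1)}"
      using expo_gt_1[OF p] expo_mono[OF p] by (auto intro: less_imp_le)
    show "((\<lambda>t. nrm (\<lambda>x. P t G x - P r G x)) \<longlongrightarrow> 0) (at r within {0..})"
    proof (rule Lim_null_comparison)
      show "eventually (\<lambda>t. norm (nrm (\<lambda>x. P t G x - P r G x)) \<le> L * \<bar>t - r\<bar>) (at r within {0..})"
        using ev0
      proof eventually_elim
        case (elim t)
        then have "nrm (\<lambda>x. P t G x - P r G x) \<le> nrm (\<lambda>x. P \<bar>t - r\<bar> G x - G x)"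
          using r valued_in_bdd[OF G] by (intro P_diff_le) auto
        also have "\<dots> \<le> L * \<bar>t - r\<bar>" by (rule L) simp
        finally show ?case by simp
      qed
      have "((\<lambda>t. L * \<bar>t - r\<bar>) \<longlongrightarrow> L * \<bar>r - r\<bar>) (at r within {0..})"
        by (intro tendsto_intros)
      then show "((\<lambda>t. L * \<bar>t - r\<bar>) \<longlongrightarrow> 0) (at r within {0..})" by simp
    qed
  qed
qed

text \<open>Along a suitable sequence \<open>h \<rightarrow> 0\<close> only: if the quotients of the form at \<open>u\<^bsup>q/2\<^esup>\<close> stayed
  below the entropy bound for all small \<open>h\<close>, the defective inequality would be violated.\<close>

lemma form_quotient_frequently:
  assumes u: "u \<in> valued_in \<mu> a b" "0 < a" "a \<le> b" and q: "q > 1" and e: "e > 0"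
  shows "frequently (\<lambda>h. h * ((Ent \<mu> (\<lambda>x. u x powr q) - ln (1 / ws) * (\<integral>x. u x powr q \<partial>\<mu>)) / (2 * C) - e)
      \<le> (\<integral>x. u x powr (q / 2) * (u x powr (q / 2) - P h (\<lambda>x. u x powr (q / 2)) x) \<partial>\<mu>)) (at_right 0)"
proof (rule ccontr)
  let ?w = "\<lambda>x. u x powr (q / 2)"
  let ?A = "(Ent \<mu> (\<lambda>x. u x powr q) - ln (1 / ws) * (\<integral>x. u x powr q \<partial>\<mu>)) / (2 * C) - e"
  have w2: "(?w x)\<^sup>2 = u x powr q" for x by (simp add: power2_eq_square powr_add[symmetric])
  have m: "?w \<in> borel_measurable \<mu>" using valued_inD[OF u(1)] by measurable
  have w: "?w \<in> valued_in \<mu> (a powr (q / 2)) (b powr (q / 2))"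
    unfolding valued_in_def using m u q
    by (auto intro!: powr_mono2 dest: valued_in_bounds[OF u(1)] intro: order_trans less_imp_le)
  assume "\<not> frequently (\<lambda>h. h * ?A \<le> (\<integral>x. ?w x * (?w x - P h ?w x) \<partial>\<mu>)) (at_right 0)"
  then have "eventually (\<lambda>h. (\<integral>x. ?w x * (?w x - P h ?w x) \<partial>\<mu>) \<le> ?A * h) (at_right 0)"
    unfolding not_frequently by eventually_elim (simp add: mult.commute)
  then have "Ent \<mu> (\<lambda>x. (?w x)\<^sup>2) \<le> 2 * C * ?A + ln (1 / ws) * (\<integral>x. (?w x)\<^sup>2 \<partial>\<mu>)"
    using u q by (intro defective_log_sobolev[OF w]) (auto intro!: powr_mono2)
  moreover have "2 * C * ?A = Ent \<mu> (\<lambda>x. u x powr q) - ln (1 / ws) * (\<integral>x. u x powr q \<partial>\<mu>) - 2 * C * e"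
    using C by (simp add: field_simps)
  moreover have "0 < 2 * C * e" using C e by simp
  ultimately show False unfolding w2 by linarith
qed

text \<open>A finite-difference version of the derivative of the integral of (P_t G)^q(t): the
  second line comes from the exponent, the third from the function through Stroock-Varopoulos, and
  the last is a remainder of order h^2.\<close>

lemma power_integral_step:
  assumes p: "p > 1" and G: "G \<in> valued_in \<mu> a b" "0 < a"
    and L: "\<And>t. t \<ge> 0 \<Longrightarrow> nrm (\<lambda>x. P t G x - G x) \<le> L * t"
    and \<Lambda>: "\<Lambda> \<ge> 0" "\<And>x y. x \<in> {a..b} \<Longrightarrow> y \<in> {a..b} \<Longrightarrow>
      \<bar>x powr (expo p r - 1) - y powr (expo p r - 1)\<bar> \<le> \<Lambda> * \<bar>x - y\<bar>"
    and r: "r \<ge> 0" and h: "h \<ge> 0"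
  defines "q \<equiv> expo p r" and "q' \<equiv> expo p (r + h)"
  shows "(\<integral>x. P (r + h) G x powr q' \<partial>\<mu>) \<le> (\<integral>x. P r G x powr q \<partial>\<mu>)
    + (q' - q) * (\<integral>x. P (r + h) G x powr q' * ln (P (r + h) G x) \<partial>\<mu>)
    - q * (4 * (q - 1) / q\<^sup>2) * (\<integral>x. P r G x powr (q / 2) * (P r G x powr (q / 2) - P h (\<lambda>x. P r G x powr (q / 2)) x) \<partial>\<mu>)
    + q * \<Lambda> * (L * h)\<^sup>2"
proof -
  define u where "u = P r G"
  define v where "v = P (r + h) G"
  have q: "q > 1" using expo_gt_1[OF p] by (simp add: q_def)
  have Gb: "G \<in> bdd_meas \<mu>" using G(1) by (rule valued_in_bdd)
  have u: "u \<in> valued_in \<mu> a b" and v: "v \<in> valued_in \<mu> a b"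
    unfolding u_def v_def using G r h by (auto intro!: P_valued_in)
  have vu: "v x = P h u x" if "x \<in> space \<mu>" for x
    unfolding u_def v_def using P_semigroup[OF h r that Gb] by (simp add: add.commute)
  note ub = valued_in_bounds[OF u] and vb = valued_in_bounds[OF v]
  have cp: "(\<lambda>x. z x powr s) \<in> bdd_meas \<mu>" if "z \<in> valued_in \<mu> a b" for z s
    using G(2) that by (intro valued_in_comp_bdd[of a b "\<lambda>x. x powr s"] continuous_intros) auto
  have cpl: "(\<lambda>x. z x powr s * ln (z x)) \<in> bdd_meas \<mu>" if "z \<in> valued_in \<mu> a b" for z s
    using G(2) that by (intro valued_in_comp_bdd[of a b "\<lambda>x. x powr s * ln x"] continuous_intros) auto
  have bu: "u \<in> bdd_meas \<mu>" and bv: "v \<in> bdd_meas \<mu>" using u v by (auto intro: valued_in_bdd)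
  \<comment> \<open>First the exponent changes at \<open>v\<close>, then the function changes from
    \<open>u\<close> to \<open>v\<close>. The tangent slope v^(q-1) is replaced by u^(q-1), the
    function tested in the form at time \<open>r\<close>, at a cost controlled by
    \<open>\<Lambda>\<close>.\<close>
  have pt: "v x powr q' \<le> u x powr q + (q' - q) * (v x powr q' * ln (v x)) + q * (u x powr (q - 1) * (v x - u x))
      + q * \<Lambda> * (v x - u x)\<^sup>2" if x: "x \<in> space \<mu>" for x
  proof -
    have pos: "0 < u x" "0 < v x" using ub[OF x] vb[OF x] G(2) by auto
    have 1: "v x powr q' - v x powr q \<le> (q' - q) * (v x powr q' * ln (v x))" by (rule powr_exponent_le[OF pos(2)])
    have 2: "v x powr q - u x powr q \<le> q * v x powr (q - 1) * (v x - u x)" using pos q by (intro powr_tangent_le) auto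
    have "(v x powr (q - 1) - u x powr (q - 1)) * (v x - u x) \<le> \<bar>v x powr (q - 1) - u x powr (q - 1)\<bar> * \<bar>v x - u x\<bar>"
      by (metis abs_ge_self abs_mult)
    also have "\<dots> \<le> \<Lambda> * \<bar>v x - u x\<bar> * \<bar>v x - u x\<bar>"
      unfolding q_def using ub[OF x] vb[OF x] by (intro mult_right_mono \<Lambda>(2)) auto
    also have "\<dots> = \<Lambda> * (v x - u x)\<^sup>2" by (simp add: power2_eq_square mult.assoc abs_mult_self_eq)
    finally have "q * ((v x powr (q - 1) - u x powr (q - 1)) * (v x - u x)) \<le> q * (\<Lambda> * (v x - u x)\<^sup>2)"
      using q by (intro mult_left_mono) auto
    then show ?thesis using 1 2 by (simp add: algebra_simps)
  qed
  have i: "integrable \<mu> (\<lambda>x. v x powr q')" "integrable \<mu> (\<lambda>x. u x powr q)"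
    "integrable \<mu> (\<lambda>x. v x powr q' * ln (v x))" "integrable \<mu> (\<lambda>x. u x powr (q - 1) * (v x - u x))"
    "integrable \<mu> (\<lambda>x. (v x - u x)\<^sup>2)"
    using cp[OF u] cp[OF v] cpl[OF v] bu bv
    by (auto intro!: bdd_integrable intro: bdd_meas_mult bdd_meas_diff bdd_meas_power2)
  have "(\<integral>x. v x powr q' \<partial>\<mu>) \<le> (\<integral>x. u x powr q + (q' - q) * (v x powr q' * ln (v x)) + q * (u x powr (q - 1) * (v x - u x))
      + q * \<Lambda> * (v x - u x)\<^sup>2 \<partial>\<mu>)"
    using i pt by (intro integral_mono) auto
  also have "\<dots> = (\<integral>x. u x powr q \<partial>\<mu>) + (q' - q) * (\<integral>x. v x powr q' * ln (v x) \<partial>\<mu>)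
      + q * (\<integral>x. u x powr (q - 1) * (v x - u x) \<partial>\<mu>) + q * \<Lambda> * (\<integral>x. (v x - u x)\<^sup>2 \<partial>\<mu>)"
    using i by simp
  finally have main: "(\<integral>x. v x powr q' \<partial>\<mu>) \<le> \<dots>" .
  have "4 * (q - 1) / q\<^sup>2 * (\<integral>x. u x powr (q / 2) * (u x powr (q / 2) - P h (\<lambda>x. u x powr (q / 2)) x) \<partial>\<mu>)
      \<le> (\<integral>x. u x powr (q - 1) * (u x - P h u x) \<partial>\<mu>)"
    using ub G(2) q by (intro reversible_form_comparison[OF rev h] cp[OF u] bu powr_Stroock_Varopoulos) (auto intro: less_le_trans)
  also have "\<dots> = - (\<integral>x. u x powr (q - 1) * (v x - u x) \<partial>\<mu>)"
    by (subst integral_minus[symmetric], intro Bochner_Integration.integral_cong) (auto simp: vu algebra_simps)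
  finally have "q * (4 * (q - 1) / q\<^sup>2 * (\<integral>x. u x powr (q / 2) * (u x powr (q / 2) - P h (\<lambda>x. u x powr (q / 2)) x) \<partial>\<mu>))
      \<le> q * - (\<integral>x. u x powr (q - 1) * (v x - u x) \<partial>\<mu>)"
    using q by (intro mult_left_mono) auto
  moreover have "(\<integral>x. (v x - u x)\<^sup>2 \<partial>\<mu>) \<le> (L * h)\<^sup>2"
  proof -
    have "nrm (\<lambda>x. v x - u x) \<le> nrm (\<lambda>x. P \<bar>(r + h) - r\<bar> G x - G x)"
      unfolding u_def v_def using r h Gb by (intro P_diff_le) auto
    also have "\<dots> \<le> L * h" using L[OF h] h by simp
    finally have "(nrm (\<lambda>x. v x - u x))\<^sup>2 \<le> (L * h)\<^sup>2" by (intro power_mono) auto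
    then show ?thesis by (simp add: Lp_norm_2_power2)
  qed
  then have "q * \<Lambda> * (\<integral>x. (v x - u x)\<^sup>2 \<partial>\<mu>) \<le> q * \<Lambda> * (L * h)\<^sup>2"
    using q \<Lambda>(1) by (intro mult_left_mono) auto
  ultimately show ?thesis using main unfolding u_def[symmetric] v_def[symmetric] by (simp add: mult.assoc)
qed

text \<open>For suitable arbitrarily small \<open>h\<close> the integral is at most N r + h
  \<open>\<beta>\<close>; replacing it by this linear bound gives \<open>\<Phi>\<close>, whose
  derivative at 0 is e / 2 < e. Only the form quotient is merely \<open>frequently\<close>
  controlled, every other estimate holds eventually.\<close>

lemma potential_dini:
  assumes p: "p > 1" and G: "G \<in> valued_in \<mu> a b" "0 < a" "a \<le> b"
    and L: "\<And>t. t \<ge> 0 \<Longrightarrow> nrm (\<lambda>x. P t G x - G x) \<le> L * t"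
    and r: "r \<ge> 0" and e: "e > 0"
  shows "frequently (\<lambda>h. potential p G (r + h) \<le> potential p G r + e * h) (at_right 0)"
proof -
  define q where "q = expo p r"
  define N where "N t = (\<integral>x. P t G x powr expo p t \<partial>\<mu>)" for t
  define I where "I t = (\<integral>x. P t G x powr expo p t * ln (P t G x) \<partial>\<mu>)" for t
  define D where "D = ln (1 / ws)"
  define c where "c = 4 * (q - 1) / q\<^sup>2"
  define q1 where "q1 = 2 * (q - 1) / C"
  define Ev where "Ev = Ent \<mu> (\<lambda>x. P r G x powr q)"
  define A where "A = (Ev - D * N r) / (2 * C)"
  have q: "q > 1" using expo_gt_1[OF p] by (simp add: q_def)
  have c: "c > 0" using q by (simp add: c_def)
  have PG: "P t G \<in> valued_in \<mu> a b" if "t \<ge> 0" for t using P_valued_in[OF that G(1)] .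
  have Npos: "N t > 0" if "t \<ge> 0" for t
    unfolding N_def by (rule integral_powr_pos[OF PG[OF that] G(2)])
  \<comment> \<open>\<open>\<eta>\<close> enters the linear bound with the factor 1 + q c; this
    value makes its share of the slope of \<open>\<Phi>\<close> equal to e / 2.\<close>
  define \<eta> where "\<eta> = e * N r * q / (2 * (1 + q * c))"
  have qc: "1 + q * c > 0" using q c by (simp add: add_pos_pos)
  have \<eta>: "\<eta> > 0" using e Npos[OF r] q qc by (simp add: \<eta>_def)
  obtain \<Lambda> where \<Lambda>: "\<Lambda> \<ge> 0" "\<And>x y. x \<in> {a..b} \<Longrightarrow> y \<in> {a..b} \<Longrightarrow>
      \<bar>x powr (expo p r - 1) - y powr (expo p r - 1)\<bar> \<le> \<Lambda> * \<bar>x - y\<bar>"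
    using powr_lipschitz[OF G(2)] by metis
  \<comment> \<open>The first summand is the growth rate at which the derivative of
    \<open>\<Phi>\<close> would vanish; the second is the slack.\<close>
  define \<beta> where "\<beta> = q1 / q * N r * (ln (N r) + D) + \<eta> * (1 + q * c)"
  have Ev: "Ev = q * I r - N r * ln (N r)"
  proof -
    have "(\<integral>x. P r G x powr q * ln (P r G x powr q) \<partial>\<mu>) = (\<integral>x. q * (P r G x powr q * ln (P r G x)) \<partial>\<mu>)"
      using PG[OF r] G(2) by (intro Bochner_Integration.integral_cong) (auto simp: ln_powr dest!: valued_in_bounds)
    then show ?thesis by (simp add: Ev_def Ent_def I_def N_def q_def)
  qed
  \<comment> \<open>The cancellation behind the choice of exponent: the coefficient of
    \<open>I r\<close> is precisely \<open>q1\<close>, the derivative of \<open>expo p\<close> at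
    \<open>r\<close>.\<close>
  have qcA: "q * c * A = q1 * I r - q1 / q * N r * (ln (N r) + D)"
    unfolding A_def Ev c_def q1_def using q C by (simp add: field_simps power2_eq_square)
  have IcontAt: "((\<lambda>h. I (r + h)) \<longlongrightarrow> I r) (at_right 0)"
  proof -
    have "continuous_on {0..} I"
      unfolding I_def using semigroup_integral_continuous[OF p G(1) L powr_continuous_on_strip(2)[OF G(2)]] .
    then have "(I \<longlongrightarrow> I r) (at r within {0..})" using r by (simp add: continuous_on_def)
    then have "(I \<longlongrightarrow> I r) (at_right r)" by (rule tendsto_within_subset) (use r in auto)
    then show ?thesis by (subst (asm) filterlim_at_right_to_0) (simp add: add.commute)
  qed
  have quot: "((\<lambda>h. (expo p (r + h) - q) / h) \<longlongrightarrow> q1) (at_right 0)"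
  proof -
    have "((\<lambda>h. (expo p (r + h) - q) / h) \<longlongrightarrow> q1) (at 0)"
      using expo_deriv[of p r] by (simp add: DERIV_def q_def q1_def)
    then show ?thesis by (rule tendsto_within_subset) simp
  qed
  have "((\<lambda>h. (expo p (r + h) - q) / h * I (r + h) + q * \<Lambda> * L\<^sup>2 * h) \<longlongrightarrow> q1 * I r + q * \<Lambda> * L\<^sup>2 * 0) (at_right 0)"
    by (intro tendsto_add tendsto_mult quot IcontAt tendsto_const tendsto_ident_at)
  then have ev1: "eventually (\<lambda>h. (expo p (r + h) - q) / h * I (r + h) + q * \<Lambda> * L\<^sup>2 * h < q1 * I r + \<eta>) (at_right 0)"
    by (rule order_tendstoD(2)) (use \<eta> in simp)
  have evpos: "eventually (\<lambda>h. h > 0) (at_right (0::real))" by (simp add: eventually_at_right_less)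
  define \<Phi> where "\<Phi> h = (ln (N r + h * \<beta>) + D) / expo p (r + h)" for h
  have "(\<Phi> has_real_derivative \<beta> / (N r * q) - (ln (N r) + D) * q1 / q\<^sup>2) (at 0)"
  proof -
    have "((\<lambda>h. expo p (r + h)) has_real_derivative q1) (at 0)"
      using expo_deriv[of p r] DERIV_shift[of "expo p" q1 0 r]
      by (simp add: q1_def q_def add.commute)
    then show ?thesis
      unfolding \<Phi>_def[abs_def] using Npos[OF r] q
      by (auto intro!: derivative_eq_intros simp: q_def field_simps power2_eq_square)
  qed
  moreover have "\<beta> / (N r * q) - (ln (N r) + D) * q1 / q\<^sup>2 = e / 2"
  proof -
    have eq: "\<eta> * (1 + q * c) = e * N r * q / 2" 
    proof -
      have "x / (2 * k) * k = x / 2" if "k > 0" for x k :: real using that by simp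
      then show ?thesis unfolding \<eta>_def using qc by blast
    qed
    then have "\<beta> = N r * q * (q1 / q\<^sup>2 * (ln (N r) + D) + e / 2)"
      unfolding \<beta>_def eq using q by (simp add: field_simps power2_eq_square)
    then show ?thesis using Npos[OF r] q by (simp add: mult.commute)
  qed
  ultimately have "((\<lambda>h. (\<Phi> h - \<Phi> 0) / h) \<longlongrightarrow> e / 2) (at 0)" by (simp add: DERIV_def)
  then have "((\<lambda>h. (\<Phi> h - \<Phi> 0) / h) \<longlongrightarrow> e / 2) (at_right 0)" by (rule tendsto_within_subset) simp
  then have ev2: "eventually (\<lambda>h. (\<Phi> h - \<Phi> 0) / h < e) (at_right 0)"
    by (rule order_tendstoD(2)) (use e in simp)
  have "frequently (\<lambda>h. h * (A - \<eta>)
      \<le> (\<integral>x. P r G x powr (q / 2) * (P r G x powr (q / 2) - P h (\<lambda>x. P r G x powr (q / 2)) x) \<partial>\<mu>)) (at_right 0)"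
    using form_quotient_frequently[OF PG[OF r] G(2,3) q \<eta>] by (simp add: A_def Ev_def N_def D_def q_def)
  then show ?thesis
  proof (rule frequently_rev_mp)
    show "eventually (\<lambda>h. h * (A - \<eta>)
        \<le> (\<integral>x. P r G x powr (q / 2) * (P r G x powr (q / 2) - P h (\<lambda>x. P r G x powr (q / 2)) x) \<partial>\<mu>)
      \<longrightarrow> potential p G (r + h) \<le> potential p G r + e * h) (at_right 0)"
      using ev1 ev2 evpos
    proof eventually_elim
      case (elim h)
      show ?case
      proof
        let ?E = "\<integral>x. P r G x powr (q / 2) * (P r G x powr (q / 2) - P h (\<lambda>x. P r G x powr (q / 2)) x) \<partial>\<mu>"
        assume "h * (A - \<eta>) \<le> ?E"
        then have E: "q * c * (h * (A - \<eta>)) \<le> q * c * ?E" using q c by (intro mult_left_mono) auto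
        have rh: "r + h \<ge> 0" using r elim by simp
        have "((expo p (r + h) - q) / h * I (r + h) + q * \<Lambda> * L\<^sup>2 * h) * h \<le> (q1 * I r + \<eta>) * h"
          using elim by (intro mult_right_mono) auto
        then have 1: "(expo p (r + h) - q) * I (r + h) + q * \<Lambda> * (L * h)\<^sup>2 \<le> (q1 * I r + \<eta>) * h"
        proof -
          have "(x / h * i + k * L\<^sup>2 * h) * h = x * i + k * (L * h)\<^sup>2" for x i k :: real
            using elim(3) by (simp add: distrib_right power2_eq_square)
          then show ?thesis using \<open>_ * h \<le> (q1 * I r + \<eta>) * h\<close> by (simp only:)
        qed
        have "N (r + h) \<le> N r + (expo p (r + h) - q) * I (r + h) - q * c * ?E + q * \<Lambda> * (L * h)\<^sup>2"
          using power_integral_step[OF p G(1,2) L \<Lambda> r less_imp_le[OF elim(3)]]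
          by (simp add: N_def I_def q_def c_def)
        also have "\<dots> \<le> N r + (q1 * I r + \<eta>) * h - q * c * (h * (A - \<eta>))" using 1 E by linarith
        also have "\<dots> = N r + (q1 * I r - q * c * A) * h + \<eta> * (1 + q * c) * h" by (simp add: algebra_simps)
        also have "\<dots> = N r + h * \<beta>" unfolding qcA \<beta>_def by (simp add: algebra_simps)
        finally have "ln (N (r + h)) \<le> ln (N r + h * \<beta>)" using Npos[OF rh] by (intro ln_mono) auto
        then have "potential p G (r + h) \<le> \<Phi> h"
          unfolding potential_def \<Phi>_def D_def N_def using expo_gt_1[OF p, of "r + h"] by (intro divide_right_mono) auto
        also have "\<Phi> h \<le> \<Phi> 0 + e * h" using elim by (simp add: field_simps)
        also have "\<Phi> 0 = potential p G r" by (simp add: \<Phi>_def potential_def N_def D_def)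
        finally show "potential p G (r + h) \<le> potential p G r + e * h" .
      qed
    qed
  qed
qed

lemma potential_nonincreasing_lipschitz:
  assumes p: "p > 1" and G: "G \<in> valued_in \<mu> a b" "0 < a" "a \<le> b"
    and L: "\<And>t. t \<ge> 0 \<Longrightarrow> nrm (\<lambda>x. P t G x - G x) \<le> L * t" and st: "0 \<le> s" "s \<le> t"
  shows "potential p G t \<le> potential p G s"
proof (rule dini_nonincreasing[OF st(2)])
  have "continuous_on {0..} (\<lambda>t. \<integral>x. P t G x powr expo p t \<partial>\<mu>)"
    by (rule semigroup_integral_continuous[OF p G(1) L powr_continuous_on_strip(1)[OF G(2)]])
  then have "continuous_on {s..t} (\<lambda>t. \<integral>x. P t G x powr expo p t \<partial>\<mu>)"
    by (rule continuous_on_subset) (use st in auto)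
  moreover have "(\<integral>x. P r G x powr expo p r \<partial>\<mu>) \<noteq> 0" if "r \<in> {s..t}" for r
    using integral_powr_pos[OF P_valued_in[OF _ G(1)] G(2), of r "expo p r"] that st by auto
  moreover have "expo p r \<noteq> 0" for r using expo_gt_1[OF p, of r] by simp
  ultimately show "continuous_on {s..t} (potential p G)"
    unfolding potential_def[abs_def] by (intro continuous_intros expo_continuous) auto
  show "frequently (\<lambda>h. potential p G (r + h) \<le> potential p G r + e * h) (at_right 0)"
    if "s \<le> r" "r < t" "e > 0" for r e
    using that st by (intro potential_dini[OF p G L]) auto
qed

end

section \<open>Removing the regularity assumptions\<close>

context markov
begin

text \<open>Near 0 the difference quotient is within distance 1 of the generator, and from
  \<open>d\<close> on the contraction bound 2 ||G|| is at most (2 ||G|| / d) t. This provides the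
  Lipschitz premise of Gross's argument for the resolvents.\<close>

lemma gen_dom_lipschitz:
  assumes dom: "G \<in> gen_dom \<mu> K" and G: "G \<in> bdd_meas \<mu>"
  obtains L where "\<And>t. t \<ge> 0 \<Longrightarrow> nrm (\<lambda>x. P t G x - G x) \<le> L * t"
proof -
  obtain g where g: "gen_rel \<mu> K G g" using dom by (auto simp: gen_dom_def)
  have Lg: "g \<in> Lp_space \<mu> 2" using g by (simp add: gen_rel_def)
  have "eventually (\<lambda>t. nrm (\<lambda>x. (P t G x - G x) / t - g x) < 1) (at_right 0)"
    by (rule order_tendstoD(2)[of _ 0]) (use g in \<open>auto simp: gen_rel_def\<close>)
  then obtain d where d: "d > 0" "\<And>t. 0 < t \<Longrightarrow> t < d \<Longrightarrow> nrm (\<lambda>x. (P t G x - G x) / t - g x) < 1"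
    unfolding eventually_at_right_field by auto
  define L where "L = 1 + nrm g + 2 * nrm G / d"
  have "nrm (\<lambda>x. P t G x - G x) \<le> L * t" if t: "t \<ge> 0" for t
  proof -
    consider "t = 0" | "0 < t \<and> t < d" | "t \<ge> d" using t by linarith
    then show ?thesis
    proof cases
      case 1
      then have "nrm (\<lambda>x. P t G x - G x) = nrm (\<lambda>x. 0)"
        using P_zero bdd_measD[OF G] by (intro Lp_norm_cong) auto
      then show ?thesis using 1 by (simp add: Lp_norm_2)
    next
      case 2
      have D: "(\<lambda>x. (P t G x - G x) / t) \<in> Lp_space \<mu> 2"
        using G t by (simp add: bdd_L2 bdd_meas_divide bdd_meas_diff P_bdd)
      have "nrm (\<lambda>x. P t G x - G x) = nrm (\<lambda>x. t * (((P t G x - G x) / t - g x) + g x))"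
        using 2 by (intro Lp_norm_cong) simp
      also have "\<dots> = t * nrm (\<lambda>x. ((P t G x - G x) / t - g x) + g x)" using t by (subst Lp_norm_2_scale) simp
      also have "\<dots> \<le> t * (nrm (\<lambda>x. (P t G x - G x) / t - g x) + nrm g)"
        using t by (intro mult_left_mono Minkowski_L2 L2_diff D Lg)
      also have "\<dots> \<le> t * L"
      proof (intro mult_left_mono)
        have "0 \<le> 2 * nrm G / d" using d(1) by simp
        then show "nrm (\<lambda>x. (P t G x - G x) / t - g x) + nrm g \<le> L" using d(2)[of t] 2 unfolding L_def by linarith
      qed (use t in simp)
      finally show ?thesis by (simp add: mult.commute)
    next
      case 3
      have "nrm (\<lambda>x. P t G x - G x) = nrm (\<lambda>x. P t G x + (-1) * G x)" by simp
      also have "\<dots> \<le> nrm (P t G) + nrm (\<lambda>x. (-1) * G x)"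
        using G t by (intro nrm_triangle bdd_meas_mult bdd_meas_const P_bdd)
      also have "\<dots> \<le> 2 * nrm G" using P_contraction[OF t G] Lp_norm_2_scale[of \<mu> "-1" G] by simp
      also have "\<dots> = 2 * nrm G / d * d" using d by simp
      also have "\<dots> \<le> 2 * nrm G / d * t" using 3 d by (intro mult_left_mono) auto
      also have "\<dots> \<le> L * t" using t by (intro mult_right_mono) (auto simp: L_def)
      finally show ?thesis .
    qed
  qed
  then show ?thesis by (rule that)
qed

section \<open>Kernels acting on integrable functions, and truncation\<close>

lemma Lp_integrable:
  assumes f: "f \<in> Lp_space \<mu> p" and p: "p \<ge> 1"
  shows "integrable \<mu> f"
proof (rule Bochner_Integration.integrable_bound)
  show "integrable \<mu> (\<lambda>x. 1 + \<bar>f x\<bar> powr p)" using f by (simp add: Lp_space_def)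
  show "f \<in> borel_measurable \<mu>" using f by (simp add: Lp_space_def)
  have "\<bar>f x\<bar> \<le> 1 + \<bar>f x\<bar> powr p" for x
  proof (cases "\<bar>f x\<bar> \<le> 1")
    case False
    then have "\<bar>f x\<bar> powr 1 \<le> \<bar>f x\<bar> powr p" using p by (intro powr_mono) auto
    then show ?thesis using False by simp
  qed (simp add: add_increasing2)
  then show "AE x in \<mu>. norm (f x) \<le> norm (1 + \<bar>f x\<bar> powr p)" by (intro AE_I2) (simp add: abs_of_nonneg)
qed

text \<open>By invariance \<open>\<mu>\<close> is the average of the laws \<open>K t x\<close>.
  Positivity of \<open>f\<close> is known only almost everywhere and reaches the kernels in this
  way.\<close>

lemma AE_kernel:
  assumes t: "t \<ge> 0" and Q: "Measurable.pred \<mu> Q" "AE y in \<mu>. Q y"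
  shows "AE x in \<mu>. AE y in K t x. Q y"
proof -
  have "bind \<mu> (K t) = \<mu>" using process t by (simp add: markov_process_def)
  then have "AE y in bind \<mu> (K t). Q y" using Q(2) by (simp only:)
  then show ?thesis by (rule AE_bind[OF kernel_sub[OF t] Q(1), THEN iffD1])
qed

text \<open>Invariance makes the iterated integral of |f| finite; so \<open>P t f x\<close> is a
  genuine integral almost everywhere, not the default value 0.\<close>

lemma AE_kernel_integrable:
  fixes f :: "'a \<Rightarrow> real"
  assumes t: "t \<ge> 0" and f: "integrable \<mu> f"
  shows "AE x in \<mu>. integrable (K t x) f"
proof -
  have fm: "f \<in> borel_measurable \<mu>" using f by simp
  have bind: "bind \<mu> (K t) = \<mu>" using process t by (simp add: markov_process_def)
  have m: "(\<lambda>x. \<integral>\<^sup>+y. ennreal (norm (f y)) \<partial>K t x) \<in> borel_measurable \<mu>"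
    using fm by (intro measurable_compose[OF kernel_sub[OF t] nn_integral_measurable_subprob_algebra]) simp
  have "(\<integral>\<^sup>+x. \<integral>\<^sup>+y. ennreal (norm (f y)) \<partial>K t x \<partial>\<mu>) = (\<integral>\<^sup>+y. ennreal (norm (f y)) \<partial>\<mu>)"
    using fm by (subst (2) bind[symmetric], subst nn_integral_bind[OF _ kernel_sub[OF t]]) auto
  also have "\<dots> < \<infinity>" using f by (simp add: integrable_iff_bounded)
  finally have "AE x in \<mu>. (\<integral>\<^sup>+y. ennreal (norm (f y)) \<partial>K t x) \<noteq> \<infinity>"
    by (intro nn_integral_PInf_AE[OF m]) simp
  then show ?thesis using AE_space
  proof eventually_elim
    case (elim x)
    then show ?case using fm t by (intro integrableI_bounded) (auto simp: kernelD less_top)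
  qed
qed

text \<open>Cut on both sides, to land in an interval bounded away from 0; n + 1 keeps the bounds
  meaningful at n = 0.\<close>

definition truncation :: "('a \<Rightarrow> real) \<Rightarrow> nat \<Rightarrow> 'a \<Rightarrow> real" where
  "truncation f n x = max (1 / (real n + 1)) (min (real n + 1) (f x))"

lemma truncation_valued_in:
  assumes "f \<in> borel_measurable \<mu>"
  shows "truncation f n \<in> valued_in \<mu> (1 / (real n + 1)) (real n + 1)"
proof -
  have "1 / (real n + 1) \<le> real n + 1" by (simp add: field_simps)
  then show ?thesis using assms
    unfolding truncation_def[abs_def] valued_in_def by auto
qed

lemma truncation_tendsto:
  assumes "0 \<le> f x" shows "(\<lambda>n. truncation f n x) \<longlonglongrightarrow> f x"
proof -
  have "(\<lambda>n. 1 / (real n + 1)) \<longlonglongrightarrow> 0"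
    using LIMSEQ_inverse_real_of_nat by (simp add: inverse_eq_divide add.commute)
  moreover have "(\<lambda>n. min (real n + 1) (f x)) \<longlonglongrightarrow> f x"
  proof (rule tendsto_eventually)
    obtain N :: nat where "f x \<le> real N" using real_arch_simple by blast
    then show "eventually (\<lambda>n. min (real n + 1) (f x) = f x) sequentially"
      by (intro eventually_sequentiallyI[of N]) auto
  qed
  ultimately have "(\<lambda>n. max (1 / (real n + 1)) (min (real n + 1) (f x))) \<longlonglongrightarrow> max 0 (f x)"
    by (rule tendsto_max)
  then show ?thesis using assms by (simp add: truncation_def)
qed

lemma truncation_le: "0 \<le> f x \<Longrightarrow> truncation f n x \<le> f x + 1"
  by (auto simp: truncation_def max_def min_def field_simps)

lemma truncation_pos: "0 < truncation f n x"
  by (simp add: truncation_def less_max_iff_disj)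

text \<open>Dominated convergence inside each kernel with majorant f + 1. The sequence need not be
  monotone, since the lower cut falls while the upper one rises; the 1 pays for raising small
  values.\<close>

lemma P_truncation:
  assumes t: "t \<ge> 0" and f: "integrable \<mu> f" "AE x in \<mu>. 0 \<le> f x"
  shows "AE x in \<mu>. (\<lambda>n. P t (truncation f n) x) \<longlonglongrightarrow> P t f x \<and> 0 \<le> P t f x
    \<and> (\<forall>n. 0 \<le> P t (truncation f n) x \<and> P t (truncation f n) x \<le> P t f x + 1)"
proof -
  have fm: "f \<in> borel_measurable \<mu>" using f by simp
  have "AE x in \<mu>. AE y in K t x. 0 \<le> f y"
    using f fm by (intro AE_kernel[OF t]) simp_all
  then show ?thesis using AE_kernel_integrable[OF t f(1)] AE_space
  proof eventually_elim
    case (elim x)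
    interpret k: prob_space "K t x" using t elim by (intro kernelD)
    have ft: "truncation f n \<in> borel_measurable (K t x)" for n
      using valued_inD[OF truncation_valued_in[OF fm]] t elim by (simp add: kernelD)
    have int: "integrable (K t x) (truncation f n)" for n
      using t elim by (intro bdd_integrable_kernel valued_in_bdd[OF truncation_valued_in[OF fm]])
    have "(\<lambda>n. \<integral>y. truncation f n y \<partial>K t x) \<longlonglongrightarrow> (\<integral>y. f y \<partial>K t x)"
    proof (rule integral_dominated_convergence[where w="\<lambda>y. f y + 1"])
      show "AE y in K t x. (\<lambda>n. truncation f n y) \<longlonglongrightarrow> f y"
        using elim(1) by eventually_elim (rule truncation_tendsto)
      show "AE y in K t x. norm (truncation f n y) \<le> f y + 1" for n
        using elim(1) by eventually_elim (use truncation_pos truncation_le in \<open>simp add: less_imp_le\<close>)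
    qed (use elim ft in auto)
    moreover have "0 \<le> P t f x" unfolding markov_op_def using elim(1) by (rule integral_nonneg_AE)
    moreover have "0 \<le> P t (truncation f n) x" for n
      unfolding markov_op_def using truncation_pos by (intro Bochner_Integration.integral_nonneg) (simp add: less_imp_le)
    moreover have "P t (truncation f n) x \<le> P t f x + 1" for n
    proof -
      have "AE y in K t x. truncation f n y \<le> f y + 1"
        using elim(1) by eventually_elim (rule truncation_le)
      then have "(\<integral>y. truncation f n y \<partial>K t x) \<le> (\<integral>y. f y + 1 \<partial>K t x)"
        using elim int by (intro integral_mono_AE) auto
      then show ?thesis using elim by (simp add: markov_op_def k.prob_space)
    qed
    ultimately show ?case by (simp add: markov_op_def)
  qed
qed

end

lemma powr_add_one_le:
  fixes x q :: real
  assumes "0 \<le> x" "0 \<le> q" shows "(x + 1) powr q \<le> 2 powr q * (x powr q + 1)"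
proof -
  have "(x + 1) powr q \<le> (2 * max x 1) powr q" using assms by (intro powr_mono2) auto
  also have "\<dots> = 2 powr q * (max x 1) powr q" by (rule powr_mult)
  also have "(max x 1) powr q \<le> x powr q + 1" by (simp add: max_def)
  finally show ?thesis by simp
qed

section \<open>From bounded data to all positive functions in L^p\<close>

context lsi_mixture
begin

text \<open>The approximants share the bounds of \<open>h\<close>, and contraction carries their L^2
  convergence to every later time, so the potentials converge.\<close>

lemma potential_nonincreasing:
  assumes p: "p > 1" and h: "h \<in> valued_in \<mu> a b" "0 < a" "a \<le> b" and st: "0 \<le> s" "s \<le> t"
  shows "potential p h t \<le> potential p h s"
proof -
  obtain G where G: "\<And>n::nat. G n \<in> valued_in \<mu> a b" "\<And>n. G n \<in> gen_dom \<mu> K"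
    "(\<lambda>n. nrm (\<lambda>x. G n x - h x)) \<longlonglongrightarrow> 0"
  proof (rule domain_approximation[OF h(1,3)], goal_cases)
    case (1 G)
    show ?case by (rule 1(1)[OF 1(2,3,4)])
  qed
  have hb: "h \<in> bdd_meas \<mu>" and Gb: "G n \<in> bdd_meas \<mu>" for n using h G(1) by (auto intro: valued_in_bdd)
  have lim: "(\<lambda>n. potential p (G n) r) \<longlonglongrightarrow> potential p h r" if r: "r \<ge> 0" for r
  proof -
    have "(\<lambda>n. nrm (\<lambda>x. P r (G n) x - P r h x)) \<longlonglongrightarrow> 0"
      by (rule Lim_null_comparison[OF always_eventually G(3)]) (use P_contraction_diff[OF r Gb hb] in simp)
    then have "(\<lambda>n. \<integral>x. P r (G n) x powr expo p r \<partial>\<mu>) \<longlonglongrightarrow> (\<integral>x. P r h x powr expo p r \<partial>\<mu>)"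
      using expo_gt_1[OF p, of r] P_valued_in[OF r G(1)]
      by (intro integral_tendsto_valued_in[OF powr_continuous_on_strip(1)[OF h(2), of b "expo p r"] _ P_valued_in[OF r h(1)]]) auto
    moreover have "(\<integral>x. P r h x powr expo p r \<partial>\<mu>) \<noteq> 0"
      using integral_powr_pos[OF P_valued_in[OF r h(1)] h(2), of "expo p r"] by simp
    ultimately show ?thesis
      unfolding potential_def using expo_gt_1[OF p, of r] by (intro tendsto_intros) auto
  qed
  have "potential p (G n) t \<le> potential p (G n) s" for n
  proof -
    obtain L where "\<And>t. t \<ge> 0 \<Longrightarrow> nrm (\<lambda>x. P t (G n) x - G n x) \<le> L * t"
      using gen_dom_lipschitz[OF G(2) Gb] by metis
    then show ?thesis by (rule potential_nonincreasing_lipschitz[OF p G(1) h(2,3) _ st])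
  qed
  then show ?thesis using lim[of t] lim[of s] st by (intro LIMSEQ_le) auto
qed

definition ratio :: "real \<Rightarrow> ('a \<Rightarrow> real) \<Rightarrow> real \<Rightarrow> real" where
  "ratio p f t = Lp_norm \<mu> (expo p t) (P t f) / ws powr (1 / expo p t)"

lemma exp_potential:
  assumes p: "p > 1" and h: "h \<in> valued_in \<mu> a b" "0 < a" and t: "t \<ge> 0"
  shows "ratio p h t = exp (potential p h t)"
proof -
  let ?N = "\<integral>x. P t h x powr expo p t \<partial>\<mu>"
  have N: "?N > 0" by (rule integral_powr_pos[OF P_valued_in[OF t h(1)] h(2)])
  have "(\<integral>x. \<bar>P t h x\<bar> powr expo p t \<partial>\<mu>) = ?N"
    using valued_in_bounds[OF P_valued_in[OF t h(1)]] h(2)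
    by (intro Bochner_Integration.integral_cong) (auto simp: abs_of_pos less_le_trans)
  then have "ratio p h t = exp (ln ?N / expo p t) / exp (ln ws / expo p t)"
    unfolding ratio_def Lp_norm_def using N weights(1) by (simp add: powr_def)
  also have "\<dots> = exp (potential p h t)"
    using weights(1) by (simp add: potential_def exp_diff[symmetric] diff_divide_distrib add_divide_distrib ln_div)
  finally show ?thesis .
qed

text \<open>At the earlier time the truncations converge by dominated convergence, for which
  membership in L^q(s) is assumed; at the later time Fatou gives the bound and the membership in
  L^q(t) together.\<close>

lemma ratio_nonincreasing:
  assumes p: "p > 1" and f: "integrable \<mu> f" "AE x in \<mu>. 0 \<le> f x" and st: "0 \<le> s" "s \<le> t"
    and fs: "P s f \<in> Lp_space \<mu> (expo p s)"
  shows "P t f \<in> Lp_space \<mu> (expo p t)" "ratio p f t \<le> ratio p f s"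
proof -
  let ?f = "truncation f"
  let ?qs = "expo p s" and ?qt = "expo p t"
  have t: "t \<ge> 0" using st by simp
  have q: "?qs > 1" "?qt > 1" using expo_gt_1[OF p] by auto
  have fm: "f \<in> borel_measurable \<mu>" using f by simp
  have v: "?f n \<in> valued_in \<mu> (1 / (real n + 1)) (real n + 1)" for n by (rule truncation_valued_in[OF fm])
  have pos: "0 < 1 / (real n + 1)" "1 / (real n + 1) \<le> real n + 1" for n by (auto simp: field_simps)
  have le: "ratio p (?f n) t \<le> ratio p (?f n) s" for n
    using potential_nonincreasing[OF p v pos st, of n] exp_potential[OF p v pos(1)] st by simp
  have Pm: "P r (?f n) \<in> borel_measurable \<mu>" "P r f \<in> borel_measurable \<mu>" if "r \<ge> 0" for r n
    using P_measurable[OF that] fm valued_inD[OF v] by auto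
  have "(\<lambda>n. \<integral>x. \<bar>P s (?f n) x\<bar> powr ?qs \<partial>\<mu>) \<longlonglongrightarrow> (\<integral>x. \<bar>P s f x\<bar> powr ?qs \<partial>\<mu>)"
  proof (rule integral_dominated_convergence[where w="\<lambda>x. 2 powr ?qs * (\<bar>P s f x\<bar> powr ?qs + 1)"])
    show "integrable \<mu> (\<lambda>x. 2 powr ?qs * (\<bar>P s f x\<bar> powr ?qs + 1))"
      using fs by (simp add: Lp_space_def)
    show "AE x in \<mu>. (\<lambda>n. \<bar>P s (?f n) x\<bar> powr ?qs) \<longlonglongrightarrow> \<bar>P s f x\<bar> powr ?qs"
      using P_truncation[OF st(1) f]
    proof eventually_elim
      case (elim x)
      then have "(\<lambda>n. \<bar>P s (?f n) x\<bar>) \<longlonglongrightarrow> \<bar>P s f x\<bar>" by (intro tendsto_rabs) simp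
      then show ?case using q by (intro tendsto_powr') auto
    qed
    show "AE x in \<mu>. norm (\<bar>P s (?f n) x\<bar> powr ?qs) \<le> 2 powr ?qs * (\<bar>P s f x\<bar> powr ?qs + 1)" for n
      using P_truncation[OF st(1) f]
    proof eventually_elim
      case (elim x)
      then have "\<bar>P s (?f n) x\<bar> powr ?qs \<le> (\<bar>P s f x\<bar> + 1) powr ?qs" using q by (intro powr_mono2) auto
      also have "\<dots> \<le> 2 powr ?qs * (\<bar>P s f x\<bar> powr ?qs + 1)" using q by (intro powr_add_one_le) auto
      finally show ?case by simp
    qed
  qed (use Pm[OF st(1)] in measurable)
  then have "(\<lambda>n. Lp_norm \<mu> ?qs (P s (?f n))) \<longlonglongrightarrow> Lp_norm \<mu> ?qs (P s f)"
    unfolding Lp_norm_def using q by (intro tendsto_powr') (auto intro!: Bochner_Integration.integral_nonneg)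
  then have "(\<lambda>n. ratio p (?f n) s) \<longlonglongrightarrow> ratio p f s"
    unfolding ratio_def using weights(1) by (intro tendsto_divide tendsto_const) auto
  then have lim: "(\<lambda>n. (ratio p (?f n) s * ws powr (1 / ?qt)) powr ?qt) \<longlonglongrightarrow> (ratio p f s * ws powr (1 / ?qt)) powr ?qt"
    using q by (intro tendsto_powr' tendsto_mult tendsto_const) (auto simp: ratio_def Lp_norm_def)
  have r0: "0 \<le> ratio p g r" for g r by (simp add: ratio_def Lp_norm_def)
  have bound: "(\<integral>\<^sup>+x. ennreal (\<bar>P t (?f n) x\<bar> powr ?qt) \<partial>\<mu>) \<le> ennreal ((ratio p (?f n) s * ws powr (1 / ?qt)) powr ?qt)" for n
  proof -
    let ?N = "\<integral>x. \<bar>P t (?f n) x\<bar> powr ?qt \<partial>\<mu>"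
    have "P t (?f n) \<in> valued_in \<mu> (1 / (real n + 1)) (real n + 1)" by (rule P_valued_in[OF t v])
    moreover have "continuous_on {1 / (real n + 1)..real n + 1} (\<lambda>x. \<bar>x\<bar> powr ?qt)"
      using pos(1)[of n] by (intro continuous_intros) auto
    ultimately have i: "integrable \<mu> (\<lambda>x. \<bar>P t (?f n) x\<bar> powr ?qt)"
      by (intro bdd_integrable valued_in_comp_bdd[where \<phi>="\<lambda>x. \<bar>x\<bar> powr ?qt"])
    have "?N = (Lp_norm \<mu> ?qt (P t (?f n))) powr ?qt"
      unfolding Lp_norm_def using q by (simp add: powr_powr Bochner_Integration.integral_nonneg)
    also have "\<dots> = (ratio p (?f n) t * ws powr (1 / ?qt)) powr ?qt"
      using weights(1) by (simp add: ratio_def)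
    also have "\<dots> \<le> (ratio p (?f n) s * ws powr (1 / ?qt)) powr ?qt"
      using le[of n] q r0 by (intro powr_mono2 mult_right_mono) auto
    finally show ?thesis using i by (subst nn_integral_eq_integral) (auto intro: ennreal_leI)
  qed
  \<comment> \<open>Fatou is run on nonnegative integrals, because a Bochner integral would silently
    be 0 if the limit were not integrable.\<close>
  have "(\<integral>\<^sup>+x. ennreal (\<bar>P t f x\<bar> powr ?qt) \<partial>\<mu>) = (\<integral>\<^sup>+x. liminf (\<lambda>n. ennreal (\<bar>P t (?f n) x\<bar> powr ?qt)) \<partial>\<mu>)"
  proof (intro nn_integral_cong_AE)
    show "AE x in \<mu>. ennreal (\<bar>P t f x\<bar> powr ?qt) = liminf (\<lambda>n. ennreal (\<bar>P t (?f n) x\<bar> powr ?qt))"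
      using P_truncation[OF t f]
    proof eventually_elim
      case (elim x)
      then have "(\<lambda>n. \<bar>P t (?f n) x\<bar>) \<longlonglongrightarrow> \<bar>P t f x\<bar>" by (intro tendsto_rabs) simp
      then have "(\<lambda>n. ennreal (\<bar>P t (?f n) x\<bar> powr ?qt)) \<longlonglongrightarrow> ennreal (\<bar>P t f x\<bar> powr ?qt)"
        using q by (intro tendsto_ennrealI tendsto_powr') auto
      then show ?case by (intro lim_imp_Liminf[symmetric]) auto
    qed
  qed
  also have "\<dots> \<le> liminf (\<lambda>n. \<integral>\<^sup>+x. ennreal (\<bar>P t (?f n) x\<bar> powr ?qt) \<partial>\<mu>)"
    using Pm[OF t] by (intro nn_integral_liminf) simp
  also have "\<dots> \<le> liminf (\<lambda>n. ennreal ((ratio p (?f n) s * ws powr (1 / ?qt)) powr ?qt))"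
    using bound by (intro Liminf_mono always_eventually) auto
  also have "\<dots> = ennreal ((ratio p f s * ws powr (1 / ?qt)) powr ?qt)"
    using tendsto_ennrealI[OF lim] by (intro lim_imp_Liminf) auto
  finally have fin: "(\<integral>\<^sup>+x. ennreal (\<bar>P t f x\<bar> powr ?qt) \<partial>\<mu>) \<le> ennreal ((ratio p f s * ws powr (1 / ?qt)) powr ?qt)" .
  then have "(\<integral>\<^sup>+x. ennreal (\<bar>P t f x\<bar> powr ?qt) \<partial>\<mu>) < \<infinity>" by (rule le_less_trans) simp
  then have i: "integrable \<mu> (\<lambda>x. \<bar>P t f x\<bar> powr ?qt)"
    using Pm(2)[OF t] by (intro integrableI_nonneg) auto
  then show "P t f \<in> Lp_space \<mu> ?qt" using Pm(2)[OF t] by (simp add: Lp_space_def)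
  let ?N = "\<integral>x. \<bar>P t f x\<bar> powr ?qt \<partial>\<mu>"
  have "ennreal ?N \<le> ennreal ((ratio p f s * ws powr (1 / ?qt)) powr ?qt)"
    using fin i by (subst (asm) nn_integral_eq_integral) auto
  then have "?N \<le> (ratio p f s * ws powr (1 / ?qt)) powr ?qt" by (subst (asm) ennreal_le_iff) auto
  then have "?N powr (1 / ?qt) \<le> ((ratio p f s * ws powr (1 / ?qt)) powr ?qt) powr (1 / ?qt)"
    using q by (intro powr_mono2) (auto intro!: Bochner_Integration.integral_nonneg)
  also have "\<dots> = ratio p f s * ws powr (1 / ?qt)"
    using q r0[of f s] by (simp add: powr_powr)
  finally show "ratio p f t \<le> ratio p f s"
    unfolding ratio_def[of p f t] Lp_norm_def using weights(1) by (simp add: divide_le_eq)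
qed

end

theorem lemma29:
  fixes \<pi> :: "'a measure" and K :: "real \<Rightarrow> 'a \<Rightarrow> 'a measure"
    and m :: nat and w c :: "nat \<Rightarrow> real"
    and \<pi>k :: "nat \<Rightarrow> 'a measure" and Kk :: "nat \<Rightarrow> real \<Rightarrow> 'a \<Rightarrow> 'a measure"
    and p Cs ws :: real and q :: "real \<Rightarrow> real" and f :: "'a \<Rightarrow> real"
  assumes process: "markov_process \<pi> K" "reversible \<pi> K"
    and mix: "mixture m w \<pi>k \<pi>"
    and processes: "\<And>k. k \<in> {1..m} \<Longrightarrow> markov_process (\<pi>k k) (Kk k)"
    and decomposition: "\<And>g. g \<in> gen_dom \<pi> K \<Longrightarrow>
      ereal (inner_L2 \<pi> g (gen \<pi> K g)) \<le> (\<Sum>k=1..m. ereal (w k) * gen_form (\<pi>k k) (Kk k) g)"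
    and log_sobolev: "\<And>k g. k \<in> {1..m} \<Longrightarrow> g \<in> gen_dom (\<pi>k k) (Kk k) \<Longrightarrow>
      integrable (\<pi>k k) (\<lambda>x. (g x)\<^sup>2 * ln ((g x)\<^sup>2)) \<Longrightarrow>
      Ent (\<pi>k k) (\<lambda>x. (g x)\<^sup>2) \<le> 2 * c k * dirichlet_form (\<pi>k k) (Kk k) g g"
    and p: "p > 1"
    and Cs: "Cs = Max (c ` {1..m})" "Cs > 0"
    and ws: "ws = Min (w ` {1..m})"
    and q: "\<And>t. q t = 1 + (p - 1) * exp (2 * t / Cs)"
    and f: "f \<in> Lp_space \<pi> p" "AE x in \<pi>. f x > 0"
  shows "(\<forall>t\<ge>0. markov_op K t f \<in> Lp_space \<pi> (q t)) \<and>
    antimono_on {0..} (\<lambda>t. Lp_norm \<pi> (q t) (markov_op K t f) / ws powr (1 / q t)) \<and>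
    (\<forall>t\<ge>0. Lp_norm \<pi> (q t) (markov_op K t f) / ws powr (1 / q t)
              \<le> Lp_norm \<pi> p f / ws powr (1 / p)) \<and>
    (\<forall>t\<ge>0. Lp_norm \<pi> (q t) (markov_op K t f) \<le> theta ws (q t) p * Lp_norm \<pi> p f)"
proof -
  interpret lsi_mixture \<pi> K m w c \<pi>k Kk Cs ws
    using process mix processes decomposition log_sobolev Cs ws
    by (intro lsi_mixture.intro lsi_mixture_axioms.intro markov.intro markov_axioms.intro)
      (simp_all add: markov_process_def)
  have qe: "q t = expo p t" for t by (simp add: q expo_def)
  have q0: "expo p 0 = p" by (simp add: expo_def)
  have fi: "integrable \<pi> f" using f(1) p by (intro Lp_integrable) auto
  have fm: "f \<in> borel_measurable \<pi>" using fi by simp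
  have fn: "AE x in \<pi>. 0 \<le> f x" using f(2) by eventually_elim simp
  have z: "markov_op K 0 f x = f x" if "x \<in> space \<pi>" for x using P_zero[OF that fm] .
  have "markov_op K 0 f \<in> Lp_space \<pi> p"
    using f(1) P_measurable[OF _ fm, of 0] z
    by (simp add: Lp_space_def cong: Bochner_Integration.integrable_cong)
  then have P0: "markov_op K 0 f \<in> Lp_space \<pi> (expo p 0)" by (simp add: q0)
  \<comment> \<open>Comparison with time 0 gives membership at all times, and this in turn is the
    premise for comparing two arbitrary times.\<close>
  have mem: "markov_op K t f \<in> Lp_space \<pi> (q t)" if "t \<ge> 0" for t
    unfolding qe using ratio_nonincreasing(1)[OF p fi fn _ that P0] by simp
  have mono: "ratio p f t \<le> ratio p f s" if "0 \<le> s" "s \<le> t" for s t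
    using ratio_nonincreasing(2)[OF p fi fn that] mem[OF that(1)] by (simp add: qe)
  have r: "ratio p f t = Lp_norm \<pi> (q t) (markov_op K t f) / ws powr (1 / q t)" for t
    by (simp add: ratio_def qe)
  have r0: "ratio p f 0 = Lp_norm \<pi> p f / ws powr (1 / p)"
    unfolding ratio_def q0 using Lp_norm_cong[of \<pi> "markov_op K 0 f" f p] z by simp
  have bound: "Lp_norm \<pi> (q t) (markov_op K t f) / ws powr (1 / q t) \<le> Lp_norm \<pi> p f / ws powr (1 / p)"
    if "t \<ge> 0" for t
    using mono[OF order_refl that] unfolding r0 unfolding r .
  have "antimono_on {0..} (\<lambda>t. Lp_norm \<pi> (q t) (markov_op K t f) / ws powr (1 / q t))"
    using mono by (intro monotone_onI) (simp add: r)
  moreover have "Lp_norm \<pi> (q t) (markov_op K t f) \<le> theta ws (q t) p * Lp_norm \<pi> p f" if "t \<ge> 0" for t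
  proof -
    have "theta ws (q t) p = ws powr (1 / q t) / ws powr (1 / p)"
      using weights(1) by (simp add: theta_def powr_divide powr_diff)
    then show ?thesis using bound[OF that] weights(1) by (simp add: divide_le_eq mult.commute)
  qed
  ultimately show ?thesis using mem bound by blast
qed

end
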